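(* There exists a critical speed $c_0\in(0,c_s)$ such that for every $c\in(c_0,c_s)$ there exists a non-constant smooth solution $Q_c=(\eta_c,v_c)\in\mathcal{NX}^2$ of $(TW_{c,hy})$, unique up to translations. Normalizing $\eta_c,v_c$ to be even, the map $c\mapsto Q_c$ belongs to $\mathcal C^2\big((c_0,c_s),\mathcal{NX}^2\big)$, and for every $c\in(c_0,c_s)$, $$\frac{d}{dc}\big(p(Q_c)\big)<0.$$ Moreover there exist constants $a_d,K_d>0$, independent of $c\in(c_0,c_s)$ and of $x\in\mathbb R$, such that for all $c\in(c_0,c_s)$ and $x\in\mathbb R$, $$\sum_{\substack{0\le k_1\le 3\\0\le k_2\le 2\\0\le j\le 2}}(c_s^2-c^2)^{j-1}\Big(|\partial_c^j\partial_x^{k_1}\eta_c(x)|+c^{1+2j+2k_2}|\partial_c^j\partial_x^{k_2}v_c(x)|\Big)\le K_d\,e^{-a_d\sqrt{c_s^2-c^2}\,|x|}.$$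
   Context: Standing assumptions: $f\in\mathcal C^3(\mathbb R_+)$ with $f(1)=0$ and $f'(1)<0$; $c_s:=\sqrt{-2f'(1)}$; $F(r):=\int_r^1 f(\rho)\,d\rho$. Assume (H1) $\frac{c_s^2}{4}(1-\rho)^2\le F(\rho)$ for all $\rho$; (H2) there exist $M\ge 0$, $q\in[2,\infty)$ with $F(\rho)\le M|1-\rho|^q$ for all $\rho\ge 2$; (H3) $f''(1)+3f'(1)\neq 0$. For $k\ge 0$, $\mathcal X^k:=H^{k+1}(\mathbb R)\times H^k(\mathbb R)$ with norm $\|(\eta,v)\|_{\mathcal X^k}^2=\|\eta\|_{H^{k+1}}^2+\|v\|_{H^k}^2$, and $\mathcal{NX}^k:=\{(\eta,v)\in\mathcal X^k:\ \sup_{\mathbb R}\eta<1\}$; $\mathcal X:=\mathcal X^0$, $\mathcal{NX}:=\mathcal{NX}^0$. Energy $E(\eta,v)=\frac18\int\frac{(\partial_x\eta)^2}{1-\eta}+\frac12\int(1-\eta)v^2+\frac12\int F(1-\eta)$ and momentum $p(\eta,v)=\frac12\int_{\mathbb R}\eta v$. The hydrodynamical travelling wave equation of speed $c$, $(TW_{c,hy})$, for $(\eta,v)$ is: $\frac c2\eta=v(1-\eta)$ and $cv=f(1-\eta)-v^2-\frac{\eta''}{2(1-\eta)}-\frac{(\eta')^2}{4(1-\eta)^2}$.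
   Formalization: Since f is only C^3, a C^∞ solution need not exist; "smooth" is read as: η_c and v_c solve the equation classically, lie in NX^2, and have all the classical derivatives in c and x that appear in the decay estimate. *)

theory Defs
  imports "HOL-Analysis.Analysis"
begin

definition L2fun :: "(real \<Rightarrow> real) \<Rightarrow> bool" where
  "L2fun u \<longleftrightarrow> u \<in> borel_measurable lborel \<and> integrable lborel (\<lambda>x. (u x)^2)"

definition test_fun :: "(real \<Rightarrow> real) \<Rightarrow> bool" where
  "test_fun \<phi> \<longleftrightarrow>
     (\<forall>n x. ((deriv ^^ n) \<phi> has_real_derivative (deriv ^^ Suc n) \<phi> x) (at x)) \<and>
     (\<exists>R. \<forall>x. R < \<bar>x\<bar> \<longrightarrow> \<phi> x = 0)"

definition is_weak_deriv :: "nat \<Rightarrow> (real \<Rightarrow> real) \<Rightarrow> (real \<Rightarrow> real) \<Rightarrow> bool" where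
  "is_weak_deriv n u g \<longleftrightarrow>
     (\<forall>\<phi>. test_fun \<phi> \<longrightarrow>
        integrable lborel (\<lambda>x. u x * (deriv ^^ n) \<phi> x) \<and>
        integrable lborel (\<lambda>x. g x * \<phi> x) \<and>
        (LINT x|lborel. u x * (deriv ^^ n) \<phi> x) = (-1)^n * (LINT x|lborel. g x * \<phi> x))"

text \<open>Membership in H^k(R), k \<ge> 1, identifying an element with its continuous representative.\<close>
definition in_H :: "nat \<Rightarrow> (real \<Rightarrow> real) \<Rightarrow> bool" where
  "in_H k u \<longleftrightarrow> continuous_on UNIV u \<and> (\<forall>i\<le>k. \<exists>g. L2fun g \<and> is_weak_deriv i u g)"

definition weak_deriv :: "nat \<Rightarrow> (real \<Rightarrow> real) \<Rightarrow> (real \<Rightarrow> real)" where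
  "weak_deriv i u = (SOME g. L2fun g \<and> is_weak_deriv i u g)"

definition H_norm_sq :: "nat \<Rightarrow> (real \<Rightarrow> real) \<Rightarrow> real" where
  "H_norm_sq k u = (\<Sum>i\<le>k. LINT x|lborel. (weak_deriv i u x)^2)"

definition in_X :: "nat \<Rightarrow> (real \<Rightarrow> real) \<Rightarrow> (real \<Rightarrow> real) \<Rightarrow> bool" where
  "in_X k \<eta> v \<longleftrightarrow> in_H (k+1) \<eta> \<and> in_H k v"

definition X_norm :: "nat \<Rightarrow> (real \<Rightarrow> real) \<Rightarrow> (real \<Rightarrow> real) \<Rightarrow> real" where
  "X_norm k \<eta> v = sqrt (H_norm_sq (k+1) \<eta> + H_norm_sq k v)"

definition in_NX :: "nat \<Rightarrow> (real \<Rightarrow> real) \<Rightarrow> (real \<Rightarrow> real) \<Rightarrow> bool" where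
  "in_NX k \<eta> v \<longleftrightarrow> in_X k \<eta> v \<and> Sup (range \<eta>) < 1"

definition has_X_deriv ::
  "nat \<Rightarrow> (real \<Rightarrow> real \<Rightarrow> real) \<Rightarrow> (real \<Rightarrow> real \<Rightarrow> real) \<Rightarrow>
   (real \<Rightarrow> real \<Rightarrow> real) \<Rightarrow> (real \<Rightarrow> real \<Rightarrow> real) \<Rightarrow> real \<Rightarrow> bool" where
  "has_X_deriv k E V E' V' c \<longleftrightarrow>
     ((\<lambda>h. X_norm k (\<lambda>x. E (c+h) x - E c x - h * E' c x)
                    (\<lambda>x. V (c+h) x - V c x - h * V' c x) / \<bar>h\<bar>) \<longlongrightarrow> 0) (at 0)"

definition X_continuous_at ::
  "nat \<Rightarrow> (real \<Rightarrow> real \<Rightarrow> real) \<Rightarrow> (real \<Rightarrow> real \<Rightarrow> real) \<Rightarrow> real \<Rightarrow> bool" where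
  "X_continuous_at k E V c \<longleftrightarrow>
     ((\<lambda>c'. X_norm k (\<lambda>x. E c' x - E c x) (\<lambda>x. V c' x - V c x)) \<longlongrightarrow> 0) (at c)"

text \<open>c \<mapsto> (E c, V c) belongs to C^2(I, NX^k) (I open).\<close>
definition C2_NX :: "nat \<Rightarrow> real set \<Rightarrow> (real \<Rightarrow> real \<Rightarrow> real) \<Rightarrow> (real \<Rightarrow> real \<Rightarrow> real) \<Rightarrow> bool" where
  "C2_NX k I E V \<longleftrightarrow>
     (\<exists>E1 V1 E2 V2. \<forall>c\<in>I.
        in_NX k (E c) (V c) \<and> in_X k (E1 c) (V1 c) \<and> in_X k (E2 c) (V2 c) \<and>
        has_X_deriv k E V E1 V1 c \<and> has_X_deriv k E1 V1 E2 V2 c \<and>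
        X_continuous_at k E2 V2 c)"

definition pd :: "(real \<Rightarrow> real \<Rightarrow> real) \<Rightarrow> nat \<Rightarrow> nat \<Rightarrow> real \<Rightarrow> real \<Rightarrow> real" where
  "pd U j k c x = (deriv ^^ j) (\<lambda>c'. (deriv ^^ k) (U c') x) c"

definition has_pds :: "(real \<Rightarrow> real \<Rightarrow> real) \<Rightarrow> real set \<Rightarrow> nat \<Rightarrow> nat \<Rightarrow> bool" where
  "has_pds U I jm km \<longleftrightarrow>
     (\<forall>c\<in>I. \<forall>x.
        (\<forall>k<km. ((deriv ^^ k) (U c) has_real_derivative (deriv ^^ Suc k) (U c) x) (at x)) \<and>
        (\<forall>k\<le>km. \<forall>j<jm. ((\<lambda>c'. pd U j k c' x) has_real_derivative pd U (Suc j) k c x) (at c)))"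

definition Fpot :: "(real \<Rightarrow> real) \<Rightarrow> real \<Rightarrow> real" where
  "Fpot f r = (LBINT \<rho>=r..1. f \<rho>)"

definition momentum :: "(real \<Rightarrow> real) \<Rightarrow> (real \<Rightarrow> real) \<Rightarrow> real" where
  "momentum \<eta> v = (1/2) * (LINT x|lborel. \<eta> x * v x)"

definition TW_hy :: "(real \<Rightarrow> real) \<Rightarrow> real \<Rightarrow> (real \<Rightarrow> real) \<Rightarrow> (real \<Rightarrow> real) \<Rightarrow> bool" where
  "TW_hy f c \<eta> v \<longleftrightarrow>
     (\<forall>x. (\<eta> has_real_derivative deriv \<eta> x) (at x) \<and>
          (deriv \<eta> has_real_derivative deriv (deriv \<eta>) x) (at x) \<and>
          c / 2 * \<eta> x = v x * (1 - \<eta> x) \<and>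
          c * v x = f (1 - \<eta> x) - (v x)^2 - deriv (deriv \<eta>) x / (2 * (1 - \<eta> x))
                    - (deriv \<eta> x)^2 / (4 * (1 - \<eta> x)^2))"

end

theory Submission
  imports Defs "HOL-Real_Asymp.Real_Asymp"
begin

text \<open>Let \<open>\<mu> = cs\<^sup>2 - c\<^sup>2\<close> and \<open>N(e) = cs\<^sup>2 e\<^sup>2 - 4 (1 - e) F(1 - e)\<close>. Eliminating \<open>v\<close> and integrating once, a wave
  that vanishes at infinity satisfies \<open>\<eta>'\<^sup>2 = \<mu> \<eta>\<^sup>2 - N(\<eta>)\<close>, and (H1) forces \<open>N(e) \<sim> cs\<^sup>2 e\<^sup>3\<close> at \<open>0\<close>.
  Let \<open>h\<close> be the inverse of \<open>e \<mapsto> N(e) / e\<^sup>2\<close> near \<open>0\<close> and put \<open>\<eta> = h(\<mu> sech\<^sup>2 s)\<close>. The equation becomes the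
  regular quadrature that \<open>\<surd>\<mu> x / 2\<close> is the integral of \<open>q(\<mu> sech\<^sup>2)\<close> from \<open>0\<close> to \<open>s\<close>, where
  \<open>q(y) = y h'(y) / h(y)\<close> tends to \<open>1\<close> at \<open>0\<close>.

  The functions \<open>h\<close> and \<open>q\<close> have limited smoothness at \<open>0\<close>, but \<open>y d/dy\<close> can be applied to them without
  changing their size. As a consequence \<open>\<mu> d/dc\<close> preserves the size of \<open>\<eta>\<close>, \<open>v\<close> and their derivatives in \<open>x\<close> up to
  powers of \<open>1 + \<surd>\<mu> |x|\<close>, which the exponential decay absorbs: these are the stated estimates. They
  dominate the difference quotients in \<open>c\<close>, which gives the regularity in the Sobolev norms.

  After the same substitution the momentum is \<open>c / (2 \<surd>\<mu>)\<close> times the integral of a function of \<open>\<mu> sech\<^sup>2\<close>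
  that vanishes quadratically at \<open>0\<close>. It behaves like \<open>\<mu>\<close> to the power \<open>3/2\<close>, and decreases with \<open>c\<close>.

  For uniqueness, the first integral of any solution is \<open>0\<close>, (H1) excludes negative values of \<open>\<eta>\<close>, the
  maximum of \<open>\<eta>\<close> is the first positive zero \<open>h(\<mu>)\<close> of \<open>\<mu> e\<^sup>2 - N(e)\<close>, and the Cauchy problem at the
  crest has one solution.\<close>

section \<open>Test functions and weak derivatives\<close>

text \<open>The model case is \<open>N(e) = cs\<^sup>2 e\<^sup>3\<close>: there
  \<open>h(y) = y / cs\<^sup>2\<close>, \<open>q = 1\<close>, and the profile is the Korteweg-de
  Vries soliton \<open>(\<mu> / cs\<^sup>2) sech\<^sup>2 (\<surd>\<mu> x / 2)\<close>. The
  substitution copies it because the direct quadrature of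
  \<open>d\<eta> / \<surd>(\<mu> \<eta>\<^sup>2 - N(\<eta>))\<close> is singular at the crest and
  diverges at \<open>0\<close>; with \<open>N(\<eta>) = \<mu> \<eta>\<^sup>2 sech\<^sup>2 s\<close>
  the root becomes \<open>\<surd>\<mu> \<eta> tanh s\<close>, and both singularities go. The
  obstacle is uniformity as \<open>\<mu>\<close> tends to \<open>0\<close> with few derivatives at
  hand: \<open>f\<close> has three, so \<open>N\<close>, which contains the antiderivative
  \<open>F\<close>, has four. The \<open>x\<close>-derivatives of \<open>\<eta>\<close> are
  therefore read from the equation, not from the quadrature: the third one contains
  \<open>N''\<close>, and two derivatives in \<open>c\<close> then lead to \<open>N''''\<close>. The
  speed \<open>c0\<close> has to be close to \<open>cs\<close> for two reasons: \<open>\<mu>\<close>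
  must stay in the range where \<open>N(e) / e\<^sup>2\<close> is inverted, and
  \<open>\<mu> < 2 c\<^sup>2\<close> is what makes the momentum decrease.\<close>

definition expinv :: "nat \<Rightarrow> real \<Rightarrow> real" where
  "expinv p t = (if t > 0 then exp (- (1/t)) / t ^ p else 0)"

text \<open>Away from \<open>0\<close> this is calculus; at \<open>0\<close> the one-sided quotients
  tend to \<open>0\<close> because \<open>exp (- 1/t)\<close> beats every power of \<open>t\<close>.
  The derivative is again a combination of members of the family, on which the smoothness of the
  bumps rests.\<close>

lemma expinv_has_derivative:
  "(expinv p has_real_derivative - real p * expinv (Suc p) t + expinv (Suc (Suc p)) t) (at t)"
proof -
  consider "t > 0" | "t < 0" | "t = 0" by linarith
  then show ?thesis
  proof cases
    case 1
    have "((\<lambda>t. exp (- (1/t)) / t ^ p) has_real_derivative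
        - real p * expinv (Suc p) t + expinv (Suc (Suc p)) t) (at t)"
    proof (cases p)
      case 0
      then show ?thesis using 1
        by (auto intro!: derivative_eq_intros simp: expinv_def field_simps power2_eq_square)
    next
      case (Suc k)
      have "((\<lambda>t. exp (- (1/t)) / t ^ Suc k) has_real_derivative
          (exp (- (1/t)) * (1 / t^2) * t ^ Suc k - exp (- (1/t)) * (real (Suc k) * t ^ k)) /
            (t ^ Suc k * t ^ Suc k)) (at t)"
      proof (rule DERIV_divide)
        show "((\<lambda>t. exp (- (1/t))) has_real_derivative exp (- (1/t)) * (1 / t^2)) (at t)"
          using 1 by (auto intro!: derivative_eq_intros simp: power2_eq_square)
        show "((\<lambda>t. t ^ Suc k) has_real_derivative real (Suc k) * t ^ k) (at t)"
          using DERIV_pow[of "Suc k" t] by simp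
      qed (use 1 in auto)
      also have "(exp (- (1/t)) * (1 / t^2) * t ^ Suc k - exp (- (1/t)) * (real (Suc k) * t ^ k)) /
            (t ^ Suc k * t ^ Suc k) = - real p * expinv (Suc p) t + expinv (Suc (Suc p)) t"
        using 1 unfolding Suc by (simp add: expinv_def field_simps power2_eq_square)
      finally show ?thesis unfolding Suc .
    qed
    then show ?thesis
      by (rule has_field_derivative_transform_within_open[of _ _ _ "{0<..}"])
        (use 1 in \<open>auto simp: expinv_def\<close>)
  next
    case 2
    have "((\<lambda>t. 0) has_real_derivative
        - real p * expinv (Suc p) t + expinv (Suc (Suc p)) t) (at t)"
      using 2 by (auto simp: expinv_def)
    then show ?thesis
      by (rule has_field_derivative_transform_within_open[of _ _ _ "{..<0}"])
        (use 2 in \<open>auto simp: expinv_def\<close>)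
  next
    case 3
    have "((\<lambda>h. expinv p h / h) \<longlongrightarrow> 0) (at_right 0)"
    proof (rule Lim_transform_eventually)
      show "((\<lambda>h::real. exp (- (1/h)) / h ^ p / h) \<longlongrightarrow> 0) (at_right 0)"
        by real_asymp
      show "\<forall>\<^sub>F h in at_right 0. exp (- (1/h)) / h ^ p / h = expinv p h / h"
        by (auto simp: expinv_def eventually_at_filter)
    qed
    moreover have "((\<lambda>h. expinv p h / h) \<longlongrightarrow> 0) (at_left 0)"
      by (rule tendsto_eventually) (auto simp: expinv_def eventually_at_filter)
    ultimately have "((\<lambda>h. expinv p h / h) \<longlongrightarrow> 0) (at 0)"
      by (simp add: filterlim_at_split)
    then show ?thesis using 3
      by (auto simp: has_field_derivative_iff expinv_def)
  qed
qed

text \<open>The generators are chosen so that the set is closed under differentiation: one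
  derivative step for a generic member then iterates to all orders, without a formula for the
  \<open>n\<close>-th derivative.\<close>

inductive_set bumps :: "(real \<Rightarrow> real) set" where
  const: "(\<lambda>x. k) \<in> bumps"
| expinv: "(\<lambda>x. expinv p (a * x + b)) \<in> bumps"
| add: "u \<in> bumps \<Longrightarrow> v \<in> bumps \<Longrightarrow> (\<lambda>x. u x + v x) \<in> bumps"
| mult: "u \<in> bumps \<Longrightarrow> v \<in> bumps \<Longrightarrow> (\<lambda>x. u x * v x) \<in> bumps"

lemma bumps_derivative:
  assumes "u \<in> bumps"
  shows "\<exists>u'\<in>bumps. \<forall>x. (u has_real_derivative u' x) (at x)"
  using assms
proof induction
  case (const k)
  show ?case by (rule bexI[of _ "\<lambda>x. 0"]) (auto intro: bumps.const)
next
  case (expinv p a b)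
  have "(\<lambda>x. a * (- real p * expinv (Suc p) (a * x + b) + expinv (Suc (Suc p)) (a * x + b))) \<in> bumps"
    by (intro bumps.intros)
  moreover have "((\<lambda>x. expinv p (a * x + b)) has_real_derivative
      a * (- real p * expinv (Suc p) (a * x + b) + expinv (Suc (Suc p)) (a * x + b))) (at x)" for x
    by (rule DERIV_cong[OF DERIV_chain2[OF expinv_has_derivative]])
      (auto intro!: derivative_eq_intros)
  ultimately show ?case by (intro bexI allI)
next
  case (add u v)
  then obtain u' v' where "u' \<in> bumps" "v' \<in> bumps"
    "\<forall>x. (u has_real_derivative u' x) (at x)" "\<forall>x. (v has_real_derivative v' x) (at x)" by blast
  then show ?case
    by (intro bexI[of _ "\<lambda>x. u' x + v' x"]) (auto intro: bumps.intros derivative_intros)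
next
  case (mult u v)
  then obtain u' v' where "u' \<in> bumps" "v' \<in> bumps"
    "\<forall>x. (u has_real_derivative u' x) (at x)" "\<forall>x. (v has_real_derivative v' x) (at x)" by blast
  then show ?case using mult.hyps
    by (intro bexI[of _ "\<lambda>x. u' x * v x + v' x * u x"])
      (auto intro!: bumps.intros DERIV_mult)
qed

lemma bumps_higher_derivative:
  assumes "u \<in> bumps"
  shows "(deriv ^^ n) u \<in> bumps \<and> ((deriv ^^ n) u has_real_derivative (deriv ^^ Suc n) u x) (at x)"
proof -
  have step: "deriv u \<in> bumps \<and> (\<forall>x. (u has_real_derivative deriv u x) (at x))"
    if u: "u \<in> bumps" for u
  proof -
    obtain u' where u': "u' \<in> bumps" "\<And>x. (u has_real_derivative u' x) (at x)"
      using bumps_derivative[OF u] by blast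
    then have "deriv u = u'" by (auto simp: DERIV_imp_deriv)
    with u' show ?thesis by auto
  qed
  have "(deriv ^^ n) u \<in> bumps"
    by (induction n) (use assms step in auto)
  with step show ?thesis by simp
qed

text \<open>The arguments are \<open>n (x - a)\<close> and \<open>n (b - x)\<close>, spelled out in
  the affine form of the generators of \<open>bumps\<close>. Each factor tends to \<open>1\<close>
  on its open half-line as \<open>n\<close> grows, so the bumps approximate the indicator of the
  open interval from below.\<close>

definition bump :: "nat \<Rightarrow> real \<Rightarrow> real \<Rightarrow> real \<Rightarrow> real" where
  "bump n a b x = expinv 0 (real n * x + - real n * a) * expinv 0 (- real n * x + real n * b)"

lemma bump_test_fun: "test_fun (bump n a b)"
proof -
  have "bump n a b \<in> bumps"
    unfolding bump_def by (intro bumps.intros)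
  moreover have "bump n a b x = 0" if "\<bar>a\<bar> + \<bar>b\<bar> < \<bar>x\<bar>" for x
  proof -
    have "x \<le> a \<or> b \<le> x" using that by linarith
    then have "real n * x \<le> real n * a \<or> real n * b \<le> real n * x"
      by (meson mult_left_mono of_nat_0_le_iff)
    then show ?thesis by (auto simp: bump_def expinv_def)
  qed
  ultimately show ?thesis
    unfolding test_fun_def using bumps_higher_derivative by blast
qed

lemma bump_bound: "\<bar>bump n a b x\<bar> \<le> indicator {a<..<b} x"
proof (cases "a < x \<and> x < b")
  case True
  have "0 \<le> expinv 0 t \<and> expinv 0 t \<le> 1" for t by (auto simp: expinv_def)
  then show ?thesis using True
    by (auto simp: bump_def abs_mult intro!: mult_le_one)
next
  case False
  then have "real n * x \<le> real n * a \<or> real n * b \<le> real n * x"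
    by (meson mult_left_mono of_nat_0_le_iff not_less)
  then show ?thesis by (auto simp: bump_def expinv_def)
qed

lemma bump_tendsto: "(\<lambda>n. bump n a b x) \<longlonglongrightarrow> indicator {a<..<b} x"
proof (cases "a < x \<and> x < b")
  case True
  have *: "(\<lambda>n. expinv 0 (real n * d)) \<longlonglongrightarrow> 1" if "d > 0" for d
  proof (rule Lim_transform_eventually)
    show "(\<lambda>n. exp (- (1 / (real n * d)))) \<longlonglongrightarrow> 1" using that by real_asymp
    show "\<forall>\<^sub>F n in sequentially. exp (- (1 / (real n * d))) = expinv 0 (real n * d)"
      using eventually_gt_at_top[of 0] by eventually_elim (use that in \<open>auto simp: expinv_def\<close>)
  qed
  have "bump n a b x = expinv 0 (real n * (x - a)) * expinv 0 (real n * (b - x))" for n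
    by (simp add: bump_def algebra_simps)
  then show ?thesis
    using tendsto_mult[OF *[of "x - a"] *[of "b - x"]] True by simp
next
  case False
  then have "bump n a b x = 0" for n
    using bump_bound[of n a b x] by (auto simp: indicator_def)
  then show ?thesis using False by auto
qed

text \<open>The positive and negative parts of \<open>d\<close> are densities of two measures that
  agree, with finite values, on all rays \<open>{a<..}\<close>. Hence the measures coincide, and
  densities are unique almost everywhere. Since \<open>ennreal\<close> truncates at
  \<open>0\<close>, the two parts can be equal only where both vanish.\<close>

lemma integral_intervals_zero_imp_AE_zero:
  fixes d :: "real \<Rightarrow> real"
  assumes int: "integrable lborel d"
    and zero: "\<And>a. (LINT x|lborel. indicator {a<..} x * d x) = 0"
  shows "AE x in lborel. d x = 0"
proof -
  have [measurable]: "d \<in> borel_measurable borel" using int by auto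
  have *: "(\<integral>\<^sup>+x. ennreal (d x) * indicator {a<..} x \<partial>lborel)
         = (\<integral>\<^sup>+x. ennreal (- d x) * indicator {a<..} x \<partial>lborel)
         \<and> (\<integral>\<^sup>+x. ennreal (d x) * indicator {a<..} x \<partial>lborel) < \<infinity>" for a
  proof -
    let ?e = "\<lambda>x. indicator {a<..} x * d x"
    have ie: "integrable lborel ?e"
      using integrable_mult_indicator[OF _ int, of "{a<..}"] by simp
    have eq: "ennreal (d x) * indicator {a<..} x = ennreal (?e x)"
        "ennreal (- d x) * indicator {a<..} x = ennreal (- ?e x)" for x
      by (auto simp: indicator_def)
    have f1: "(\<integral>\<^sup>+x. ennreal (?e x) \<partial>lborel) < \<infinity>"
      and f2: "(\<integral>\<^sup>+x. ennreal (- ?e x) \<partial>lborel) < \<infinity>"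
      using ie unfolding real_integrable_def by (auto simp: less_top)
    have "enn2real (\<integral>\<^sup>+x. ennreal (?e x) \<partial>lborel) = enn2real (\<integral>\<^sup>+x. ennreal (- ?e x) \<partial>lborel)"
      using zero[of a] real_lebesgue_integral_def[OF ie] by simp
    then have "(\<integral>\<^sup>+x. ennreal (?e x) \<partial>lborel) = (\<integral>\<^sup>+x. ennreal (- ?e x) \<partial>lborel)"
      using f1 f2 by (metis ennreal_enn2real infinity_ennreal_def)
    with f1 show ?thesis unfolding eq by simp
  qed
  have "density lborel (\<lambda>x. ennreal (d x)) = density lborel (\<lambda>x. ennreal (- d x))"
  proof (rule measure_eqI_lessThan)
    fix a
    show "emeasure (density lborel (\<lambda>x. ennreal (d x))) {a<..} < \<infinity>"
      using conjunct2[OF *[of a]] by (simp add: emeasure_density)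
    show "emeasure (density lborel (\<lambda>x. ennreal (d x))) {a<..}
        = emeasure (density lborel (\<lambda>x. ennreal (- d x))) {a<..}"
      using *[of a] by (simp add: emeasure_density)
  qed auto
  then have "AE x in lborel. ennreal (d x) = ennreal (- d x)"
    by (intro sigma_finite_measure.density_unique[OF sigma_finite_lborel]) auto
  then show ?thesis
  proof eventually_elim
    case (elim x)
    then show ?case
      by (cases "d x \<ge> 0"; cases "d x = 0") (auto simp: ennreal_eq_0_iff ennreal_neg dest: sym)
  qed
qed

text \<open>The bumps converge boundedly to indicators of intervals, so the integral of
  \<open>d\<close> over every bounded interval is \<open>0\<close>. The preceding lemma asks for
  integrability on the line, hence it is applied to \<open>d\<close> cut off to
  \<open>(-n, n)\<close> for each \<open>n\<close>.\<close>

lemma du_Bois_Reymond: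
  fixes d :: "real \<Rightarrow> real"
  assumes loc: "\<And>a b. integrable lborel (\<lambda>x. indicator {a<..<b} x * d x)"
    and zero: "\<And>\<phi>. test_fun \<phi> \<Longrightarrow> (LINT x|lborel. d x * \<phi> x) = 0"
    and meas [measurable]: "d \<in> borel_measurable borel"
  shows "AE x in lborel. d x = 0"
proof -
  have ind: "(LINT x|lborel. indicator {a<..<b} x * d x) = 0" for a b
  proof -
    have [measurable]: "bump n a b \<in> borel_measurable borel" for n
      using bump_test_fun[of n a b] unfolding test_fun_def
      by (intro borel_measurable_continuous_onI continuous_at_imp_continuous_on ballI)
         (metis DERIV_isCont funpow_0)
    have "(\<lambda>n. LINT x|lborel. d x * bump n a b x) \<longlonglongrightarrow> (LINT x|lborel. indicator {a<..<b} x * d x)"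
    proof (rule integral_dominated_convergence[where w = "\<lambda>x. \<bar>indicator {a<..<b} x * d x\<bar>"])
      show "AE x in lborel. (\<lambda>n. d x * bump n a b x) \<longlonglongrightarrow> indicator {a<..<b} x * d x"
        using tendsto_mult[OF tendsto_const bump_tendsto] by (auto simp: mult.commute)
      show "AE x in lborel. norm (d x * bump n a b x) \<le> \<bar>indicator {a<..<b} x * d x\<bar>" for n
        using mult_left_mono[OF bump_bound[of n a b]] by (auto simp: abs_mult mult.commute)
    qed (use loc in auto)
    moreover have "(LINT x|lborel. d x * bump n a b x) = 0" for n
      using zero bump_test_fun by blast
    ultimately show ?thesis by (simp add: LIMSEQ_const_iff)
  qed
  have "AE x in lborel. indicator {-real n<..<real n} x * d x = 0" for n :: nat
  proof (rule integral_intervals_zero_imp_AE_zero)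
    fix a
    have "(\<lambda>x. indicator {a<..} x * (indicator {-real n<..<real n} x * d x))
        = (\<lambda>x. indicator {max a (-real n)<..<real n} x * d x)"
      by (auto simp: indicator_def)
    then show "(LINT x|lborel. indicator {a<..} x * (indicator {-real n<..<real n} x * d x)) = 0"
      using ind by simp
  qed (use loc in auto)
  then have "AE x in lborel. \<forall>n::nat. indicator {-real n<..<real n} x * d x = 0"
    by (rule AE_all_countable[THEN iffD2, rule_format])
  then show ?thesis
  proof eventually_elim
    case (elim x)
    obtain n :: nat where "\<bar>x\<bar> < real n" using reals_Archimedean2 by blast
    then show ?case using elim[rule_format, of n] by (auto simp: indicator_def split: if_splits)
  qed
qed

lemma L2fun_locally_integrable:
  assumes "L2fun d"
  shows "integrable lborel (\<lambda>x. indicator {a<..<b} x * d x)"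
proof (rule Bochner_Integration.integrable_bound)
  have [measurable]: "d \<in> borel_measurable borel" using assms by (simp add: L2fun_def)
  have "integrable lborel (\<lambda>x. indicator {a<..<b} x :: real)" by (cases "a \<le> b") auto
  then show "integrable lborel (\<lambda>x. indicator {a<..<b} x + (d x)^2)"
    using assms by (auto simp: L2fun_def)
  have "\<bar>y\<bar> \<le> 1 + y\<^sup>2" for y :: real
    using zero_le_power2[of "\<bar>y\<bar> - 1"] zero_le_power2[of y]
    by (simp add: power2_eq_square algebra_simps)
  then show "AE x in lborel. norm (indicator {a<..<b} x * d x) \<le> norm (indicator {a<..<b} x + (d x)^2)"
    by (auto simp: indicator_def)
  show "(\<lambda>x. indicator {a<..<b} x * d x) \<in> borel_measurable lborel" by measurable
qed

lemma L2fun_diff: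
  assumes "L2fun u" "L2fun v"
  shows "L2fun (\<lambda>x. u x - v x)"
proof -
  have [measurable]: "u \<in> borel_measurable borel" "v \<in> borel_measurable borel"
    using assms by (auto simp: L2fun_def)
  have "integrable lborel (\<lambda>x. (u x - v x)^2)"
  proof (rule Bochner_Integration.integrable_bound)
    show "integrable lborel (\<lambda>x. 2 * ((u x)^2 + (v x)^2))"
      using assms by (auto simp: L2fun_def)
    have "(a - b)\<^sup>2 \<le> 2 * (a\<^sup>2 + b\<^sup>2)" for a b :: real
      using zero_le_power2[of "a + b"] by (simp add: power2_eq_square algebra_simps)
    then show "AE x in lborel. norm ((u x - v x)^2) \<le> norm (2 * ((u x)^2 + (v x)^2))" by auto
  qed auto
  then show ?thesis by (simp add: L2fun_def)
qed

lemma weak_deriv_unique: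
  assumes g: "is_weak_deriv i u g" and g': "is_weak_deriv i u g'"
    and loc: "\<And>a b. integrable lborel (\<lambda>x. indicator {a<..<b} x * g x)"
      "\<And>a b. integrable lborel (\<lambda>x. indicator {a<..<b} x * g' x)"
    and meas [measurable]: "g \<in> borel_measurable borel" "g' \<in> borel_measurable borel"
  shows "AE x in lborel. g x = g' x"
proof -
  have "AE x in lborel. g x - g' x = 0"
  proof (rule du_Bois_Reymond)
    show "integrable lborel (\<lambda>x. indicator {a<..<b} x * (g x - g' x))" for a b
      using Bochner_Integration.integrable_diff[OF loc(1)[of a b] loc(2)[of a b]]
      by (simp add: right_diff_distrib)
    fix \<phi> assume \<phi>: "test_fun \<phi>"
    have int: "integrable lborel (\<lambda>x. g x * \<phi> x)" "integrable lborel (\<lambda>x. g' x * \<phi> x)"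
      and "(LINT x|lborel. u x * (deriv ^^ i) \<phi> x) = (-1)^i * (LINT x|lborel. g x * \<phi> x)"
      and "(LINT x|lborel. u x * (deriv ^^ i) \<phi> x) = (-1)^i * (LINT x|lborel. g' x * \<phi> x)"
      using g g' \<phi> unfolding is_weak_deriv_def by blast+
    then show "(LINT x|lborel. (g x - g' x) * \<phi> x) = 0"
      by (simp add: left_diff_distrib)
  qed auto
  then show ?thesis by simp
qed

text \<open>\<open>weak_deriv\<close> is an arbitrary choice; uniqueness almost everywhere lets
  every Sobolev norm be computed from a concrete weak derivative instead.\<close>

lemma weak_deriv_L2_eq:
  assumes "L2fun g" "is_weak_deriv i u g"
  shows "(LINT x|lborel. (weak_deriv i u x)^2) = (LINT x|lborel. (g x)^2)"
proof -
  have *: "L2fun (weak_deriv i u) \<and> is_weak_deriv i u (weak_deriv i u)"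
    unfolding weak_deriv_def by (rule someI[of _ g]) (use assms in simp)
  have [measurable]: "g \<in> borel_measurable borel" "weak_deriv i u \<in> borel_measurable borel"
    using assms * by (auto simp: L2fun_def)
  have "AE x in lborel. weak_deriv i u x = g x"
    by (rule weak_deriv_unique[of i u]) (use * assms L2fun_locally_integrable in auto)
  then show ?thesis
    by (intro integral_cong_AE) auto
qed

section \<open>Calculus with test functions\<close>

lemma test_fun_deriv:
  assumes "test_fun \<phi>"
  shows "test_fun (deriv \<phi>)"
proof -
  from assms obtain R where R: "\<And>x. R < \<bar>x\<bar> \<Longrightarrow> \<phi> x = 0"
    and d: "\<And>n x. ((deriv ^^ n) \<phi> has_real_derivative (deriv ^^ Suc n) \<phi> x) (at x)"
    unfolding test_fun_def by blast
  have "((deriv ^^ n) (deriv \<phi>) has_real_derivative (deriv ^^ Suc n) (deriv \<phi>) x) (at x)" for n x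
    using d[of "Suc n" x] by (simp add: funpow_swap1)
  moreover have "deriv \<phi> x = 0" if "R < \<bar>x\<bar>" for x
  proof -
    have "open {x. R < \<bar>x\<bar>}" by (intro open_Collect_less continuous_intros)
    then have "(\<phi> has_real_derivative 0) (at x)"
      by (rule has_field_derivative_transform_within_open[OF DERIV_const]) (use that R in simp_all)
    then show ?thesis by (rule DERIV_imp_deriv)
  qed
  ultimately show ?thesis unfolding test_fun_def by blast
qed

lemma test_fun_higher_deriv: "test_fun \<phi> \<Longrightarrow> test_fun ((deriv ^^ n) \<phi>)"
  by (induction n) (auto intro: test_fun_deriv)

lemma test_fun_DERIV: "test_fun \<phi> \<Longrightarrow> (\<phi> has_real_derivative deriv \<phi> x) (at x)"
  unfolding test_fun_def by (metis funpow_0 funpow_simps_right(1) comp_apply funpow.simps(2) id_apply)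

lemma test_fun_continuous: "test_fun \<phi> \<Longrightarrow> continuous_on UNIV \<phi>"
  using test_fun_DERIV DERIV_isCont by (blast intro: continuous_at_imp_continuous_on)

lemma test_fun_bounded:
  assumes "test_fun \<phi>"
  obtains M where "\<And>x. \<bar>\<phi> x\<bar> \<le> M"
proof -
  from assms obtain R where R: "\<And>x. R < \<bar>x\<bar> \<Longrightarrow> \<phi> x = 0"
    unfolding test_fun_def by blast
  have "compact (\<phi> ` {-\<bar>R\<bar>..\<bar>R\<bar>})"
    using continuous_on_subset[OF test_fun_continuous[OF assms]]
    by (intro compact_continuous_image) auto
  then obtain M where M: "\<And>x. x \<in> {-\<bar>R\<bar>..\<bar>R\<bar>} \<Longrightarrow> \<bar>\<phi> x\<bar> \<le> M"
    by (metis compact_imp_bounded bounded_iff imageI real_norm_def)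
  have "\<bar>\<phi> x\<bar> \<le> \<bar>M\<bar>" for x
  proof (cases "R < \<bar>x\<bar>")
    case False
    then have "x \<in> {-\<bar>R\<bar>..\<bar>R\<bar>}" by auto
    then show ?thesis using M by fastforce
  qed (simp add: R)
  then show ?thesis by (rule that)
qed

lemma test_fun_mult_integrable:
  assumes "test_fun \<phi>" "continuous_on UNIV u"
  shows "integrable lborel (\<lambda>x. u x * \<phi> x)"
proof -
  from assms obtain R where R: "\<And>x. R < \<bar>x\<bar> \<Longrightarrow> \<phi> x = 0"
    unfolding test_fun_def by blast
  have "integrable lborel (\<lambda>x. indicator {-\<bar>R\<bar>..\<bar>R\<bar>} x *\<^sub>R (u x * \<phi> x))"
    using continuous_on_subset[OF test_fun_continuous[OF assms(1)]] continuous_on_subset[OF assms(2)]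
    by (intro borel_integrable_compact continuous_intros) auto
  also have "(\<lambda>x. indicator {-\<bar>R\<bar>..\<bar>R\<bar>} x *\<^sub>R (u x * \<phi> x)) = (\<lambda>x. u x * \<phi> x)"
  proof
    fix x show "indicator {-\<bar>R\<bar>..\<bar>R\<bar>} x *\<^sub>R (u x * \<phi> x) = u x * \<phi> x"
      by (cases "R < \<bar>x\<bar>") (use R[of x] in \<open>auto simp: indicator_def\<close>)
  qed
  finally show ?thesis .
qed

lemma integral_by_parts_test_fun:
  assumes "test_fun \<phi>" "\<And>x. (u has_real_derivative u' x) (at x)" "continuous_on UNIV u'"
  shows "(LINT x|lborel. u x * deriv \<phi> x) = - (LINT x|lborel. u' x * \<phi> x)"
proof -
  from assms obtain R where R: "\<And>x. R < \<bar>x\<bar> \<Longrightarrow> \<phi> x = 0"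
    unfolding test_fun_def by blast
  from test_fun_deriv[OF assms(1)] obtain R' where R': "\<And>x. R' < \<bar>x\<bar> \<Longrightarrow> deriv \<phi> x = 0"
    unfolding test_fun_def by blast
  \<comment> \<open>Beyond \<open>r\<close> both \<open>\<phi>\<close> and
    \<open>deriv \<phi>\<close> vanish, so the boundary terms are zero and cutting off to
    \<open>[-r, r]\<close> changes nothing.\<close>
  define r where "r = \<bar>R\<bar> + \<bar>R'\<bar> + 1"
  have u: "continuous_on UNIV u"
    using assms(2) DERIV_isCont by (blast intro: continuous_at_imp_continuous_on)
  let ?g = "\<lambda>x. u x * deriv \<phi> x + u' x * \<phi> x"
  have cont: "continuous_on UNIV ?g"
    by (intro continuous_intros u assms(3) test_fun_continuous assms(1) test_fun_deriv)
  have "(LINT x|lborel. ?g x * indicator {-r..r} x) = u r * \<phi> r - u (-r) * \<phi> (-r)"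
  proof (rule integral_FTC_Icc_real)
    show "((\<lambda>x. u x * \<phi> x) has_real_derivative ?g x) (at x)" for x
      using DERIV_mult[OF assms(2) test_fun_DERIV[OF assms(1)], of x] by (simp add: algebra_simps)
    show "isCont ?g x" for x using cont by (simp add: continuous_on_eq_continuous_at)
  qed (simp add: r_def)
  also have "\<dots> = 0" using R by (simp add: r_def)
  also have "(\<lambda>x. ?g x * indicator {-r..r} x) = ?g"
  proof
    fix x show "?g x * indicator {-r..r} x = ?g x"
    proof (cases "x \<in> {-r..r}")
      case False
      then have "R < \<bar>x\<bar>" "R' < \<bar>x\<bar>" by (auto simp: r_def)
      then show ?thesis using R R' by simp
    qed simp
  qed
  finally have "(LINT x|lborel. ?g x) = 0" .
  moreover have "(LINT x|lborel. ?g x) = (LINT x|lborel. u x * deriv \<phi> x) + (LINT x|lborel. u' x * \<phi> x)"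
    by (intro Bochner_Integration.integral_add test_fun_mult_integrable test_fun_deriv u assms)
  ultimately show ?thesis by simp
qed

lemma is_weak_deriv_0: "continuous_on UNIV u \<Longrightarrow> is_weak_deriv 0 u u"
  unfolding is_weak_deriv_def by (auto intro: test_fun_mult_integrable)

lemma is_weak_deriv_Suc:
  assumes "is_weak_deriv n u g" "\<And>x. (g has_real_derivative g' x) (at x)" "continuous_on UNIV g'"
  shows "is_weak_deriv (Suc n) u g'"
  unfolding is_weak_deriv_def
proof (intro allI impI)
  fix \<phi> assume \<phi>: "test_fun \<phi>"
  have "integrable lborel (\<lambda>x. u x * (deriv ^^ n) (deriv \<phi>) x)"
    "(LINT x|lborel. u x * (deriv ^^ n) (deriv \<phi>) x) = (-1)^n * (LINT x|lborel. g x * deriv \<phi> x)"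
    using assms(1) test_fun_deriv[OF \<phi>] unfolding is_weak_deriv_def by blast+
  moreover have "(deriv ^^ n) (deriv \<phi>) = (deriv ^^ Suc n) \<phi>" by (simp add: funpow_swap1)
  ultimately show "integrable lborel (\<lambda>x. u x * (deriv ^^ Suc n) \<phi> x) \<and>
      integrable lborel (\<lambda>x. g' x * \<phi> x) \<and>
      (LINT x|lborel. u x * (deriv ^^ Suc n) \<phi> x) = (-1) ^ Suc n * (LINT x|lborel. g' x * \<phi> x)"
    using integral_by_parts_test_fun[OF \<phi> assms(2,3)] test_fun_mult_integrable[OF \<phi> assms(3)]
    by simp
qed

lemma is_weak_deriv_lincomb:
  assumes "is_weak_deriv n u g" "is_weak_deriv n v h"
  shows "is_weak_deriv n (\<lambda>x. u x + k * v x) (\<lambda>x. g x + k * h x)"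
  using assms unfolding is_weak_deriv_def
  by (auto simp: distrib_right mult.assoc distrib_left)

section \<open>Families of decaying functions\<close>

lemma integrable_exp_abs:
  assumes "a > 0"
  shows "integrable lborel (\<lambda>x::real. exp (- a * \<bar>x\<bar>))"
proof -
  have "set_integrable lebesgue {0..} (\<lambda>x::real. exp (- a * x))"
    using nonnegative_absolutely_integrable_1[OF integrable_on_exp_minus_to_infinity[OF assms, of 0]]
    by simp
  then have i: "integrable lborel (\<lambda>x. indicator {0..} x * exp (- a * x))"
    unfolding set_integrable_def by (simp add: integrable_completion)
  \<comment> \<open>Reflection gives the negative half-line.\<close>
  have "integrable lborel (\<lambda>x. indicator {0..} (0 + (-1) * x) * exp (- a * (0 + (-1) * x)))"
    by (rule lborel_integrable_real_affine[OF i]) simp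
  then have "integrable lborel (\<lambda>x. indicator {0..} x * exp (- a * x) + indicator {0..} (- x) * exp (- a * (- x)))"
    using i by (intro Bochner_Integration.integrable_add) auto
  then show ?thesis
    by (rule Bochner_Integration.integrable_bound) (auto simp: indicator_def abs_if)
qed

text \<open>Reduction to sequences: a limit along \<open>at c\<close> is a limit along all sequences
  tending to \<open>c\<close>, and the bound, valid only near \<open>c\<close>, holds from some
  index \<open>N\<close> on.\<close>

lemma dominated_convergence_at:
  fixes F :: "real \<Rightarrow> real \<Rightarrow> real"
  assumes lim: "\<And>x. ((\<lambda>h. F h x) \<longlongrightarrow> G x) (at c)"
    and dom: "\<forall>\<^sub>F h in at c. F h \<in> borel_measurable borel \<and> (\<forall>x. \<bar>F h x\<bar> \<le> W x)"
    and W: "integrable lborel W" and G: "G \<in> borel_measurable borel"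
  shows "((\<lambda>h. LINT x|lborel. F h x) \<longlongrightarrow> (LINT x|lborel. G x)) (at c)"
  unfolding tendsto_at_iff_sequentially
proof (intro allI impI)
  fix X :: "nat \<Rightarrow> real" assume X: "\<forall>i. X i \<in> UNIV - {c}" "X \<longlonglongrightarrow> c"
  then have XF: "filterlim X (at c) sequentially" by (auto simp: filterlim_at)
  obtain N where N: "\<And>i. i \<ge> N \<Longrightarrow> F (X i) \<in> borel_measurable borel \<and> (\<forall>x. \<bar>F (X i) x\<bar> \<le> W x)"
    using filterlim_iff[THEN iffD1, OF XF, rule_format, OF dom] by (auto simp: eventually_sequentially)
  have "(\<lambda>i. LINT x|lborel. F (X (i + N)) x) \<longlonglongrightarrow> (LINT x|lborel. G x)"
  proof (rule integral_dominated_convergence[OF _ _ W])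
    show "AE x in lborel. (\<lambda>i. F (X (i + N)) x) \<longlonglongrightarrow> G x"
      by (intro AE_I2 LIMSEQ_ignore_initial_segment[of "\<lambda>i. F (X i) _"] filterlim_compose[OF lim XF])
  qed (use N G in auto)
  then show "((\<lambda>h. LINT x|lborel. F h x) \<circ> X) \<longlonglongrightarrow> (LINT x|lborel. G x)"
    unfolding comp_def by (rule LIMSEQ_offset)
qed

text \<open>Exponential decay with constants that are uniform only locally in the parameter: the
  rate may degenerate towards the ends of \<open>I\<close>, as it does for the waves near
  \<open>cs\<close>. Local uniformity is what dominated convergence at a fixed parameter uses; the
  clause \<open>c' \<in> I\<close> makes \<open>I\<close> open.\<close>

definition decaying :: "real set \<Rightarrow> (real \<Rightarrow> real \<Rightarrow> real) \<Rightarrow> bool" where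
  "decaying I u \<longleftrightarrow> (\<forall>c\<in>I. continuous_on UNIV (u c)) \<and>
     (\<forall>c\<in>I. \<exists>r>0. \<exists>K a. 0 < a \<and> 0 \<le> K \<and>
        (\<forall>c'. \<bar>c' - c\<bar> < r \<longrightarrow> c' \<in> I \<and> (\<forall>x. \<bar>u c' x\<bar> \<le> K * exp (- a * \<bar>x\<bar>))))"

definition deriv_family :: "real set \<Rightarrow> (real \<Rightarrow> real \<Rightarrow> real) \<Rightarrow> (real \<Rightarrow> real \<Rightarrow> real) \<Rightarrow> bool" where
  "deriv_family I u u' \<longleftrightarrow> decaying I u \<and> decaying I u' \<and>
     (\<forall>c\<in>I. \<forall>x. ((\<lambda>c. u c x) has_real_derivative u' c x) (at c))"

lemma decayingE:
  assumes "decaying I u" "c \<in> I"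
  obtains r K a where "0 < r" "0 < a" "0 \<le> K"
    "\<And>c'. \<bar>c' - c\<bar> < r \<Longrightarrow> c' \<in> I" "\<And>c' x. \<bar>c' - c\<bar> < r \<Longrightarrow> \<bar>u c' x\<bar> \<le> K * exp (- a * \<bar>x\<bar>)"
  using assms unfolding decaying_def by metis

lemma decaying_nbhd:
  assumes "decaying I u" "c \<in> I"
  obtains r where "0 < r" "\<And>c'. \<bar>c' - c\<bar> < r \<Longrightarrow> c' \<in> I"
  using assms unfolding decaying_def by metis

lemma decaying_measurable:
  assumes "decaying I u" "c \<in> I"
  shows "u c \<in> borel_measurable borel"
  using assms by (auto simp: decaying_def intro!: borel_measurable_continuous_onI)

lemma decaying_L2:
  assumes "decaying I u" "c \<in> I"
  shows "L2fun (u c)"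
proof -
  have [measurable]: "u c \<in> borel_measurable borel" by (rule decaying_measurable[OF assms])
  obtain K a where Ka: "0 < a" "\<And>x. \<bar>u c x\<bar> \<le> K * exp (- a * \<bar>x\<bar>)"
    using decayingE[OF assms] by (metis abs_zero diff_self)
  have "integrable lborel (\<lambda>x. (u c x)^2)"
  proof (rule Bochner_Integration.integrable_bound)
    show "integrable lborel (\<lambda>x. K^2 * exp (- (2 * a) * \<bar>x\<bar>))"
      using integrable_exp_abs[of "2 * a"] Ka by simp
    have "(u c x)^2 \<le> K^2 * exp (- (2 * a) * \<bar>x\<bar>)" for x
      using power_mono[OF Ka(2)[of x], of 2]
      by (simp add: power_mult_distrib exp_double[symmetric] mult.assoc)
    then show "AE x in lborel. norm ((u c x)^2) \<le> norm (K^2 * exp (- (2 * a) * \<bar>x\<bar>))" by auto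
  qed auto
  then show ?thesis by (simp add: L2fun_def)
qed

text \<open>Mean value theorem in the parameter for each fixed \<open>x\<close>: the local bound on
  \<open>u'\<close> becomes an integrable majorant for the difference quotients of
  \<open>u\<close>.\<close>

lemma deriv_family_bound:
  assumes "deriv_family I u u'" "c \<in> I"
  obtains r K a where "0 < r" "0 < a" "0 \<le> K"
    "\<And>c'. \<bar>c' - c\<bar> < r \<Longrightarrow> c' \<in> I"
    "\<And>x. \<bar>u' c x\<bar> \<le> K * exp (- a * \<bar>x\<bar>)"
    "\<And>h x. \<bar>h\<bar> < r \<Longrightarrow> \<bar>u (c + h) x - u c x\<bar> \<le> \<bar>h\<bar> * (K * exp (- a * \<bar>x\<bar>))"
proof -
  obtain r K a where r: "0 < r" "0 < a" "0 \<le> K"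
    "\<And>c'. \<bar>c' - c\<bar> < r \<Longrightarrow> c' \<in> I" "\<And>c' x. \<bar>c' - c\<bar> < r \<Longrightarrow> \<bar>u' c' x\<bar> \<le> K * exp (- a * \<bar>x\<bar>)"
    using assms decayingE[of I u' c] unfolding deriv_family_def by metis
  have "\<bar>u (c + h) x - u c x\<bar> \<le> \<bar>h\<bar> * (K * exp (- a * \<bar>x\<bar>))" if "\<bar>h\<bar> < r" for h x
  proof -
    have "norm (u (c + h) x - u c x) \<le> K * exp (- a * \<bar>x\<bar>) * norm (c + h - c)"
    proof (rule field_differentiable_bound)
      show "convex (ball c r)" by simp
      fix z assume "z \<in> ball c r"
      then have z: "\<bar>z - c\<bar> < r" by (simp add: dist_real_def abs_minus_commute)
      show "((\<lambda>c. u c x) has_real_derivative u' z x) (at z within ball c r)"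
        using assms(1) r(4)[OF z] unfolding deriv_family_def by (blast intro: has_field_derivative_at_within)
      show "norm (u' z x) \<le> K * exp (- a * \<bar>x\<bar>)" using r(5)[OF z] by simp
    qed (use that r in \<open>auto simp: dist_real_def\<close>)
    then show ?thesis by (simp add: mult.commute)
  qed
  with r show ?thesis by (intro that[of r a K]) auto
qed

lemma difference_quotient_tendsto:
  assumes "deriv_family I u u'" "c \<in> I"
  shows "((\<lambda>h. (u (c + h) x - u c x) / h) \<longlongrightarrow> u' c x) (at 0)"
  using assms unfolding deriv_family_def DERIV_def by blast

lemma eventually_abs_less_at_0: "0 < r \<Longrightarrow> \<forall>\<^sub>F h::real in at 0. \<bar>h\<bar> < r \<and> h \<noteq> 0"
  unfolding eventually_at by (auto intro!: exI[of _ r] simp: dist_real_def)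

text \<open>The bounded weight \<open>\<psi>\<close> covers two uses: test functions and their
  derivatives in the weak formulation, and the constant \<open>1\<close> when the momentum is
  differentiated.\<close>

lemma difference_quotient_integral_tendsto:
  assumes fam: "deriv_family I u u'" and c: "c \<in> I"
    and [measurable]: "\<psi> \<in> borel_measurable borel" and M: "\<And>x. \<bar>\<psi> x\<bar> \<le> M"
  shows "((\<lambda>h. LINT x|lborel. (u (c + h) x - u c x) / h * \<psi> x) \<longlongrightarrow>
      (LINT x|lborel. u' c x * \<psi> x)) (at 0)"
proof -
  have M0: "0 \<le> M" using M by (meson abs_ge_zero order_trans)
  obtain r K a where r: "0 < r" "0 < a" "0 \<le> K" "\<And>c'. \<bar>c' - c\<bar> < r \<Longrightarrow> c' \<in> I"
    "\<And>h x. \<bar>h\<bar> < r \<Longrightarrow> \<bar>u (c + h) x - u c x\<bar> \<le> \<bar>h\<bar> * (K * exp (- a * \<bar>x\<bar>))"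
    using deriv_family_bound[OF fam c] by metis
  have d: "decaying I u" "decaying I u'" using fam by (auto simp: deriv_family_def)
  show ?thesis
  proof (rule dominated_convergence_at)
    show "((\<lambda>h. (u (c + h) x - u c x) / h * \<psi> x) \<longlongrightarrow> u' c x * \<psi> x) (at 0)" for x
      by (intro tendsto_intros difference_quotient_tendsto[OF fam c])
    show "integrable lborel (\<lambda>x. K * exp (- a * \<bar>x\<bar>) * M)"
      using integrable_exp_abs[OF r(2)] by simp
    show "(\<lambda>x. u' c x * \<psi> x) \<in> borel_measurable borel"
      using decaying_measurable[OF d(2) c] by measurable
    show "\<forall>\<^sub>F h in at 0. (\<lambda>x. (u (c + h) x - u c x) / h * \<psi> x) \<in> borel_measurable borel \<and>
        (\<forall>x. \<bar>(u (c + h) x - u c x) / h * \<psi> x\<bar> \<le> K * exp (- a * \<bar>x\<bar>) * M)"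
      using eventually_abs_less_at_0[OF r(1)]
    proof eventually_elim
      case (elim h)
      have [measurable]: "u (c + h) \<in> borel_measurable borel" "u c \<in> borel_measurable borel"
        using decaying_measurable[OF d(1)] r(4)[of "c + h"] elim c by auto
      have "\<bar>(u (c + h) x - u c x) / h\<bar> \<le> K * exp (- a * \<bar>x\<bar>)" for x
        using r(5)[of h x] elim by (simp add: abs_divide divide_le_eq mult.commute)
      then have "\<bar>(u (c + h) x - u c x) / h * \<psi> x\<bar> \<le> K * exp (- a * \<bar>x\<bar>) * M" for x
        unfolding abs_mult using M M0 r(3) by (intro mult_mono) auto
      then show ?case by auto
    qed
  qed
qed

text \<open>The weak identity holds for the difference quotients by linearity, and both sides
  converge as \<open>h\<close> tends to \<open>0\<close>.\<close>

lemma is_weak_deriv_param: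
  assumes u: "deriv_family I u u'" and g: "deriv_family I g g'"
    and wd: "\<And>c. c \<in> I \<Longrightarrow> is_weak_deriv n (u c) (g c)" and c: "c \<in> I"
  shows "is_weak_deriv n (u' c) (g' c)"
  unfolding is_weak_deriv_def
proof (intro allI impI)
  fix \<phi> assume \<phi>: "test_fun \<phi>"
  have lim: "((\<lambda>h. LINT x|lborel. (u (c + h) x - u c x) / h * \<psi> x) \<longlongrightarrow>
      (LINT x|lborel. u' c x * \<psi> x)) (at 0)"
    if fam: "deriv_family I u u'" and \<psi>: "test_fun \<psi>" for \<psi> u u'
  proof -
    obtain M where "\<And>x. \<bar>\<psi> x\<bar> \<le> M" using test_fun_bounded[OF \<psi>] by blast
    then show ?thesis
      using difference_quotient_integral_tendsto[OF fam c] test_fun_continuous[OF \<psi>]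
      by (blast intro: borel_measurable_continuous_onI)
  qed
  obtain r where r: "0 < r" "\<And>c'. \<bar>c' - c\<bar> < r \<Longrightarrow> c' \<in> I"
    using deriv_family_bound[OF u c] by metis
  let ?\<psi> = "(deriv ^^ n) \<phi>"
  have \<psi>: "test_fun ?\<psi>" by (rule test_fun_higher_deriv[OF \<phi>])
  have "\<forall>\<^sub>F h in at 0. (-1)^n * (LINT x|lborel. (g (c + h) x - g c x) / h * \<phi> x)
      = (LINT x|lborel. (u (c + h) x - u c x) / h * ?\<psi> x)"
    using eventually_abs_less_at_0[OF r(1)]
  proof eventually_elim
    case (elim h)
    have "c + h \<in> I" using r(2)[of "c + h"] elim by auto
    then have w: "is_weak_deriv n (u (c + h)) (g (c + h))" "is_weak_deriv n (u c) (g c)" using wd c by auto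
    have "is_weak_deriv n (\<lambda>x. u (c + h) x + (-1) * u c x) (\<lambda>x. g (c + h) x + (-1) * g c x)"
      by (rule is_weak_deriv_lincomb[OF w])
    then have "(LINT x|lborel. (u (c + h) x - u c x) * ?\<psi> x) =
        (-1)^n * (LINT x|lborel. (g (c + h) x - g c x) * \<phi> x)"
      using \<phi> unfolding is_weak_deriv_def by auto
    then show ?case by simp
  qed
  then have "((\<lambda>h. LINT x|lborel. (u (c + h) x - u c x) / h * ?\<psi> x) \<longlongrightarrow>
      (-1)^n * (LINT x|lborel. g' c x * \<phi> x)) (at 0)"
    by (rule Lim_transform_eventually[rotated]) (intro tendsto_intros lim[OF g \<phi>])
  then have "(LINT x|lborel. u' c x * ?\<psi> x) = (-1)^n * (LINT x|lborel. g' c x * \<phi> x)"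
    using lim[OF u \<psi>] by (intro tendsto_unique[of "at (0::real)"]) auto
  moreover have "continuous_on UNIV (u' c)" "continuous_on UNIV (g' c)"
    using u g c by (auto simp: deriv_family_def decaying_def)
  ultimately show "integrable lborel (\<lambda>x. u' c x * ?\<psi> x) \<and> integrable lborel (\<lambda>x. g' c x * \<phi> x) \<and>
      (LINT x|lborel. u' c x * ?\<psi> x) = (-1)^n * (LINT x|lborel. g' c x * \<phi> x)"
    using test_fun_mult_integrable \<phi> \<psi> by blast
qed

lemma L2_remainder_tendsto:
  assumes fam: "deriv_family I u u'" and c: "c \<in> I"
  shows "((\<lambda>h. LINT x|lborel. ((u (c + h) x - u c x - h * u' c x) / h)^2) \<longlongrightarrow> 0) (at 0)"
proof -
  obtain r K a where r: "0 < r" "0 < a" "0 \<le> K" "\<And>c'. \<bar>c' - c\<bar> < r \<Longrightarrow> c' \<in> I"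
    "\<And>x. \<bar>u' c x\<bar> \<le> K * exp (- a * \<bar>x\<bar>)"
    "\<And>h x. \<bar>h\<bar> < r \<Longrightarrow> \<bar>u (c + h) x - u c x\<bar> \<le> \<bar>h\<bar> * (K * exp (- a * \<bar>x\<bar>))"
    using deriv_family_bound[OF fam c] by metis
  have d: "decaying I u" "decaying I u'" using fam by (auto simp: deriv_family_def)
  have "((\<lambda>h. LINT x|lborel. ((u (c + h) x - u c x - h * u' c x) / h)^2) \<longlongrightarrow> (LINT x::real|lborel. 0)) (at 0)"
  proof (rule dominated_convergence_at)
    fix x
    have "((\<lambda>h. ((u (c + h) x - u c x) / h - u' c x)^2) \<longlongrightarrow> (u' c x - u' c x)^2) (at 0)"
      by (intro tendsto_intros difference_quotient_tendsto[OF fam c])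
    moreover have "\<forall>\<^sub>F h in at 0. ((u (c + h) x - u c x) / h - u' c x)^2
        = ((u (c + h) x - u c x - h * u' c x) / h)^2"
      using eventually_abs_less_at_0[OF r(1)] by eventually_elim (simp add: diff_divide_distrib)
    ultimately show "((\<lambda>h. ((u (c + h) x - u c x - h * u' c x) / h)^2) \<longlongrightarrow> 0) (at 0)"
      using Lim_transform_eventually by fastforce
  next
    \<comment> \<open>The difference quotient and \<open>u'\<close> are each bounded by
      \<open>K exp (- a |x|)\<close>; hence the constant \<open>2 K\<close>, squared.\<close>
    show "integrable lborel (\<lambda>x. (2 * K)^2 * exp (- (2 * a) * \<bar>x\<bar>))"
      using integrable_exp_abs[of "2 * a"] r by simp
    show "\<forall>\<^sub>F h in at 0. (\<lambda>x. ((u (c + h) x - u c x - h * u' c x) / h)^2) \<in> borel_measurable borel \<and>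
        (\<forall>x. \<bar>((u (c + h) x - u c x - h * u' c x) / h)^2\<bar> \<le> (2 * K)^2 * exp (- (2 * a) * \<bar>x\<bar>))"
      using eventually_abs_less_at_0[OF r(1)]
    proof eventually_elim
      case (elim h)
      have [measurable]: "u (c + h) \<in> borel_measurable borel" "u c \<in> borel_measurable borel"
        "u' c \<in> borel_measurable borel"
        using decaying_measurable[OF d(1)] decaying_measurable[OF d(2)] r(4)[of "c + h"] elim c by auto
      have "((u (c + h) x - u c x - h * u' c x) / h)^2 \<le> (2 * K)^2 * exp (- (2 * a) * \<bar>x\<bar>)" for x
      proof -
        have "\<bar>u (c + h) x - u c x - h * u' c x\<bar> \<le> \<bar>u (c + h) x - u c x\<bar> + \<bar>h\<bar> * \<bar>u' c x\<bar>"
          using abs_triangle_ineq4 by (metis abs_mult)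
        also have "\<dots> \<le> \<bar>h\<bar> * (K * exp (- a * \<bar>x\<bar>)) + \<bar>h\<bar> * (K * exp (- a * \<bar>x\<bar>))"
          using elim r(5)[of x] r(6)[of h x] by (intro add_mono mult_left_mono) auto
        finally have "\<bar>(u (c + h) x - u c x - h * u' c x) / h\<bar> \<le> 2 * K * exp (- a * \<bar>x\<bar>)"
          using elim by (simp add: abs_divide divide_le_eq mult_ac)
        from power_mono[OF this, of 2]
        have "((u (c + h) x - u c x - h * u' c x) / h)^2 \<le> (2 * K * exp (- a * \<bar>x\<bar>))^2"
          unfolding power2_abs by simp
        then show ?thesis
          by (simp add: power_mult_distrib exp_double[symmetric] mult.assoc)
      qed
      then show ?case by auto
    qed
  qed auto
  then show ?thesis by simp
qed

lemma L2_difference_tendsto: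
  assumes u: "decaying I u" and c: "c \<in> I" and cont: "\<And>x. isCont (\<lambda>c. u c x) c"
  shows "((\<lambda>c'. LINT x|lborel. (u c' x - u c x)^2) \<longlongrightarrow> 0) (at c)"
proof -
  obtain r K a where r: "0 < r" "0 < a" "0 \<le> K" "\<And>c'. \<bar>c' - c\<bar> < r \<Longrightarrow> c' \<in> I"
    "\<And>c' x. \<bar>c' - c\<bar> < r \<Longrightarrow> \<bar>u c' x\<bar> \<le> K * exp (- a * \<bar>x\<bar>)"
    using decayingE[OF u c] by metis
  have ev: "\<forall>\<^sub>F c' in at c. \<bar>c' - c\<bar> < r"
    using r(1) unfolding eventually_at by (auto simp: dist_real_def)
  have "((\<lambda>c'. LINT x|lborel. (u c' x - u c x)^2) \<longlongrightarrow> (LINT x::real|lborel. 0)) (at c)"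
  proof (rule dominated_convergence_at)
    fix x
    have "((\<lambda>c'. (u c' x - u c x)^2) \<longlongrightarrow> (u c x - u c x)^2) (at c)"
      using cont[of x] unfolding isCont_def by (intro tendsto_intros)
    then show "((\<lambda>c'. (u c' x - u c x)^2) \<longlongrightarrow> 0) (at c)" by simp
  next
    show "integrable lborel (\<lambda>x. (2 * K)^2 * exp (- (2 * a) * \<bar>x\<bar>))"
      using integrable_exp_abs[of "2 * a"] r by simp
    show "\<forall>\<^sub>F c' in at c. (\<lambda>x. (u c' x - u c x)^2) \<in> borel_measurable borel \<and>
        (\<forall>x. \<bar>(u c' x - u c x)^2\<bar> \<le> (2 * K)^2 * exp (- (2 * a) * \<bar>x\<bar>))"
      using ev
    proof eventually_elim
      case (elim c')
      have [measurable]: "u c' \<in> borel_measurable borel" "u c \<in> borel_measurable borel"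
        using decaying_measurable[OF u] r(4)[of c'] elim c by auto
      have "(u c' x - u c x)^2 \<le> (2 * K)^2 * exp (- (2 * a) * \<bar>x\<bar>)" for x
      proof -
        have "\<bar>u c' x - u c x\<bar> \<le> 2 * K * exp (- a * \<bar>x\<bar>)"
          using r(5)[OF elim, of x] r(5)[of c x] r(1) by linarith
        from power_mono[OF this, of 2] show ?thesis
          by (simp add: power_mult_distrib exp_double[symmetric] mult.assoc)
      qed
      then show ?case by auto
    qed
  qed auto
  then show ?thesis by simp
qed

section \<open>Differentiability and continuity in Sobolev norms\<close>

lemma H_norm_sq_eq:
  assumes "\<And>i. i \<le> n \<Longrightarrow> L2fun (g i) \<and> is_weak_deriv i u (g i)"
  shows "H_norm_sq n u = (\<Sum>i\<le>n. LINT x|lborel. (g i x)^2)"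
  unfolding H_norm_sq_def by (intro sum.cong weak_deriv_L2_eq) (use assms in auto)

lemma L2fun_cmult:
  assumes "L2fun u"
  shows "L2fun (\<lambda>x. k * u x)"
  using assms by (auto simp: L2fun_def power_mult_distrib)

text \<open>The \<open>k\<close>-th weak derivative of the remainder of \<open>U 0\<close> is the
  remainder of \<open>U k\<close>, so the norm is a finite sum of \<open>L\<^sup>2\<close>
  remainders.\<close>

lemma H_norm_sq_remainder_tendsto:
  assumes fam: "\<And>k. k \<le> n \<Longrightarrow> deriv_family I (U k) (U' k)"
    and wd: "\<And>k c. k \<le> n \<Longrightarrow> c \<in> I \<Longrightarrow> is_weak_deriv k (U 0 c) (U k c)"
    and c: "c \<in> I"
  shows "((\<lambda>h. H_norm_sq n (\<lambda>x. U 0 (c + h) x - U 0 c x - h * U' 0 c x) / h^2) \<longlongrightarrow> 0) (at 0)"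
proof -
  obtain r where r: "0 < r" "\<And>c'. \<bar>c' - c\<bar> < r \<Longrightarrow> c' \<in> I"
    using decaying_nbhd[of I "U 0" c] fam[of 0] c unfolding deriv_family_def by blast
  have "((\<lambda>h. \<Sum>k\<le>n. LINT x|lborel. ((U k (c + h) x - U k c x - h * U' k c x) / h)^2) \<longlongrightarrow> (\<Sum>k\<le>n. 0)) (at 0)"
    by (intro tendsto_sum L2_remainder_tendsto[OF _ c] fam) auto
  moreover have "\<forall>\<^sub>F h in at 0. (\<Sum>k\<le>n. LINT x|lborel. ((U k (c + h) x - U k c x - h * U' k c x) / h)^2)
      = H_norm_sq n (\<lambda>x. U 0 (c + h) x - U 0 c x - h * U' 0 c x) / h^2"
    using eventually_abs_less_at_0[OF r(1)]
  proof eventually_elim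
    case (elim h)
    have ch: "c + h \<in> I" using r(2)[of "c + h"] elim by auto
    have "H_norm_sq n (\<lambda>x. U 0 (c + h) x - U 0 c x - h * U' 0 c x)
        = (\<Sum>k\<le>n. LINT x|lborel. (U k (c + h) x - U k c x - h * U' k c x)^2)"
    proof (rule H_norm_sq_eq)
      fix i assume i: "i \<le> n"
      have "decaying I (U i)" "decaying I (U' i)" using fam[OF i] by (auto simp: deriv_family_def)
      then have "L2fun (\<lambda>x. U i (c + h) x - U i c x - h * U' i c x)"
        by (intro L2fun_diff L2fun_cmult) (auto intro: decaying_L2 ch c)
      moreover have "is_weak_deriv i (U' 0 c) (U' i c)"
        by (rule is_weak_deriv_param[OF fam fam]) (use i wd c in auto)
      then have "is_weak_deriv i (\<lambda>x. (U 0 (c + h) x + (-1) * U 0 c x) + (- h) * U' 0 c x)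
          (\<lambda>x. (U i (c + h) x + (-1) * U i c x) + (- h) * U' i c x)"
        by (intro is_weak_deriv_lincomb wd i ch c)
      ultimately show "L2fun (\<lambda>x. U i (c + h) x - U i c x - h * U' i c x) \<and>
          is_weak_deriv i (\<lambda>x. U 0 (c + h) x - U 0 c x - h * U' 0 c x)
            (\<lambda>x. U i (c + h) x - U i c x - h * U' i c x)"
        by simp
    qed
    then show ?case by (simp add: power_divide sum_divide_distrib)
  qed
  ultimately show ?thesis using Lim_transform_eventually by fastforce
qed

lemma H_norm_sq_difference_tendsto:
  assumes dec: "\<And>k. k \<le> n \<Longrightarrow> decaying I (U k)"
    and cont: "\<And>k x. k \<le> n \<Longrightarrow> isCont (\<lambda>c. U k c x) c"
    and wd: "\<And>k c. k \<le> n \<Longrightarrow> c \<in> I \<Longrightarrow> is_weak_deriv k (U 0 c) (U k c)"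
    and c: "c \<in> I"
  shows "((\<lambda>c'. H_norm_sq n (\<lambda>x. U 0 c' x - U 0 c x)) \<longlongrightarrow> 0) (at c)"
proof -
  obtain r where r: "0 < r" "\<And>c'. \<bar>c' - c\<bar> < r \<Longrightarrow> c' \<in> I"
    using decaying_nbhd[of I "U 0" c] dec[of 0] c by blast
  have "((\<lambda>c'. \<Sum>k\<le>n. LINT x|lborel. (U k c' x - U k c x)^2) \<longlongrightarrow> (\<Sum>k\<le>n. 0)) (at c)"
    by (intro tendsto_sum L2_difference_tendsto[OF _ c] dec cont) auto
  moreover have "\<forall>\<^sub>F c' in at c. \<bar>c' - c\<bar> < r"
    using r(1) unfolding eventually_at by (auto simp: dist_real_def)
  then have "\<forall>\<^sub>F c' in at c. (\<Sum>k\<le>n. LINT x|lborel. (U k c' x - U k c x)^2)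
      = H_norm_sq n (\<lambda>x. U 0 c' x - U 0 c x)"
  proof eventually_elim
    case (elim c')
    have c': "c' \<in> I" using r(2) elim by auto
    have "L2fun (\<lambda>x. U i c' x - U i c x) \<and>
        is_weak_deriv i (\<lambda>x. U 0 c' x - U 0 c x) (\<lambda>x. U i c' x - U i c x)" if "i \<le> n" for i
      using is_weak_deriv_lincomb[OF wd[OF that c'] wd[OF that c], of "-1"]
        L2fun_diff[OF decaying_L2[OF dec[OF that] c'] decaying_L2[OF dec[OF that] c]] by simp
    then show ?case by (intro H_norm_sq_eq[where g = "\<lambda>i x. U i c' x - U i c x", symmetric])
  qed
  ultimately show ?thesis using Lim_transform_eventually by fastforce
qed

text \<open>Only \<open>U\<close> is assumed to be classically differentiable in \<open>x\<close>: the parameter derivatives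
  inherit their weak derivatives by differentiation under the integral against test functions.\<close>

locale C2_family =
  fixes I :: "real set" and n :: nat and U U1 U2 :: "nat \<Rightarrow> real \<Rightarrow> real \<Rightarrow> real"
  assumes fam1: "k \<le> n \<Longrightarrow> deriv_family I (U k) (U1 k)"
    and fam2: "k \<le> n \<Longrightarrow> deriv_family I (U1 k) (U2 k)"
    and cont2: "k \<le> n \<Longrightarrow> c \<in> I \<Longrightarrow> isCont (\<lambda>c. U2 k c x) c"
    and derivx: "k < n \<Longrightarrow> c \<in> I \<Longrightarrow> (U k c has_real_derivative U (Suc k) c x) (at x)"
begin

lemma U_cont: "k \<le> n \<Longrightarrow> c \<in> I \<Longrightarrow> continuous_on UNIV (U k c)"
  using fam1 by (auto simp: deriv_family_def decaying_def)

lemma wd: "k \<le> n \<Longrightarrow> c \<in> I \<Longrightarrow> is_weak_deriv k (U 0 c) (U k c)"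
proof (induction k)
  case (Suc k)
  show ?case
    by (rule is_weak_deriv_Suc[of k _ "U k c"]) (use Suc in \<open>auto intro: U_cont derivx\<close>)
qed (auto intro: is_weak_deriv_0 U_cont)

lemma wd1: "k \<le> n \<Longrightarrow> c \<in> I \<Longrightarrow> is_weak_deriv k (U1 0 c) (U1 k c)"
  by (rule is_weak_deriv_param[OF fam1 fam1]) (auto intro: wd)

lemma wd2: "k \<le> n \<Longrightarrow> c \<in> I \<Longrightarrow> is_weak_deriv k (U2 0 c) (U2 k c)"
  by (rule is_weak_deriv_param[OF fam2 fam2]) (auto intro: wd1)

lemma in_H_family:
  assumes "c \<in> I"
  shows "in_H n (U 0 c)" "in_H n (U1 0 c)" "in_H n (U2 0 c)"
proof -
  have d: "decaying I (U k)" "decaying I (U1 k)" "decaying I (U2 k)" if "k \<le> n" for k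
    using fam1[OF that] fam2[OF that] by (auto simp: deriv_family_def)
  have c0: "continuous_on UNIV (U 0 c)" "continuous_on UNIV (U1 0 c)" "continuous_on UNIV (U2 0 c)"
    using d[of 0] assms by (auto simp: decaying_def)
  show "in_H n (U 0 c)"
    using c0(1) wd[OF _ assms] decaying_L2[OF d(1) assms] unfolding in_H_def by blast
  show "in_H n (U1 0 c)"
    using c0(2) wd1[OF _ assms] decaying_L2[OF d(2) assms] unfolding in_H_def by blast
  show "in_H n (U2 0 c)"
    using c0(3) wd2[OF _ assms] decaying_L2[OF d(3) assms] unfolding in_H_def by blast
qed

lemmas norm_deriv1 = H_norm_sq_remainder_tendsto[OF fam1 wd]
lemmas norm_deriv2 = H_norm_sq_remainder_tendsto[OF fam2 wd1]

lemma norm_cont2: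
  assumes "c \<in> I"
  shows "((\<lambda>c'. H_norm_sq n (\<lambda>x. U2 0 c' x - U2 0 c x)) \<longlongrightarrow> 0) (at c)"
  by (rule H_norm_sq_difference_tendsto[of n I U2, OF _ cont2[OF _ assms] wd2 assms])
    (use fam2 in \<open>auto simp: deriv_family_def\<close>)

end

lemma has_X_derivI:
  assumes "((\<lambda>h. H_norm_sq (k + 1) (\<lambda>x. E (c + h) x - E c x - h * E' c x) / h^2) \<longlongrightarrow> 0) (at 0)"
    "((\<lambda>h. H_norm_sq k (\<lambda>x. V (c + h) x - V c x - h * V' c x) / h^2) \<longlongrightarrow> 0) (at 0)"
  shows "has_X_deriv k E V E' V' c"
proof -
  have "((\<lambda>h. sqrt (H_norm_sq (k + 1) (\<lambda>x. E (c + h) x - E c x - h * E' c x) / h^2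
      + H_norm_sq k (\<lambda>x. V (c + h) x - V c x - h * V' c x) / h^2)) \<longlongrightarrow> sqrt (0 + 0)) (at 0)"
    by (intro tendsto_intros assms)
  then show ?thesis
    unfolding has_X_deriv_def X_norm_def
    by (simp add: add_divide_distrib[symmetric] real_sqrt_divide)
qed

lemma X_continuous_atI:
  assumes "((\<lambda>c'. H_norm_sq (k + 1) (\<lambda>x. E c' x - E c x)) \<longlongrightarrow> 0) (at c)"
    "((\<lambda>c'. H_norm_sq k (\<lambda>x. V c' x - V c x)) \<longlongrightarrow> 0) (at c)"
  shows "X_continuous_at k E V c"
proof -
  have "((\<lambda>c'. sqrt (H_norm_sq (k + 1) (\<lambda>x. E c' x - E c x) + H_norm_sq k (\<lambda>x. V c' x - V c x)))
      \<longlongrightarrow> sqrt (0 + 0)) (at c)"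
    by (intro tendsto_intros assms)
  then show ?thesis unfolding X_continuous_at_def X_norm_def by simp
qed

lemma C2_NX_families:
  assumes E: "C2_family I (k + 1) U U1 U2" and V: "C2_family I k V V1 V2"
    and sup: "\<And>c. c \<in> I \<Longrightarrow> Sup (range (U 0 c)) < 1"
  shows "C2_NX k I (U 0) (V 0)"
proof -
  interpret E: C2_family I "k + 1" U U1 U2 by (rule E)
  interpret V: C2_family I k V V1 V2 by (rule V)
  show ?thesis
    unfolding C2_NX_def in_NX_def in_X_def
    by (intro exI[of _ "U1 0"] exI[of _ "U2 0"] exI[of _ "V1 0"] exI[of _ "V2 0"] ballI conjI
        E.in_H_family V.in_H_family has_X_derivI X_continuous_atI E.norm_deriv1 E.norm_deriv2
        E.norm_cont2 V.norm_deriv1 V.norm_deriv2 V.norm_cont2 sup)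
qed

section \<open>Weighted classes\<close>

text \<open>\<open>B\<close> is the size of \<open>u\<close>, and every application of the derivation \<open>m(c) d/dc\<close> must preserve
  this size up to powers of \<open>L\<close>. The variable \<open>x\<close> is a parameter.\<close>

definition wbound ::
  "real set \<Rightarrow> (real \<Rightarrow> real \<Rightarrow> real) \<Rightarrow> (real \<Rightarrow> real \<Rightarrow> real) \<Rightarrow> (real \<Rightarrow> real \<Rightarrow> real) \<Rightarrow> bool" where
  "wbound I L B u \<longleftrightarrow>
     (\<exists>N K. 0 \<le> K \<and> (\<forall>c\<in>I. \<forall>x. \<bar>u c x\<bar> \<le> K * L c x ^ N * B c x)) \<and>
     (\<forall>c\<in>I. \<forall>x. 0 \<le> B c x) \<and>
     (\<forall>x. continuous_on I (\<lambda>c. u c x)) \<and> (\<forall>c\<in>I. continuous_on UNIV (u c))"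

primrec wclass ::
  "real set \<Rightarrow> (real \<Rightarrow> real) \<Rightarrow> (real \<Rightarrow> real \<Rightarrow> real) \<Rightarrow> nat \<Rightarrow>
   (real \<Rightarrow> real \<Rightarrow> real) \<Rightarrow> (real \<Rightarrow> real \<Rightarrow> real) \<Rightarrow> bool" where
  "wclass I m L 0 B u \<longleftrightarrow> wbound I L B u"
| "wclass I m L (Suc n) B u \<longleftrightarrow> wbound I L B u \<and>
     (\<exists>u'. (\<forall>c\<in>I. \<forall>x. ((\<lambda>c. u c x) has_real_derivative u' c x) (at c)) \<and>
        wclass I m L n B (\<lambda>c x. m c * u' c x))"

lemma wclass_wbound: "wclass I m L n B u \<Longrightarrow> wbound I L B u"
  by (cases n) auto

lemma wbound_continuous:
  assumes "wbound I L B u"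
  shows "continuous_on I (\<lambda>c. u c x)" "c \<in> I \<Longrightarrow> continuous_on UNIV (u c)"
  using assms by (auto simp: wbound_def)

lemma wclass_Suc_D: "wclass I m L (Suc n) B u \<Longrightarrow> wclass I m L n B u"
  by (induction n arbitrary: u) (auto dest: wclass_wbound)

lemma wclass_antimono: "wclass I m L n B u \<Longrightarrow> k \<le> n \<Longrightarrow> wclass I m L k B u"
  by (induction n) (auto simp: le_Suc_eq simp del: wclass.simps(2) intro: wclass_Suc_D)

locale weights =
  fixes I :: "real set" and m :: "real \<Rightarrow> real" and L :: "real \<Rightarrow> real \<Rightarrow> real"
  assumes open_I: "open I" and L_ge_1: "c \<in> I \<Longrightarrow> 1 \<le> L c x"
begin

abbreviation cls where "cls \<equiv> wclass I m L"

section \<open>Algebra of the weighted classes\<close>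

lemma wboundI:
  assumes "0 \<le> K" "\<And>c x. c \<in> I \<Longrightarrow> \<bar>u c x\<bar> \<le> K * L c x ^ N * B c x" "\<And>c x. c \<in> I \<Longrightarrow> 0 \<le> B c x"
    "\<And>x. continuous_on I (\<lambda>c. u c x)" "\<And>c. c \<in> I \<Longrightarrow> continuous_on UNIV (u c)"
  shows "wbound I L B u"
  using assms unfolding wbound_def by blast

lemma wboundI0:
  assumes "0 \<le> K" "\<And>c x. c \<in> I \<Longrightarrow> \<bar>u c x\<bar> \<le> K * B c x" "\<And>c x. c \<in> I \<Longrightarrow> 0 \<le> B c x"
    "\<And>x. continuous_on I (\<lambda>c. u c x)" "\<And>c. c \<in> I \<Longrightarrow> continuous_on UNIV (u c)"
  shows "wbound I L B u"
  using wboundI[of K u 0 B] assms by simp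

lemma clsSI:
  assumes "wbound I L B u"
    "\<And>c x. c \<in> I \<Longrightarrow> ((\<lambda>c. u c x) has_real_derivative u' c x) (at c)"
    "cls n B (\<lambda>c x. m c * u' c x)"
  shows "cls (Suc n) B u"
  using assms by auto

lemma clsSE:
  assumes "cls (Suc n) B u"
  obtains u' where "\<And>c x. c \<in> I \<Longrightarrow> ((\<lambda>c. u c x) has_real_derivative u' c x) (at c)"
    "cls n B (\<lambda>c x. m c * u' c x)"
  using assms by auto

lemma wbound_cong:
  assumes "wbound I L B u" "\<And>c x. c \<in> I \<Longrightarrow> u c x = v c x"
  shows "wbound I L B v"
  using assms by (auto simp: wbound_def cong: continuous_on_cong)

lemma cls_cong:
  assumes "cls n B u" "\<And>c x. c \<in> I \<Longrightarrow> u c x = v c x"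
  shows "cls n B v"
proof (cases n)
  case 0
  then show ?thesis using assms wbound_cong by auto
next
  case (Suc k)
  obtain u' where u': "\<And>c x. c \<in> I \<Longrightarrow> ((\<lambda>c. u c x) has_real_derivative u' c x) (at c)"
    "cls k B (\<lambda>c x. m c * u' c x)"
    using assms(1) unfolding Suc by (rule clsSE) blast
  have "((\<lambda>c. v c x) has_real_derivative u' c x) (at c)" if "c \<in> I" for c x
    by (rule has_field_derivative_transform_within_open[OF u'(1)[OF that, of x] open_I that])
      (use assms(2) in simp)
  then show ?thesis
    unfolding Suc using u' wbound_cong[OF wclass_wbound[OF assms(1)] assms(2)] by (intro clsSI) auto
qed

lemma wbound_le:
  assumes "wbound I L A u" "0 \<le> K" "\<And>c x. c \<in> I \<Longrightarrow> A c x \<le> K * B c x"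
    "\<And>c x. c \<in> I \<Longrightarrow> 0 \<le> B c x"
  shows "wbound I L B u"
proof -
  obtain N K' where K': "0 \<le> K'" "\<And>c x. c \<in> I \<Longrightarrow> \<bar>u c x\<bar> \<le> K' * L c x ^ N * A c x"
    using assms(1) unfolding wbound_def by blast
  show ?thesis
  proof (rule wboundI)
    show "0 \<le> K' * K" using K' assms by simp
    fix c x assume c: "c \<in> I"
    have "0 \<le> K' * L c x ^ N" using K' L_ge_1[OF c, of x] by simp
    then have "K' * L c x ^ N * A c x \<le> K' * L c x ^ N * (K * B c x)"
      using assms(3)[OF c] by (intro mult_left_mono) auto
    then show "\<bar>u c x\<bar> \<le> K' * K * L c x ^ N * B c x"
      using K'(2)[OF c, of x] by (simp add: algebra_simps)
  qed (use assms in \<open>auto simp: wbound_def\<close>)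
qed

lemma cls_le:
  assumes "cls n A u" "0 \<le> K" "\<And>c x. c \<in> I \<Longrightarrow> A c x \<le> K * B c x"
    "\<And>c x. c \<in> I \<Longrightarrow> 0 \<le> B c x"
  shows "cls n B u"
  using assms(1)
proof (induction n arbitrary: u)
  case 0
  then show ?case using wbound_le assms by auto
next
  case (Suc n)
  from Suc.prems obtain u' where "\<And>c x. c \<in> I \<Longrightarrow> ((\<lambda>c. u c x) has_real_derivative u' c x) (at c)"
    "cls n A (\<lambda>c x. m c * u' c x)"
    by (rule clsSE) blast
  then show ?case
    using Suc wbound_le[OF wclass_wbound[OF Suc.prems] assms(2-)] by (intro clsSI) auto
qed

lemma wbound_add:
  assumes "wbound I L B u" "wbound I L B v"
  shows "wbound I L B (\<lambda>c x. u c x + v c x)"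
proof -
  obtain N K where K: "0 \<le> K" "\<And>c x. c \<in> I \<Longrightarrow> \<bar>u c x\<bar> \<le> K * L c x ^ N * B c x"
    using assms(1) unfolding wbound_def by blast
  obtain N' K' where K': "0 \<le> K'" "\<And>c x. c \<in> I \<Longrightarrow> \<bar>v c x\<bar> \<le> K' * L c x ^ N' * B c x"
    using assms(2) unfolding wbound_def by blast
  show ?thesis
  proof (rule wboundI)
    show "0 \<le> K + K'" using K K' by simp
    fix c x assume c: "c \<in> I"
    have B: "0 \<le> B c x" using assms c by (auto simp: wbound_def)
    have "K * L c x ^ N * B c x \<le> K * L c x ^ (N + N') * B c x"
      "K' * L c x ^ N' * B c x \<le> K' * L c x ^ (N + N') * B c x"
      using L_ge_1[OF c, of x] K K' B
      by (auto intro!: mult_right_mono mult_left_mono power_increasing)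
    then show "\<bar>u c x + v c x\<bar> \<le> (K + K') * L c x ^ (N + N') * B c x"
      using K(2)[OF c, of x] K'(2)[OF c, of x] by (simp add: algebra_simps)
  qed (use assms in \<open>auto simp: wbound_def intro!: continuous_intros\<close>)
qed

lemma wbound_mult:
  assumes "wbound I L A u" "wbound I L B v"
  shows "wbound I L (\<lambda>c x. A c x * B c x) (\<lambda>c x. u c x * v c x)"
proof -
  obtain N K where K: "0 \<le> K" "\<And>c x. c \<in> I \<Longrightarrow> \<bar>u c x\<bar> \<le> K * L c x ^ N * A c x"
    using assms(1) unfolding wbound_def by blast
  obtain N' K' where K': "0 \<le> K'" "\<And>c x. c \<in> I \<Longrightarrow> \<bar>v c x\<bar> \<le> K' * L c x ^ N' * B c x"
    using assms(2) unfolding wbound_def by blast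
  show ?thesis
  proof (rule wboundI)
    show "0 \<le> K * K'" using K K' by simp
    fix c x assume c: "c \<in> I"
    have "\<bar>u c x * v c x\<bar> \<le> (K * L c x ^ N * A c x) * (K' * L c x ^ N' * B c x)"
      unfolding abs_mult using K(2)[OF c, of x] K'(2)[OF c, of x]
      by (intro mult_mono) auto
    then show "\<bar>u c x * v c x\<bar> \<le> K * K' * L c x ^ (N + N') * (A c x * B c x)"
      by (simp add: algebra_simps power_add)
  qed (use assms in \<open>auto simp: wbound_def intro!: continuous_intros\<close>)
qed

lemma cls_add:
  assumes "cls n B u" "cls n B v"
  shows "cls n B (\<lambda>c x. u c x + v c x)"
  using assms
proof (induction n arbitrary: u v)
  case 0
  then show ?case using wbound_add by auto
next
  case (Suc n)
  from Suc.prems(1) obtain u' where u': "\<And>c x. c \<in> I \<Longrightarrow> ((\<lambda>c. u c x) has_real_derivative u' c x) (at c)"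
    "cls n B (\<lambda>c x. m c * u' c x)" by (rule clsSE) blast
  from Suc.prems(2) obtain v' where v': "\<And>c x. c \<in> I \<Longrightarrow> ((\<lambda>c. v c x) has_real_derivative v' c x) (at c)"
    "cls n B (\<lambda>c x. m c * v' c x)" by (rule clsSE) blast
  show ?case
  proof (rule clsSI[where u' = "\<lambda>c x. u' c x + v' c x"])
    show "cls n B (\<lambda>c x. m c * (u' c x + v' c x))"
      using Suc.IH[OF u'(2) v'(2)] by (simp add: distrib_left)
  qed (use Suc.prems u' v' in \<open>auto intro!: wbound_add derivative_intros intro: wclass_wbound simp del: wclass.simps\<close>)
qed

lemma cls_mult:
  assumes "cls n A u" "cls n B v"
  shows "cls n (\<lambda>c x. A c x * B c x) (\<lambda>c x. u c x * v c x)"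
  using assms
proof (induction n arbitrary: u v)
  case 0
  then show ?case using wbound_mult by auto
next
  case (Suc n)
  from Suc.prems(1) obtain u' where u': "\<And>c x. c \<in> I \<Longrightarrow> ((\<lambda>c. u c x) has_real_derivative u' c x) (at c)"
    "cls n A (\<lambda>c x. m c * u' c x)" by (rule clsSE) blast
  from Suc.prems(2) obtain v' where v': "\<And>c x. c \<in> I \<Longrightarrow> ((\<lambda>c. v c x) has_real_derivative v' c x) (at c)"
    "cls n B (\<lambda>c x. m c * v' c x)" by (rule clsSE) blast
  show ?case
  proof (rule clsSI[where u' = "\<lambda>c x. u' c x * v c x + v' c x * u c x"])
    have "cls n (\<lambda>c x. A c x * B c x) (\<lambda>c x. (m c * u' c x) * v c x + u c x * (m c * v' c x))"
      using Suc.IH[OF u'(2) wclass_Suc_D[OF Suc.prems(2)]] Suc.IH[OF wclass_Suc_D[OF Suc.prems(1)] v'(2)]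
      by (rule cls_add)
    then show "cls n (\<lambda>c x. A c x * B c x) (\<lambda>c x. m c * (u' c x * v c x + v' c x * u c x))"
      by (rule cls_cong) (simp add: algebra_simps)
  qed (use Suc.prems u' v' in \<open>auto intro!: wbound_mult DERIV_mult intro: wclass_wbound simp del: wclass.simps\<close>)
qed

lemma cls_mult_le:
  assumes "cls n A u" "cls n B v" "0 \<le> K" "\<And>c x. c \<in> I \<Longrightarrow> A c x * B c x \<le> K * D c x"
    "\<And>c x. c \<in> I \<Longrightarrow> 0 \<le> D c x"
  shows "cls n D (\<lambda>c x. u c x * v c x)"
  by (rule cls_le[OF cls_mult[OF assms(1,2)] assms(3-)])

lemma cls_zero: "(\<And>c x. c \<in> I \<Longrightarrow> 0 \<le> B c x) \<Longrightarrow> cls n B (\<lambda>c x. 0)"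
proof (induction n)
  case 0
  then show ?case by (auto intro!: wboundI0[of 0])
next
  case (Suc n)
  then show ?case by (intro clsSI[where u' = "\<lambda>_ _. 0"]) (auto intro!: wboundI0[of 0])
qed

lemma cls_const: "cls n (\<lambda>_ _. 1) (\<lambda>c x. k)"
proof (cases n)
  case 0
  then show ?thesis by (auto intro!: wboundI0[of "\<bar>k\<bar>"])
next
  case (Suc n)
  show ?thesis unfolding Suc
    by (intro clsSI[where u' = "\<lambda>_ _. 0"]) (auto intro!: wboundI0[of "\<bar>k\<bar>"] cls_zero)
qed

lemma cls_mult1:
  assumes "cls n (\<lambda>_ _. 1) u" "cls n B v"
  shows "cls n B (\<lambda>c x. u c x * v c x)"
  using cls_mult[OF assms] by simp

lemma cls_cmult:
  assumes "cls n B v"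
  shows "cls n B (\<lambda>c x. k * v c x)"
  by (rule cls_mult1[OF cls_const assms])

lemma cls_diff:
  assumes "cls n B u" "cls n B v"
  shows "cls n B (\<lambda>c x. u c x - v c x)"
  using cls_add[OF assms(1) cls_cmult[OF assms(2), of "-1"]] by simp

text \<open>The derivation maps \<open>1 / u\<close> to \<open>- (m u') / u\<^sup>2\<close>. The
  condition on the product of \<open>A\<close> and \<open>B\<close> makes \<open>(m u') / u\<close>
  of size \<open>1\<close>, so a single factor \<open>1 / u\<close> carries the size
  \<open>B\<close> and the induction closes.\<close>

lemma cls_inverse:
  assumes "cls n A u" "wbound I L B (\<lambda>c x. 1 / u c x)" "0 \<le> K"
    "\<And>c x. c \<in> I \<Longrightarrow> A c x * B c x \<le> K" "\<And>c x. c \<in> I \<Longrightarrow> u c x \<noteq> 0"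
  shows "cls n B (\<lambda>c x. 1 / u c x)"
  using assms(1)
proof (induction n)
  case 0
  then show ?case using assms by auto
next
  case (Suc n)
  from Suc.prems obtain u' where u': "\<And>c x. c \<in> I \<Longrightarrow> ((\<lambda>c. u c x) has_real_derivative u' c x) (at c)"
    "cls n A (\<lambda>c x. m c * u' c x)" by (rule clsSE) blast
  have B: "0 \<le> B c x" if "c \<in> I" for c x using assms(2) that by (auto simp: wbound_def)
  have i: "cls n B (\<lambda>c x. 1 / u c x)" using Suc wclass_Suc_D by blast
  have "cls n (\<lambda>_ _. 1) (\<lambda>c x. m c * u' c x * (1 / u c x))"
    by (rule cls_mult_le[OF u'(2) i assms(3)]) (use assms in auto)
  then have "cls n B (\<lambda>c x. m c * u' c x * (1 / u c x) * (1 / u c x))"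
    by (rule cls_mult1[OF _ i])
  from cls_cmult[OF this, of "-1"]
  have "cls n B (\<lambda>c x. m c * (- u' c x / (u c x)^2))"
    by (simp add: power2_eq_square divide_simps)
  moreover have "((\<lambda>c. 1 / u c x) has_real_derivative (- u' c x / (u c x)^2)) (at c)" if "c \<in> I" for c x
    using u'(1)[OF that] assms(5)[OF that]
    by (auto intro!: derivative_eq_intros simp: power2_eq_square)
  ultimately show ?case by (intro clsSI assms(2))
qed

end

text \<open>Functions of one variable under the derivation \<open>w d/dw\<close>. The second
  variable is a dummy, so that the algebra of the two-variable classes applies unchanged.\<close>

abbreviation rclass :: "real set \<Rightarrow> nat \<Rightarrow> (real \<Rightarrow> real) \<Rightarrow> (real \<Rightarrow> real) \<Rightarrow> bool" where
  "rclass J n E \<phi> \<equiv> wclass J (\<lambda>w. w) (\<lambda>_ _. 1) n (\<lambda>w _. E w) (\<lambda>w _. \<phi> w)"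

lemma rclass_SucE:
  assumes "rclass J (Suc n) E \<phi>" "open J"
  obtains \<phi>' where "\<And>w. w \<in> J \<Longrightarrow> (\<phi> has_real_derivative \<phi>' w) (at w)" "rclass J n E (\<lambda>w. w * \<phi>' w)"
proof -
  interpret weights J "\<lambda>w. w" "\<lambda>_ _. 1" using assms(2) by unfold_locales auto
  obtain \<phi>' where p: "\<And>w x. w \<in> J \<Longrightarrow> ((\<lambda>w. \<phi> w) has_real_derivative \<phi>' w x) (at w)"
    "wclass J (\<lambda>w. w) (\<lambda>_ _. 1) n (\<lambda>w _. E w) (\<lambda>w x. w * \<phi>' w x)"
    using assms(1) by auto
  \<comment> \<open>The derivative witness may formally depend on the dummy variable; uniqueness of
    derivatives removes the dependence.\<close>
  have "w * \<phi>' w x = w * \<phi>' w 0" if "w \<in> J" for w x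
    using DERIV_unique[OF p(1)[OF that, of x] p(1)[OF that, of 0]] by simp
  with p(2) have "rclass J n E (\<lambda>w. w * \<phi>' w 0)"
    by (rule cls_cong)
  with p(1) show ?thesis by (intro that[of "\<lambda>w. \<phi>' w 0"])
qed

context weights
begin

text \<open>The derivation acts by \<open>m d/dc \<phi>(u) = ((m u') / u) (u \<phi>'(u))\<close>.
  The first factor is of size \<open>1\<close> because \<open>u\<close> is its own weight, the
  second is the composition with \<open>w \<phi>'(w)\<close>. Thus only \<open>w d/dw\<close> ever
  falls on \<open>\<phi>\<close>, whose plain derivatives may be singular at
  \<open>0\<close>.\<close>

lemma cls_compose:
  assumes "open J" "J \<subseteq> {0<..}"
    and u: "cls n u u" "\<And>c x. c \<in> I \<Longrightarrow> u c x \<in> J"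
    and \<phi>: "rclass J n E \<phi>"
  shows "cls n (\<lambda>c x. E (u c x)) (\<lambda>c x. \<phi> (u c x))"
  using u(1) \<phi>
proof (induction n arbitrary: \<phi>)
  have base: "wbound I L (\<lambda>c x. E (u c x)) (\<lambda>c x. \<phi> (u c x))"
    if u0: "wbound I L u u" and \<phi>: "rclass J 0 E \<phi>" for \<phi>
  proof -
    obtain K where K: "0 \<le> K" "\<And>w. w \<in> J \<Longrightarrow> \<bar>\<phi> w\<bar> \<le> K * E w"
      and E: "\<And>w. w \<in> J \<Longrightarrow> 0 \<le> E w" and \<phi>c: "continuous_on J \<phi>"
      using \<phi> by (auto simp: wbound_def)
    show ?thesis
    proof (rule wboundI0[OF K(1)])
      show "continuous_on I (\<lambda>c. \<phi> (u c x))" for x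
        using u0 u(2) by (intro continuous_on_compose2[OF \<phi>c]) (auto simp: wbound_def)
      show "continuous_on UNIV (\<lambda>x. \<phi> (u c x))" if "c \<in> I" for c
        using u0 u(2) that by (intro continuous_on_compose2[OF \<phi>c]) (auto simp: wbound_def)
    qed (use K E u(2) in auto)
  qed
  {
    case 0
    then show ?case using base by auto
  next
    case (Suc n)
    have b: "wbound I L (\<lambda>c x. E (u c x)) (\<lambda>c x. \<phi> (u c x))"
      by (rule base) (use Suc.prems in \<open>auto dest: wclass_wbound\<close>)
    from Suc.prems(1) obtain u' where u': "\<And>c x. c \<in> I \<Longrightarrow> ((\<lambda>c. u c x) has_real_derivative u' c x) (at c)"
      "cls n u (\<lambda>c x. m c * u' c x)" by (rule clsSE) blast
    from Suc.prems(2) assms(1) obtain \<phi>' where \<phi>': "\<And>w. w \<in> J \<Longrightarrow> (\<phi> has_real_derivative \<phi>' w) (at w)"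
      "rclass J n E (\<lambda>w. w * \<phi>' w)" by (rule rclass_SucE) blast
    have un: "cls n u u" using Suc.prems wclass_Suc_D by blast
    have pos: "u c x > 0" if "c \<in> I" for c x using u(2)[OF that] assms(2) by auto
    have ne: "u c x \<noteq> 0" if "c \<in> I" for c x using pos[OF that, of x] by simp
    have "wbound I L (\<lambda>c x. 1 / u c x) (\<lambda>c x. 1 / u c x)"
    proof (rule wboundI0[of 1])
      show "continuous_on I (\<lambda>c. 1 / u c x)" for x
        using wclass_wbound[OF un] ne by (auto simp: wbound_def intro!: continuous_intros)
      show "continuous_on UNIV (\<lambda>x. 1 / u c x)" if "c \<in> I" for c
        using wclass_wbound[OF un] ne[OF that] that
        by (auto simp: wbound_def intro!: continuous_intros)
    qed (use pos in \<open>auto simp: less_imp_le\<close>)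
    then have "cls n (\<lambda>c x. 1 / u c x) (\<lambda>c x. 1 / u c x)"
      by (rule cls_inverse[OF un, of _ 1]) (use ne in auto)
    then have "cls n (\<lambda>_ _. 1) (\<lambda>c x. m c * u' c x * (1 / u c x))"
      by (rule cls_mult_le[OF u'(2) _, of _ _ 1]) (use ne in auto)
    then have "cls n (\<lambda>c x. E (u c x)) (\<lambda>c x. m c * u' c x * (1 / u c x) * (u c x * \<phi>' (u c x)))"
      by (rule cls_mult1) (use Suc.IH[OF un \<phi>'(2)] in simp)
    then have "cls n (\<lambda>c x. E (u c x)) (\<lambda>c x. m c * (\<phi>' (u c x) * u' c x))"
      by (rule cls_cong) (use ne in auto)
    then show ?case
      by (intro clsSI[OF b, where u' = "\<lambda>c x. \<phi>' (u c x) * u' c x"])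
        (auto intro!: DERIV_chain2[OF \<phi>'(1)] u' u(2))
  }
qed

lemma cls_tanh:
  assumes "cls n (\<lambda>_ _. 1) s"
  shows "cls n (\<lambda>_ _. 1) (\<lambda>c x. tanh (s c x))"
  using assms
proof (induction n)
  have b: "wbound I L (\<lambda>_ _. 1) (\<lambda>c x. tanh (s c x))" if "cls n (\<lambda>_ _. 1) s" for n
  proof (rule wboundI0[of 1])
    show "\<bar>tanh (s c x)\<bar> \<le> 1 * 1" for c x
      using tanh_real_lt_1[of "s c x"] tanh_real_gt_neg1[of "s c x"] by linarith
  qed (use wclass_wbound[OF that] in \<open>auto simp: wbound_def intro!: continuous_intros\<close>)
  {
    case 0
    then show ?case using b[of 0] by simp
  next
    case (Suc n)
    from Suc.prems obtain s' where s': "\<And>c x. c \<in> I \<Longrightarrow> ((\<lambda>c. s c x) has_real_derivative s' c x) (at c)"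
      "cls n (\<lambda>_ _. 1) (\<lambda>c x. m c * s' c x)" by (rule clsSE) blast
    have t: "cls n (\<lambda>_ _. 1) (\<lambda>c x. tanh (s c x))" using Suc wclass_Suc_D by blast
    have "cls n (\<lambda>_ _. 1) (\<lambda>c x. (1 - tanh (s c x) * tanh (s c x)) * (m c * s' c x))"
      by (intro cls_mult1 cls_diff cls_const t s')
    then have "cls n (\<lambda>_ _. 1) (\<lambda>c x. m c * ((1 - tanh (s c x) ^ 2) * s' c x))"
      by (rule cls_cong) (simp add: power2_eq_square)
    then show ?case
      by (intro clsSI[OF b[OF Suc.prems], where u' = "\<lambda>c x. (1 - tanh (s c x) ^ 2) * s' c x"])
        (auto intro!: derivative_eq_intros s')
  }
qed

text \<open>The derivative is \<open>- 2 tanh s\<close> times the function itself times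
  \<open>s'\<close>, so the function can serve as its own weight: the exponential decay survives
  every derivation, whereas the weight \<open>1\<close> would lose it.\<close>

lemma cls_sech2:
  assumes "cls n (\<lambda>_ _. 1) s"
  shows "cls n (\<lambda>c x. 1 - tanh (s c x) ^ 2) (\<lambda>c x. 1 - tanh (s c x) ^ 2)"
  using assms
proof (induction n)
  have p: "0 \<le> 1 - tanh y ^ 2" for y :: real
    using tanh_real_lt_1[of y] tanh_real_gt_neg1[of y] by (simp add: abs_square_le_1 abs_le_iff)
  have b: "wbound I L (\<lambda>c x. 1 - tanh (s c x) ^ 2) (\<lambda>c x. 1 - tanh (s c x) ^ 2)"
    if "cls n (\<lambda>_ _. 1) s" for n
    by (rule wboundI0[of 1]) 
      (use wclass_wbound[OF that] p in \<open>auto simp: wbound_def intro!: continuous_intros\<close>)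
  {
    case 0
    then show ?case using b[of 0] by simp
  next
    case (Suc n)
    from Suc.prems obtain s' where s': "\<And>c x. c \<in> I \<Longrightarrow> ((\<lambda>c. s c x) has_real_derivative s' c x) (at c)"
      "cls n (\<lambda>_ _. 1) (\<lambda>c x. m c * s' c x)" by (rule clsSE) blast
    have sn: "cls n (\<lambda>_ _. 1) s" using Suc.prems wclass_Suc_D by blast
    have "cls n (\<lambda>c x. 1 - tanh (s c x) ^ 2)
        (\<lambda>c x. ((- 2) * (tanh (s c x) * (m c * s' c x))) * (1 - tanh (s c x) ^ 2))"
      by (intro cls_mult1 cls_cmult cls_tanh sn s' Suc.IH)
    then have "cls n (\<lambda>c x. 1 - tanh (s c x) ^ 2)
        (\<lambda>c x. m c * (- 2 * tanh (s c x) * (1 - tanh (s c x) ^ 2) * s' c x))"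
      by (rule cls_cong) (simp add: algebra_simps)
    then show ?case
      by (intro clsSI[OF b[OF Suc.prems],
            where u' = "\<lambda>c x. - 2 * tanh (s c x) * (1 - tanh (s c x) ^ 2) * s' c x"])
        (auto intro!: derivative_eq_intros s')
  }
qed

end

section \<open>The phase function\<close>

abbreviation sech2 :: "real \<Rightarrow> real" where "sech2 y \<equiv> 1 - (tanh y)\<^sup>2"

lemma sech2_bounds: "0 < sech2 y" "sech2 y \<le> 1"
  using tanh_real_lt_1[of y] tanh_real_gt_neg1[of y] by (auto simp: abs_square_less_1 abs_less_iff)

lemma mult_sech2_mem:
  assumes "\<mu> \<in> {0<..<w}"
  shows "\<mu> * sech2 y \<in> {0<..<w}"
proof -
  have "\<mu> * sech2 y \<le> \<mu> * 1" using assms sech2_bounds[of y] by (intro mult_left_mono) auto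
  moreover have "0 < \<mu> * sech2 y" using assms sech2_bounds[of y] by (intro mult_pos_pos) auto
  ultimately show ?thesis using assms by auto
qed

text \<open>This is the integral of \<open>k (\<mu> sech\<^sup>2)\<close> from \<open>0\<close> to \<open>t\<close>, for either sign of \<open>t\<close>.\<close>

definition Kint :: "(real \<Rightarrow> real) \<Rightarrow> real \<Rightarrow> real \<Rightarrow> real" where
  "Kint k t \<mu> = t * integral {0..1} (\<lambda>r. k (\<mu> * sech2 (t * r)))"

lemma Kint_integrand_continuous:
  assumes "continuous_on {0<..<w} k"
  shows "continuous_on ((UNIV \<times> {0<..<w}) \<times> S) (\<lambda>((t, \<mu>), r). k (\<mu> * sech2 (t * r)))"
proof -
  have "continuous_on ((UNIV \<times> {0<..<w}) \<times> S)
      (\<lambda>z. k (snd (fst z) * sech2 (fst (fst z) * snd z)))"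
    by (rule continuous_on_compose2[OF assms])
      (auto intro!: continuous_intros simp del: greaterThanLessThan_iff intro: mult_sech2_mem)
  then show ?thesis by (simp add: split_beta)
qed

lemma Kint_continuous:
  assumes "continuous_on {0<..<w} k"
  shows "continuous_on (UNIV \<times> {0<..<w}) (\<lambda>(t, \<mu>). Kint k t \<mu>)"
proof -
  have "continuous_on (UNIV \<times> {0<..<w})
      (\<lambda>z. integral (cbox 0 1) (\<lambda>r. k (snd z * sech2 (fst z * r))))"
    by (rule integral_continuous_on_param)
      (use Kint_integrand_continuous[OF assms] in \<open>simp add: split_beta\<close>)
  then show ?thesis
    unfolding Kint_def split_beta by (intro continuous_intros) simp
qed

lemma Kint_has_derivative_t:
  assumes "continuous_on {0<..<w} k" "\<mu> \<in> {0<..<w}"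
  shows "((\<lambda>t. Kint k t \<mu>) has_real_derivative k (\<mu> * sech2 t)) (at t)"
proof -
  define g where "g y = k (\<mu> * sech2 y)" for y
  have g: "continuous_on UNIV g"
    unfolding g_def
    by (rule continuous_on_compose2[OF assms(1)])
      (auto intro!: continuous_intros simp del: greaterThanLessThan_iff intro: mult_sech2_mem[OF assms(2)])
  \<comment> \<open>An antiderivative on the whole line: the representation \<open>G t - G 0\<close>
    then holds for both signs of \<open>t\<close>.\<close>
  obtain G where G: "(G has_real_derivative g y) (at y)" for y
    using einterval_antiderivative[of "-\<infinity>" \<infinity> g] g
    by (auto simp: continuous_on_eq_continuous_at has_real_derivative_iff_has_vector_derivative)
  have "Kint k t \<mu> = G t - G 0" for t
  proof -
    have "((\<lambda>r. g (t * r) * t) has_integral G (t * 1) - G (t * 0)) {0..1}"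
      by (rule fundamental_theorem_of_calculus)
        (auto intro!: derivative_eq_intros DERIV_chain2[OF G] 
          simp: has_real_derivative_iff_has_vector_derivative[symmetric])
    from integral_unique[OF this] show ?thesis by (simp add: Kint_def g_def mult.commute)
  qed
  then show ?thesis using G[of t] by (auto intro!: derivative_eq_intros simp: g_def)
qed

text \<open>The factor \<open>sech2\<close> from the chain rule is rewritten as
  \<open>(\<mu> sech2) / \<mu>\<close>, so the derivative is again a \<open>Kint\<close>, now of
  \<open>y k'\<close>. This matters because \<open>y k'\<close>, unlike \<open>k'\<close>, is
  controlled near \<open>0\<close>.\<close>

lemma Kint_has_derivative_mu:
  assumes "continuous_on {0<..<w} k" "\<And>y. y \<in> {0<..<w} \<Longrightarrow> (k has_real_derivative k' y) (at y)"
    "continuous_on {0<..<w} (\<lambda>y. y * k' y)" "\<mu> \<in> {0<..<w}"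
  shows "((\<lambda>\<mu>. Kint k t \<mu>) has_real_derivative Kint (\<lambda>y. y * k' y) t \<mu> / \<mu>) (at \<mu>)"
proof -
  have "((\<lambda>\<mu>. integral (cbox 0 1) (\<lambda>r. k (\<mu> * sech2 (t * r)))) has_real_derivative
      integral (cbox 0 1) (\<lambda>r. (\<mu> * sech2 (t * r)) * k' (\<mu> * sech2 (t * r)) / \<mu>)) (at \<mu> within {0<..<w})"
  proof (rule leibniz_rule_field_derivative)
    fix x r assume x: "x \<in> {0<..<w}"
    show "((\<lambda>\<mu>. k (\<mu> * sech2 (t * r))) has_real_derivative
        x * sech2 (t * r) * k' (x * sech2 (t * r)) / x) (at x within {0<..<w})"
    proof (rule has_field_derivative_at_within[OF DERIV_cong])
      show "((\<lambda>\<mu>. k (\<mu> * sech2 (t * r))) has_real_derivative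
          k' (x * sech2 (t * r)) * sech2 (t * r)) (at x)"
        by (rule DERIV_chain2[where f = k and g = "\<lambda>\<mu>. \<mu> * sech2 (t * r)", OF assms(2)[OF mult_sech2_mem[OF x]]]) (auto intro!: derivative_eq_intros)
    qed (use x in auto)
  next
    fix x assume x: "x \<in> {0<..<w}"
    show "(\<lambda>r. k (x * sech2 (t * r))) integrable_on cbox 0 1"
      by (intro integrable_continuous continuous_on_compose2[OF assms(1)] continuous_intros)
        (use x mult_sech2_mem in auto)
  next
    have "continuous_on ({0<..<w} \<times> cbox 0 1)
        (\<lambda>z. (fst z * sech2 (t * snd z)) * k' (fst z * sech2 (t * snd z)))"
      by (rule continuous_on_compose2[OF assms(3)])
        (auto intro!: continuous_intros simp del: greaterThanLessThan_iff intro: mult_sech2_mem)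
    then have "continuous_on ({0<..<w} \<times> cbox 0 1)
        (\<lambda>z. (fst z * sech2 (t * snd z)) * k' (fst z * sech2 (t * snd z)) / fst z)"
      by (rule continuous_on_divide) (auto intro!: continuous_intros)
    then show "continuous_on ({0<..<w} \<times> cbox 0 1)
        (\<lambda>(x, r). x * sech2 (t * r) * k' (x * sech2 (t * r)) / x)"
      by (simp add: split_beta)
  qed (use assms in auto)
  then have D: "((\<lambda>\<mu>. t * integral (cbox 0 1) (\<lambda>r. k (\<mu> * sech2 (t * r)))) has_real_derivative
      t * integral (cbox 0 1) (\<lambda>r. (\<mu> * sech2 (t * r)) * k' (\<mu> * sech2 (t * r)) / \<mu>)) (at \<mu>)"
    using assms(4) by (auto intro!: derivative_eq_intros simp: at_within_open[of \<mu> "{0<..<w}"])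
  have "integral (cbox 0 1) (\<lambda>r. (\<mu> * sech2 (t * r)) * k' (\<mu> * sech2 (t * r)) / \<mu>)
      = integral {0..1} (\<lambda>r. (\<mu> * sech2 (t * r)) * k' (\<mu> * sech2 (t * r))) / \<mu>"
    unfolding integral_divide[symmetric] by simp
  then show ?thesis
    unfolding Kint_def by (intro DERIV_cong[OF D[unfolded cbox_interval]]) (simp only: cbox_interval times_divide_eq_right)
qed

text \<open>Both the upper limit and the parameter of the integral move with \<open>c\<close>. Total
  differentiability comes from the two partial derivatives, the one in \<open>t\<close> being
  jointly continuous.\<close>

lemma Kint_chain:
  assumes k: "continuous_on {0<..<w} k" "\<And>y. y \<in> {0<..<w} \<Longrightarrow> (k has_real_derivative k' y) (at y)"
    "continuous_on {0<..<w} (\<lambda>y. y * k' y)"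
    and m: "m c \<in> {0<..<w}" "(m has_real_derivative m') (at c)"
    and s: "(s has_real_derivative s') (at c)"
  shows "((\<lambda>c. Kint k (s c) (m c)) has_real_derivative
      k (m c * sech2 (s c)) * s' + Kint (\<lambda>y. y * k' y) (s c) (m c) / m c * m') (at c)"
proof -
  let ?J = "{0<..<w}"
  let ?d = "Kint (\<lambda>y. y * k' y) (s c) (m c) / m c"
  have "((\<lambda>(\<mu>, t). Kint k t \<mu>) has_derivative
      (\<lambda>(a, b). ?d * a + blinfun_mult_right (k (m c * sech2 (s c))) b)) (at (m c, s c) within ?J \<times> UNIV)"
  proof (rule has_derivative_partialsI)
    show "((\<lambda>\<mu>. Kint k (s c) \<mu>) has_derivative (\<lambda>a. ?d * a)) (at (m c) within ?J)"
      using Kint_has_derivative_mu[OF k m(1)] has_field_derivative_at_within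
      unfolding has_field_derivative_def by blast
    show "((\<lambda>t. Kint k t \<mu>) has_derivative blinfun_mult_right (k (\<mu> * sech2 t))) (at t within UNIV)"
      if "\<mu> \<in> ?J" for \<mu> t
      using Kint_has_derivative_t[OF k(1) that, of t] by (simp add: has_field_derivative_def)
    have "continuous_on (?J \<times> UNIV) (\<lambda>z. blinfun_mult_right (k (fst z * sech2 (snd z))))"
      by (intro bounded_linear.continuous_on[OF bounded_linear_blinfun_mult_right]
          continuous_on_compose2[OF k(1)] continuous_intros)
        (use mult_sech2_mem in auto)
    then show "continuous (at (m c, s c) within ?J \<times> UNIV) (\<lambda>(\<mu>, t). blinfun_mult_right (k (\<mu> * sech2 t)))"
      using m(1) by (auto simp: continuous_on_eq_continuous_within case_prod_unfold)
  qed auto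
  then have D: "((\<lambda>(\<mu>, t). Kint k t \<mu>) has_derivative
      (\<lambda>(a, b). ?d * a + k (m c * sech2 (s c)) * b)) (at (m c, s c))"
    using m(1) by (subst (asm) at_within_open) (auto intro: open_Times)
  have "((\<lambda>c. (m c, s c)) has_derivative (\<lambda>h. (m' * h, s' * h))) (at c)"
    using m(2) s unfolding has_field_derivative_def by (rule has_derivative_Pair)
  from has_derivative_compose[OF this D]
  show ?thesis
    unfolding has_field_derivative_def prod.case
    by (rule has_derivative_eq_rhs) (auto simp: fun_eq_iff algebra_simps)
qed

lemma Kint_average_bounds:
  assumes "continuous_on {0<..<w} k" "\<mu> \<in> {0<..<w}" "\<And>y. y \<in> {0<..<w} \<Longrightarrow> a \<le> k y \<and> k y \<le> b"
  obtains \<kappa> where "Kint k t \<mu> = t * \<kappa>" "a \<le> \<kappa>" "\<kappa> \<le> b"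
proof
  have int: "(\<lambda>r. k (\<mu> * sech2 (t * r))) integrable_on {0..1}"
    by (intro integrable_continuous_real continuous_on_compose2[OF assms(1)] continuous_intros)
      (use assms(2) mult_sech2_mem in auto)
  show "a \<le> integral {0..1} (\<lambda>r. k (\<mu> * sech2 (t * r)))"
    using integral_le[of "\<lambda>_. a" "{0..1}", OF integrable_const_ivl int] assms(3) mult_sech2_mem[OF assms(2)] by simp
  show "integral {0..1} (\<lambda>r. k (\<mu> * sech2 (t * r))) \<le> b"
    using integral_le[of _ "{0..1}" "\<lambda>_. b", OF int integrable_const_ivl] assms(3) mult_sech2_mem[OF assms(2)] by simp
qed (simp add: Kint_def)

lemma Kint_minus: "Kint k (- t) \<mu> = - Kint k t \<mu>"
  by (simp add: Kint_def)

text \<open>The two-sided bound on \<open>q\<close> makes \<open>t \<mapsto> Kint q t \<mu>\<close>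
  a bi-Lipschitz bijection of the line, uniformly in \<open>\<mu>\<close>; the phase is its
  inverse.\<close>

locale phase =
  fixes w :: real and q q' :: "real \<Rightarrow> real"
  assumes w_pos: "0 < w"
    and q_deriv: "y \<in> {0<..<w} \<Longrightarrow> (q has_real_derivative q' y) (at y)"
    and \<theta>q_cont: "continuous_on {0<..<w} (\<lambda>y. y * q' y)"
    and q_bounds: "y \<in> {0<..<w} \<Longrightarrow> 1/2 \<le> q y \<and> q y \<le> 2"
begin

lemma q_cont: "continuous_on {0<..<w} q"
  using q_deriv DERIV_isCont by (blast intro: continuous_at_imp_continuous_on)

text \<open>Mean value theorem with slope at least \<open>1/2\<close>. The exact form with the
  intermediate point \<open>z\<close> is kept because it yields the derivative of the
  inverse.\<close>

lemma Kint_expanding: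
  assumes "\<mu> \<in> {0<..<w}"
  shows "\<bar>t - s\<bar> / 2 \<le> \<bar>Kint q t \<mu> - Kint q s \<mu>\<bar>"
    and "t \<noteq> s \<Longrightarrow> \<exists>z. \<bar>z - s\<bar> \<le> \<bar>t - s\<bar> \<and> Kint q t \<mu> - Kint q s \<mu> = q (\<mu> * sech2 z) * (t - s)"
proof -
  have *: "\<exists>z. \<bar>z - s\<bar> \<le> \<bar>t - s\<bar> \<and> Kint q t \<mu> - Kint q s \<mu> = q (\<mu> * sech2 z) * (t - s)" if "t \<noteq> s"
  proof (cases "s < t")
    case True
    obtain z where "z > s" "z < t" "Kint q t \<mu> - Kint q s \<mu> = (t - s) * q (\<mu> * sech2 z)"
      using MVT2[OF True, of "\<lambda>t. Kint q t \<mu>" "\<lambda>t. q (\<mu> * sech2 t)"] Kint_has_derivative_t[OF q_cont assms] by blast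
    then show ?thesis by (intro exI[of _ z]) auto
  next
    case False
    then have "t < s" using that by simp
    then obtain z where "z > t" "z < s" "Kint q s \<mu> - Kint q t \<mu> = (s - t) * q (\<mu> * sech2 z)"
      using MVT2[of t s "\<lambda>t. Kint q t \<mu>" "\<lambda>t. q (\<mu> * sech2 t)"] Kint_has_derivative_t[OF q_cont assms] by blast
    then show ?thesis by (intro exI[of _ z]) (auto simp: algebra_simps)
  qed
  then show "t \<noteq> s \<Longrightarrow> \<exists>z. \<bar>z - s\<bar> \<le> \<bar>t - s\<bar> \<and> Kint q t \<mu> - Kint q s \<mu> = q (\<mu> * sech2 z) * (t - s)" .
  show "\<bar>t - s\<bar> / 2 \<le> \<bar>Kint q t \<mu> - Kint q s \<mu>\<bar>"
  proof (cases "t = s")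
    case False
    then obtain z where z: "Kint q t \<mu> - Kint q s \<mu> = q (\<mu> * sech2 z) * (t - s)" using * by blast
    have "1/2 \<le> q (\<mu> * sech2 z)" using q_bounds[OF mult_sech2_mem[OF assms]] by blast
    then show ?thesis unfolding z abs_mult
      using mult_right_mono[of "1/2" "\<bar>q (\<mu> * sech2 z)\<bar>" "\<bar>t - s\<bar>"] by simp
  qed simp
qed

lemma Kint_ex1:
  assumes "\<mu> \<in> {0<..<w}"
  shows "\<exists>!t. Kint q t \<mu> = y"
proof
  \<comment> \<open>Since the average of \<open>q\<close> is at least \<open>1/2\<close>, the points
    \<open>- 2 |y|\<close> and \<open>2 |y|\<close> bracket the value \<open>y\<close>.\<close>
  have "Kint q (- 2 * \<bar>y\<bar>) \<mu> \<le> y" "y \<le> Kint q (2 * \<bar>y\<bar>) \<mu>"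
  proof -
    obtain \<kappa> where k: "Kint q (2 * \<bar>y\<bar>) \<mu> = 2 * \<bar>y\<bar> * \<kappa>" "1/2 \<le> \<kappa>"
      using Kint_average_bounds[OF q_cont assms q_bounds] by metis
    then have "\<bar>y\<bar> \<le> Kint q (2 * \<bar>y\<bar>) \<mu>"
      using mult_left_mono[OF k(2), of "2 * \<bar>y\<bar>"] by simp
    then show "Kint q (- 2 * \<bar>y\<bar>) \<mu> \<le> y" "y \<le> Kint q (2 * \<bar>y\<bar>) \<mu>"
      using Kint_minus[of q "2 * \<bar>y\<bar>" \<mu>] by auto
  qed
  then have "\<exists>t\<ge>- 2 * \<bar>y\<bar>. t \<le> 2 * \<bar>y\<bar> \<and> Kint q t \<mu> = y"
    using Kint_has_derivative_t[OF q_cont assms]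
    by (intro IVT') (auto intro!: continuous_at_imp_continuous_on DERIV_isCont)
  then show "Kint q (SOME t. Kint q t \<mu> = y) \<mu> = y" by (metis (mono_tags, lifting) someI)
next
  fix t assume "Kint q t \<mu> = y"
  then have "Kint q (SOME t. Kint q t \<mu> = y) \<mu> = y" by (metis (mono_tags, lifting) someI)
  with \<open>Kint q t \<mu> = y\<close> show "t = (SOME t. Kint q t \<mu> = y)"
    using Kint_expanding(1)[OF assms, of t "SOME t. Kint q t \<mu> = y"] by simp
qed

definition phi :: "real \<Rightarrow> real \<Rightarrow> real" where
  "phi \<mu> y = (THE t. Kint q t \<mu> = y)"

lemma Kint_phi: "\<mu> \<in> {0<..<w} \<Longrightarrow> Kint q (phi \<mu> y) \<mu> = y"
  unfolding phi_def by (rule theI'[OF Kint_ex1])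

lemma phi_eqI: "\<mu> \<in> {0<..<w} \<Longrightarrow> Kint q t \<mu> = y \<Longrightarrow> phi \<mu> y = t"
  unfolding phi_def using Kint_ex1 by blast

lemma phi_minus: "\<mu> \<in> {0<..<w} \<Longrightarrow> phi \<mu> (- y) = - phi \<mu> y"
  by (rule phi_eqI) (auto simp: Kint_minus Kint_phi)

lemma phi_bounds:
  assumes "\<mu> \<in> {0<..<w}"
  shows "\<bar>phi \<mu> y\<bar> \<le> 2 * \<bar>y\<bar>" "\<bar>y\<bar> \<le> 2 * \<bar>phi \<mu> y\<bar>"
proof -
  obtain \<kappa> where k: "Kint q (phi \<mu> y) \<mu> = phi \<mu> y * \<kappa>" "1/2 \<le> \<kappa>" "\<kappa> \<le> 2"
    using Kint_average_bounds[OF q_cont assms q_bounds] by metis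
  have "\<bar>y\<bar> = \<bar>phi \<mu> y * \<kappa>\<bar>" using Kint_phi[OF assms, of y] k(1) by simp
  also have "\<dots> = \<bar>phi \<mu> y\<bar> * \<kappa>" using k(2) by (simp add: abs_mult)
  finally have "\<bar>y\<bar> = \<bar>phi \<mu> y\<bar> * \<kappa>" .
  then show "\<bar>phi \<mu> y\<bar> \<le> 2 * \<bar>y\<bar>" "\<bar>y\<bar> \<le> 2 * \<bar>phi \<mu> y\<bar>"
    using mult_left_mono[OF k(2), of "\<bar>phi \<mu> y\<bar>"] mult_left_mono[OF k(3), of "\<bar>phi \<mu> y\<bar>"] by auto
qed

text \<open>The implicit function theorem, obtained from mean values: the increment of the phase
  equals \<open>num\<close> divided by \<open>q\<close> at an intermediate point, and this point
  tends to \<open>s\<close>.\<close>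

lemma phi_has_derivative:
  assumes m: "m c \<in> {0<..<w}" "(m has_real_derivative m') (at c)"
    and y: "(y has_real_derivative y') (at c)"
  defines "s \<equiv> phi (m c) (y c)"
  shows "((\<lambda>c. phi (m c) (y c)) has_real_derivative
      (y' - Kint (\<lambda>z. z * q' z) s (m c) / m c * m') / q (m c * sech2 s)) (at c)"
proof -
  let ?J = "{0<..<w}"
  \<comment> \<open>With the phase frozen at \<open>s\<close>, this is the defect of the defining
    equation at the parameter \<open>c'\<close>. It is differentiable in \<open>c'\<close> although
    the phase is not yet known to be.\<close>
  define num where "num c' = y c' - Kint q s (m c')" for c'
  have num: "(num has_real_derivative (y' - Kint (\<lambda>z. z * q' z) s (m c) / m c * m')) (at c)"
    unfolding num_def
    by (intro derivative_intros y DERIV_chain2[OF Kint_has_derivative_mu[OF q_cont q_deriv \<theta>q_cont m(1)] m(2)])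
  have num0: "num c = 0" using Kint_phi[OF m(1)] by (simp add: num_def s_def)
  have evJ: "\<forall>\<^sub>F c' in at c. m c' \<in> ?J"
    using DERIV_isCont[OF m(2)] m(1) unfolding isCont_def
    by (intro topological_tendstoD) auto
  have *: "\<forall>c'. \<exists>z. m c' \<in> ?J \<longrightarrow> \<bar>z - s\<bar> \<le> 2 * \<bar>num c'\<bar> \<and>
        phi (m c') (y c') - s = num c' / q (m c' * sech2 z)"
  proof
    fix c'
    show "\<exists>z. m c' \<in> ?J \<longrightarrow> \<bar>z - s\<bar> \<le> 2 * \<bar>num c'\<bar> \<and>
        phi (m c') (y c') - s = num c' / q (m c' * sech2 z)"
    proof (cases "m c' \<in> ?J")
      case True
      let ?t = "phi (m c') (y c')"
      have n: "num c' = Kint q ?t (m c') - Kint q s (m c')"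
        using Kint_phi[OF True] by (simp add: num_def)
      have b: "\<bar>?t - s\<bar> \<le> 2 * \<bar>num c'\<bar>"
        using Kint_expanding(1)[OF True, of ?t s] n by simp
      show ?thesis
      proof (cases "?t = s")
        case False
        then obtain z where z: "\<bar>z - s\<bar> \<le> \<bar>?t - s\<bar>" "num c' = q (m c' * sech2 z) * (?t - s)"
          using Kint_expanding(2)[OF True False] n by auto
        have "1/2 \<le> q (m c' * sech2 z)" using q_bounds[OF mult_sech2_mem[OF True]] by blast
        then show ?thesis using z b by (intro exI[of _ z]) auto
      qed (use n in \<open>auto intro!: exI[of _ s]\<close>)
    qed auto
  qed
  obtain z where z: "\<And>c'. m c' \<in> ?J \<Longrightarrow> \<bar>z c' - s\<bar> \<le> 2 * \<bar>num c'\<bar>"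
    "\<And>c'. m c' \<in> ?J \<Longrightarrow> phi (m c') (y c') - s = num c' / q (m c' * sech2 (z c'))"
    using choice[OF *] by blast
  have numlim: "(num \<longlongrightarrow> 0) (at c)" using DERIV_isCont[OF num] num0 by (simp add: isCont_def)
  have "(z \<longlongrightarrow> s) (at c)"
  proof (rule LIM_zero_cancel[OF Lim_null_comparison])
    show "\<forall>\<^sub>F c' in at c. norm (z c' - s) \<le> 2 * \<bar>num c'\<bar>"
      using evJ by eventually_elim (use z(1) in auto)
  next
    show "((\<lambda>c'. 2 * \<bar>num c'\<bar>) \<longlongrightarrow> 0) (at c)" using numlim by (auto intro!: tendsto_eq_intros)
  qed
  then have "((\<lambda>c'. m c' * sech2 (z c')) \<longlongrightarrow> m c * sech2 s) (at c)"
    using DERIV_isCont[OF m(2)] unfolding isCont_def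
    by (intro tendsto_intros) (auto simp: cosh_real_nonzero)
  then have Q: "((\<lambda>c'. q (m c' * sech2 (z c'))) \<longlongrightarrow> q (m c * sech2 s)) (at c)"
    using isCont_tendsto_compose[OF DERIV_isCont[OF q_deriv[OF mult_sech2_mem[OF m(1)]]]] by blast
  have "1/2 \<le> q (m c * sech2 s)" using q_bounds[OF mult_sech2_mem[OF m(1)]] by blast
  then have "((\<lambda>c'. (num c' - num c) / (c' - c) / q (m c' * sech2 (z c'))) \<longlongrightarrow>
      (y' - Kint (\<lambda>z. z * q' z) s (m c) / m c * m') / q (m c * sech2 s)) (at c)"
    using num unfolding has_field_derivative_iff by (intro tendsto_divide Q) auto
  moreover have "\<forall>\<^sub>F c' in at c. (num c' - num c) / (c' - c) / q (m c' * sech2 (z c'))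
      = (phi (m c') (y c') - phi (m c) (y c)) / (c' - c)"
    using evJ by eventually_elim (use z(2) num0 in \<open>auto simp: s_def\<close>)
  ultimately show ?thesis
    unfolding has_field_derivative_iff by (rule Lim_transform_eventually)
qed

end

section \<open>The profile\<close>

lemma greaterThanLessThan_subset_pos: "{0<..<a::real} \<subseteq> {0<..}"
  by auto

text \<open>The nonlinearity enters only through \<open>N\<close>, its first two derivatives, the
  inverse \<open>h\<close> and the logarithmic derivative \<open>q\<close> of \<open>h\<close>. In
  names, \<open>\<theta>\<close> stands for \<open>y d/dy\<close>. Two derivatives in
  \<open>c\<close> are wanted, hence the order two of the classes, lowered to one for
  \<open>y q'\<close>.\<close>

locale profile = phase w q q' for w :: real and q q' :: "real \<Rightarrow> real" +
  fixes h N N1 N2 :: "real \<Rightarrow> real" and \<delta> C cs c0 :: real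
  assumes \<delta>: "0 < \<delta>" "\<delta> < 1" and C: "0 \<le> C"
    and \<theta>q_rclass: "rclass {0<..<w} 1 (\<lambda>_. 1) (\<lambda>y. y * q' y)"
    and h_mem: "y \<in> {0<..<w} \<Longrightarrow> h y \<in> {0<..<\<delta>}"
    and h_deriv: "y \<in> {0<..<w} \<Longrightarrow> (h has_real_derivative h y * q y / y) (at y)"
    and h_le: "y \<in> {0<..<w} \<Longrightarrow> h y \<le> C * y"
    and h_rclass: "rclass {0<..<w} 2 h h"
    and N_h: "y \<in> {0<..<w} \<Longrightarrow> N (h y) = y * (h y)^2"
    and N1_h: "y \<in> {0<..<w} \<Longrightarrow> N1 (h y) = y * h y * (2 + 1 / q y)"
    and N1_deriv: "e \<in> {0<..<\<delta>} \<Longrightarrow> (N1 has_real_derivative N2 e) (at e)"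
    and N1_rclass: "rclass {0<..<\<delta>} 2 (\<lambda>e. e) N1"
    and N2_rclass: "rclass {0<..<\<delta>} 2 (\<lambda>_. 1) N2"
    and c0: "0 < c0" "c0 < cs" "cs^2 - c0^2 \<le> w"
begin

definition I :: "real set" where "I = {c0<..<cs}"
definition m :: "real \<Rightarrow> real" where "m c = cs^2 - c^2"
text \<open>The distance to the crest in units of the width \<open>1 / \<surd>m\<close> of the wave.
  The derivation \<open>m d/dc\<close> turns \<open>\<surd>m x\<close> into
  \<open>- c \<surd>m x\<close>, whence the powers of this quantity.\<close>

definition L :: "real \<Rightarrow> real \<Rightarrow> real" where "L c x = 1 + sqrt (m c) * \<bar>x\<bar>"
definition s :: "real \<Rightarrow> real \<Rightarrow> real" where "s c x = phi (m c) (sqrt (m c) * x / 2)"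
definition W :: "real \<Rightarrow> real \<Rightarrow> real" where "W c x = m c * sech2 (s c x)"
definition eta :: "real \<Rightarrow> real \<Rightarrow> real" where "eta c x = h (W c x)"

lemma m_mem:
  assumes "c \<in> I"
  shows "m c \<in> {0<..<w}"
proof -
  have "c0^2 < c^2" "c^2 < cs^2" using assms c0 by (auto simp: I_def intro!: power_strict_mono)
  then show ?thesis using c0 by (auto simp: m_def)
qed

lemma m_pos: "c \<in> I \<Longrightarrow> 0 < m c"
  using m_mem by auto

lemma c_pos: "c \<in> I \<Longrightarrow> 0 < c" and c_less: "c \<in> I \<Longrightarrow> c < cs"
  using c0 by (auto simp: I_def)

sublocale weights I m L
proof
  show "1 \<le> L c x" if "c \<in> I" for c x using m_pos[OF that] by (auto simp: L_def)
qed (simp add: I_def)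

lemma m_DERIV: "(m has_real_derivative - (2 * c)) (at c)"
  unfolding m_def by (auto intro!: derivative_eq_intros)

lemma sqrt_m_DERIV: "c \<in> I \<Longrightarrow> ((\<lambda>c. sqrt (m c)) has_real_derivative - c / sqrt (m c)) (at c)"
proof -
  assume c: "c \<in> I"
  have "((\<lambda>c. sqrt (m c)) has_real_derivative inverse (sqrt (m c)) / 2 * - (2 * c)) (at c)"
    by (rule DERIV_chain2[OF DERIV_real_sqrt[OF m_pos[OF c]] m_DERIV])
  then show ?thesis by (rule DERIV_cong) (simp add: inverse_eq_divide)
qed

lemma m_times_div_sqrt: "c \<in> I \<Longrightarrow> m c * (a / sqrt (m c)) = a * sqrt (m c)"
  using real_div_sqrt[of "m c"] m_pos[of c] by (metis less_imp_le mult.commute times_divide_eq_left times_divide_eq_right)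

lemma m_cont: "continuous_on I m"
  unfolding m_def by (intro continuous_intros)

lemma W_mem: "c \<in> I \<Longrightarrow> W c x \<in> {0<..<w}"
  unfolding W_def by (rule mult_sech2_mem[OF m_mem])

text \<open>Joint induction: the derivation sends \<open>m\<close> to \<open>- 2 c m\<close> and
  \<open>c\<close> to \<open>m\<close>, so neither class can be raised in order without the
  other.\<close>

lemma cls_m_c: "cls n (\<lambda>c x. m c) (\<lambda>c x. m c) \<and> cls n (\<lambda>_ _. 1) (\<lambda>c x. c)"
proof (induction n)
  have b: "wbound I L (\<lambda>c x. m c) (\<lambda>c x. m c)"
    by (rule wboundI0[of 1]) (use m_pos m_cont in \<open>auto simp: less_imp_le abs_of_pos\<close>)
  have b': "wbound I L (\<lambda>_ _. 1) (\<lambda>c x. c)"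
    by (rule wboundI0[of cs]) (use c_pos c_less c0 in \<open>auto intro!: continuous_intros simp: abs_of_pos less_imp_le\<close>)
  {
    case 0
    show ?case using b b' by simp
  next
    case (Suc n)
    have "cls n (\<lambda>c x. m c) (\<lambda>c x. (- 2 * c) * m c)"
      using Suc by (intro cls_mult1 cls_cmult) auto
    then have "cls n (\<lambda>c x. m c) (\<lambda>c x. m c * (- (2 * c)))"
      by (rule cls_cong) simp
    moreover have "cls n (\<lambda>_ _. 1) (\<lambda>c x. m c * 1)"
      using cls_le[of n "\<lambda>c x. m c" "\<lambda>c x. m c" w "\<lambda>_ _. 1"] Suc m_mem w_pos by (force simp: less_imp_le)
    ultimately show ?case
      by (intro conjI clsSI[OF b, where u' = "\<lambda>c x. - (2 * c)"] clsSI[OF b', where u' = "\<lambda>c x. 1"])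
        (auto intro!: m_DERIV derivative_eq_intros)
  }
qed

lemmas cls_m = conjunct1[OF cls_m_c] and cls_c = conjunct2[OF cls_m_c]

lemma cls_m1: "cls n (\<lambda>_ _. 1) (\<lambda>c x. m c)"
  by (rule cls_le[OF cls_m, of w]) (use m_mem w_pos in \<open>auto simp: less_imp_le\<close>)

lemma cls_sqrt_m: "cls n (\<lambda>_ _. 1) (\<lambda>c x. sqrt (m c))"
proof (induction n)
  have b: "wbound I L (\<lambda>_ _. 1) (\<lambda>c x. sqrt (m c))"
    by (rule wboundI0[of "sqrt w"])
      (use m_mem w_pos m_cont in \<open>auto simp: less_imp_le real_sqrt_le_iff intro!: continuous_intros\<close>)
  {
    case 0
    show ?case using b by simp
  next
    case (Suc n)
    have "cls n (\<lambda>_ _. 1) (\<lambda>c x. (- 1 * c) * sqrt (m c))"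
      by (intro cls_mult1 cls_cmult cls_c Suc)
    then have "cls n (\<lambda>_ _. 1) (\<lambda>c x. m c * (- c / sqrt (m c)))"
      by (rule cls_cong) (simp only: m_times_div_sqrt mult_minus1)
    then show ?case
      by (intro clsSI[OF b, where u' = "\<lambda>c x. - c / sqrt (m c)"] sqrt_m_DERIV) auto
  }
qed

lemma cls_sqrt_m_x: "cls n (\<lambda>_ _. 1) (\<lambda>c x. sqrt (m c) * x)"
proof (induction n)
  have b: "wbound I L (\<lambda>_ _. 1) (\<lambda>c x. sqrt (m c) * x)"
  proof (rule wboundI[of 1 _ 1])
    show "\<bar>sqrt (m c) * x\<bar> \<le> 1 * L c x ^ 1 * 1" if "c \<in> I" for c x
      using m_pos[OF that] by (auto simp: L_def abs_mult)
  qed (use m_cont in \<open>auto intro!: continuous_intros\<close>)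
  {
    case 0
    show ?case using b by simp
  next
    case (Suc n)
    have "cls n (\<lambda>_ _. 1) (\<lambda>c x. (- 1 * c) * (sqrt (m c) * x))"
      by (intro cls_mult1 cls_cmult cls_c Suc)
    then have "cls n (\<lambda>_ _. 1) (\<lambda>c x. m c * (- c / sqrt (m c) * x))"
      by (rule cls_cong) (simp only: mult.assoc[symmetric] m_times_div_sqrt mult_minus1 mult_1_right)
    then show ?case
      by (intro clsSI[OF b, where u' = "\<lambda>c x. - c / sqrt (m c) * x"])
        (intro DERIV_cmult_right sqrt_m_DERIV)+
  }
qed

lemma s_DERIV_x:
  assumes "c \<in> I"
  shows "(s c has_real_derivative sqrt (m c) / 2 / q (W c x)) (at x)"
proof -
  have "((\<lambda>x. phi (m c) (sqrt (m c) * x / 2)) has_real_derivative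
      (sqrt (m c) / 2 - Kint (\<lambda>z. z * q' z) (phi (m c) (sqrt (m c) * x / 2)) (m c) / m c * 0) /
        q (m c * sech2 (phi (m c) (sqrt (m c) * x / 2)))) (at x)"
    by (rule phi_has_derivative[where m = "\<lambda>_. m c" and y = "\<lambda>x. sqrt (m c) * x / 2"])
      (use m_mem[OF assms] in \<open>auto intro!: derivative_eq_intros\<close>)
  then show ?thesis by (simp add: s_def[abs_def] W_def)
qed

definition s' :: "real \<Rightarrow> real \<Rightarrow> real" where
  "s' c x = (- c / sqrt (m c) * x / 2 + 2 * c * Kint (\<lambda>z. z * q' z) (s c x) (m c) / m c) / q (W c x)"

lemma s_DERIV_c:
  assumes "c \<in> I"
  shows "((\<lambda>c. s c x) has_real_derivative s' c x) (at c)"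
proof -
  have "((\<lambda>c. phi (m c) (sqrt (m c) * x / 2)) has_real_derivative
      (- c / sqrt (m c) * x / 2 - Kint (\<lambda>z. z * q' z) (phi (m c) (sqrt (m c) * x / 2)) (m c) / m c * (- (2 * c))) /
        q (m c * sech2 (phi (m c) (sqrt (m c) * x / 2)))) (at c)"
    by (rule phi_has_derivative[where y = "\<lambda>c. sqrt (m c) * x / 2"])
      (intro m_mem[OF assms] m_DERIV DERIV_cdivide DERIV_cmult_right sqrt_m_DERIV assms)+
  then show ?thesis by (simp add: s_def s'_def W_def algebra_simps)
qed

lemma s_bounds:
  assumes "c \<in> I"
  shows "\<bar>s c x\<bar> \<le> sqrt (m c) * \<bar>x\<bar>" "sqrt (m c) * \<bar>x\<bar> \<le> 4 * \<bar>s c x\<bar>"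
  using phi_bounds[OF m_mem[OF assms], of "sqrt (m c) * x / 2"] m_pos[OF assms]
  by (auto simp: s_def abs_mult)

lemma s_continuous:
  shows "continuous_on I (\<lambda>c. s c x)" "c \<in> I \<Longrightarrow> continuous_on UNIV (s c)"
  using s_DERIV_c s_DERIV_x DERIV_isCont by (blast intro: continuous_at_imp_continuous_on)+

lemma wbound_s: "wbound I L (\<lambda>_ _. 1) s"
proof (rule wboundI[of 1 _ 1])
  show "\<bar>s c x\<bar> \<le> 1 * L c x ^ 1 * 1" if "c \<in> I" for c x
    using s_bounds(1)[OF that, of x] by (simp add: L_def)
qed (use s_continuous in auto)

lemma cls_W: "cls n (\<lambda>_ _. 1) s \<Longrightarrow> cls n W W"
  using cls_mult[OF cls_m cls_sech2] unfolding W_def[abs_def] .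

text \<open>The derivation produces \<open>k(W) (m s')\<close> minus \<open>2 c\<close> times the
  same integral with \<open>y k'\<close> in place of \<open>k\<close>. The form persists, so the
  induction runs over all \<open>k\<close>; the linear growth in \<open>s\<close> is absorbed by one
  factor \<open>L\<close>.\<close>

lemma cls_Kint:
  assumes "cls n (\<lambda>_ _. 1) s" "rclass {0<..<w} n (\<lambda>_. 1) k"
  shows "cls n (\<lambda>_ _. 1) (\<lambda>c x. Kint k (s c x) (m c))"
  using assms
proof (induction n arbitrary: k)
  have b: "wbound I L (\<lambda>_ _. 1) (\<lambda>c x. Kint k (s c x) (m c))" if k0: "rclass {0<..<w} 0 (\<lambda>_. 1) k" for k
  proof -
    obtain K where K: "0 \<le> K" "\<And>y. y \<in> {0<..<w} \<Longrightarrow> \<bar>k y\<bar> \<le> K" and k: "continuous_on {0<..<w} k"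
      using k0 by (auto simp: wbound_def)
    show ?thesis
    proof (rule wboundI[of K _ 1])
      fix c x assume c: "c \<in> I"
      have "- K \<le> k y \<and> k y \<le> K" if "y \<in> {0<..<w}" for y using K(2)[OF that] by auto
      from Kint_average_bounds[OF k m_mem[OF c] this]
      obtain \<kappa> where "Kint k (s c x) (m c) = s c x * \<kappa>" "- K \<le> \<kappa>" "\<kappa> \<le> K" by metis
      then have "\<bar>Kint k (s c x) (m c)\<bar> \<le> L c x * K"
        using s_bounds(1)[OF c, of x] K(1) L_ge_1[OF c, of x]
        by (auto simp: abs_mult L_def intro!: mult_mono)
      then show "\<bar>Kint k (s c x) (m c)\<bar> \<le> K * L c x ^ 1 * 1" by (simp add: mult.commute)
    next
      show "continuous_on I (\<lambda>c. Kint k (s c x) (m c))" for x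
        using continuous_on_compose2[OF Kint_continuous[OF k] continuous_on_Pair[OF s_continuous(1) m_cont]] m_mem
        by (simp add: image_subset_iff)
      show "continuous_on UNIV (\<lambda>x. Kint k (s c x) (m c))" if "c \<in> I" for c
        using continuous_on_compose2[OF Kint_continuous[OF k]
            continuous_on_Pair[OF s_continuous(2)[OF that] continuous_on_const[of _ "m c"]]] m_mem[OF that]
        by (simp add: image_subset_iff)
    qed (use K in auto)
  qed
  {
    case 0
    then show ?case using b by simp
  next
    case (Suc n)
    from Suc.prems(2) obtain k' where k': "\<And>y. y \<in> {0<..<w} \<Longrightarrow> (k has_real_derivative k' y) (at y)"
      "rclass {0<..<w} n (\<lambda>_. 1) (\<lambda>y. y * k' y)" by (rule rclass_SucE) auto
    from Suc.prems(1) obtain u where u: "\<And>c x. c \<in> I \<Longrightarrow> ((\<lambda>c. s c x) has_real_derivative u c x) (at c)"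
      "cls n (\<lambda>_ _. 1) (\<lambda>c x. m c * u c x)" by (rule clsSE) blast
    have sn: "cls n (\<lambda>_ _. 1) s" using Suc.prems wclass_Suc_D by blast
    have kn: "rclass {0<..<w} n (\<lambda>_. 1) k" using Suc.prems wclass_Suc_D by blast
    have kc: "continuous_on {0<..<w} k" "continuous_on {0<..<w} (\<lambda>y. y * k' y)"
      using wclass_wbound[OF kn] wclass_wbound[OF k'(2)] by (auto simp: wbound_def)
    have kW: "cls n (\<lambda>_ _. 1) (\<lambda>c x. k (W c x))"
      by (rule cls_compose[OF open_greaterThanLessThan greaterThanLessThan_subset_pos cls_W[OF sn] W_mem kn])
    have "cls n (\<lambda>_ _. 1) (\<lambda>c x. k (W c x) * (m c * u c x) + ((- 2) * c) * Kint (\<lambda>y. y * k' y) (s c x) (m c))"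
      by (intro cls_add cls_mult1 cls_cmult kW u(2) cls_c Suc.IH sn k'(2))
    then have "cls n (\<lambda>_ _. 1) (\<lambda>c x. m c * (k (m c * sech2 (s c x)) * u c x +
        Kint (\<lambda>y. y * k' y) (s c x) (m c) / m c * (- (2 * c))))"
    proof (rule cls_cong)
      fix c x assume "c \<in> I"
      then have "m c \<noteq> 0" using m_pos[of c] by simp
      then show "k (W c x) * (m c * u c x) + ((- 2) * c) * Kint (\<lambda>y. y * k' y) (s c x) (m c) =
          m c * (k (m c * sech2 (s c x)) * u c x + Kint (\<lambda>y. y * k' y) (s c x) (m c) / m c * (- (2 * c)))"
        by (simp add: W_def field_simps)
    qed
    moreover have "wbound I L (\<lambda>_ _. 1) (\<lambda>c x. Kint k (s c x) (m c))"
      by (rule b) (use wclass_wbound[OF kn] in simp)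
    ultimately show ?case
      by (rule clsSI[rotated 2]) (intro Kint_chain[OF kc(1) k'(1) kc(2) m_mem m_DERIV u(1)])
  }
qed

lemma q_rclass: "rclass {0<..<w} 2 (\<lambda>_. 1) q"
proof -
  interpret R: weights "{0<..<w}" "\<lambda>w. w" "\<lambda>_ _. 1" by unfold_locales auto
  have "wbound {0<..<w} (\<lambda>_ _. 1) (\<lambda>_ _. 1) (\<lambda>y _. q y)"
  proof (rule R.wboundI0[of 2])
    show "\<bar>q y\<bar> \<le> 2 * 1" if "y \<in> {0<..<w}" for y using q_bounds[OF that] by auto
  qed (use q_cont in auto)
  then have "rclass {0<..<w} (Suc 1) (\<lambda>_. 1) q"
    by (rule R.clsSI) (use q_deriv \<theta>q_rclass in auto)
  then show ?thesis by (simp add: numeral_2_eq_2)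
qed

lemma cls_inverse_q:
  assumes "cls n (\<lambda>_ _. 1) s" "n \<le> 2"
  shows "cls n (\<lambda>_ _. 1) (\<lambda>c x. 1 / q (W c x))"
proof (rule cls_inverse[where A = "\<lambda>_ _. 1" and K = 1])
  have q0: "1/2 \<le> q (W c x)" if "c \<in> I" for c x using q_bounds[OF W_mem[OF that]] by blast
  show qW: "cls n (\<lambda>_ _. 1) (\<lambda>c x. q (W c x))"
    by (rule cls_compose[OF open_greaterThanLessThan greaterThanLessThan_subset_pos cls_W[OF assms(1)] W_mem wclass_antimono[OF q_rclass assms(2)]])
  show qn: "q (W c x) \<noteq> 0" if "c \<in> I" for c x using q0[OF that, of x] by auto
  show "wbound I L (\<lambda>_ _. 1) (\<lambda>c x. 1 / q (W c x))"
  proof (rule wboundI0[of 2])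
    show "\<bar>1 / q (W c x)\<bar> \<le> 2 * 1" if "c \<in> I" for c x
      using q0[OF that, of x] by (auto simp: divide_simps abs_if)
    show "continuous_on I (\<lambda>c. 1 / q (W c x))" for x
      using wbound_continuous(1)[OF wclass_wbound[OF qW]] qn by (intro continuous_intros) auto
    show "continuous_on UNIV (\<lambda>x. 1 / q (W c x))" if "c \<in> I" for c
      using wbound_continuous(2)[OF wclass_wbound[OF qW] that] qn[OF that] by (intro continuous_intros) auto
  qed auto
qed auto

text \<open>Bootstrap: \<open>m s'\<close> is expressed through \<open>s\<close> without its
  derivatives, so each order of \<open>s\<close> yields the next one. It stops at order two because
  \<open>y q'\<close> has order one.\<close>

lemma cls_s_step:
  assumes "cls n (\<lambda>_ _. 1) s" "n \<le> 1"
  shows "cls (Suc n) (\<lambda>_ _. 1) s"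
proof (rule clsSI[OF wbound_s s_DERIV_c])
  have "cls n (\<lambda>_ _. 1) (\<lambda>c x. (((- (1/2)) * c) * (sqrt (m c) * x) +
      (2 * c) * Kint (\<lambda>z. z * q' z) (s c x) (m c)) * (1 / q (W c x)))"
    by (intro cls_mult1 cls_add cls_cmult cls_c cls_sqrt_m_x cls_Kint cls_inverse_q assms
        wclass_antimono[OF \<theta>q_rclass]) (use assms in auto)
  then show "cls n (\<lambda>_ _. 1) (\<lambda>c x. m c * s' c x)"
  proof (rule cls_cong)
    fix c x assume c: "c \<in> I"
    have "m c * (- c / sqrt (m c) * x / 2) = (- (1/2)) * c * (sqrt (m c) * x)"
    proof -
      have "m c * (- c / sqrt (m c) * x / 2) = (m c * (- c / sqrt (m c))) * (x / 2)" by simp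
      then show ?thesis unfolding m_times_div_sqrt[OF c] by simp
    qed
    moreover have "m c * (2 * c * Kint (\<lambda>z. z * q' z) (s c x) (m c) / m c)
        = 2 * c * Kint (\<lambda>z. z * q' z) (s c x) (m c)"
      using m_pos[OF c] by simp
    ultimately show "((- (1/2)) * c * (sqrt (m c) * x) + 2 * c * Kint (\<lambda>z. z * q' z) (s c x) (m c)) *
        (1 / q (W c x)) = m c * s' c x"
      unfolding s'_def by (simp only: times_divide_eq_right distrib_left mult_1_right)
  qed
qed

lemma cls_s: "cls 2 (\<lambda>_ _. 1) s"
proof -
  have "cls 0 (\<lambda>_ _. 1) s" using wbound_s by simp
  from cls_s_step[OF this] have "cls 1 (\<lambda>_ _. 1) s" by simp
  from cls_s_step[OF this] show ?thesis by (simp add: numeral_2_eq_2)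
qed

lemma cls_eta: "cls 2 eta eta"
  using cls_compose[OF open_greaterThanLessThan greaterThanLessThan_subset_pos cls_W[OF cls_s] W_mem h_rclass] by (simp add: eta_def[abs_def])

lemma eta_mem: "c \<in> I \<Longrightarrow> eta c x \<in> {0<..<\<delta>}"
  unfolding eta_def by (intro h_mem W_mem)

text \<open>Closed forms of the successive \<open>x\<close>-derivatives of \<open>eta\<close>. From
  the second on they come from the differentiated first integral
  \<open>\<eta>'' = m \<eta> - N1(\<eta>) / 2\<close>, so that \<open>q\<close> is never
  differentiated in \<open>x\<close>.\<close>

definition U :: "nat \<Rightarrow> real \<Rightarrow> real \<Rightarrow> real" where
  "U k c x = (if k = 0 then eta c x
     else if k = 1 then - (sqrt (m c)) * tanh (s c x) * eta c x
     else if k = 2 then m c * eta c x - N1 (eta c x) / 2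
     else (m c - N2 (eta c x) / 2) * (- (sqrt (m c)) * tanh (s c x) * eta c x))"

lemma U_0: "U 0 = eta"
  by (simp add: U_def fun_eq_iff)

text \<open>\<open>h'\<close> contributes a factor \<open>q\<close> and the phase a factor
  \<open>1 / q\<close>; they cancel. This is the reason for the weight \<open>q\<close> in the
  quadrature.\<close>

lemma eta_DERIV_x:
  assumes "c \<in> I"
  shows "(eta c has_real_derivative U 1 c x) (at x)"
proof -
  have q: "q (W c x) \<noteq> 0" "W c x > 0" using q_bounds[OF W_mem[OF assms, of x]] W_mem[OF assms, of x] by auto
  have "((\<lambda>x. m c * sech2 (s c x)) has_real_derivative
      m c * (- 2 * tanh (s c x) * sech2 (s c x) * (sqrt (m c) / 2 / q (W c x)))) (at x)"
    by (rule derivative_eq_intros refl s_DERIV_x[OF assms] | simp)+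
  then have "(W c has_real_derivative - tanh (s c x) * W c x * sqrt (m c) / q (W c x)) (at x)"
    unfolding W_def[abs_def] by (rule DERIV_cong) (simp add: W_def)
  from DERIV_chain2[OF h_deriv[OF W_mem[OF assms]] this]
  show ?thesis unfolding eta_def[abs_def]
    by (rule DERIV_cong) (use q in \<open>simp add: U_def eta_def field_simps\<close>)
qed

lemma U_DERIV_x:
  assumes "c \<in> I" "k < 3"
  shows "(U k c has_real_derivative U (Suc k) c x) (at x)"
proof -
  have k: "k = 0 \<or> k = 1 \<or> k = 2" using assms by auto
  have q: "q (W c x) \<noteq> 0" "W c x > 0" using q_bounds[OF W_mem[OF assms(1), of x]] W_mem[OF assms(1), of x] by auto
  define r where "r = sqrt (m c)"
  have sq: "r * r = m c" using m_pos[OF assms(1)] by (simp add: r_def)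
  have U1: "U 1 c x = - r * tanh (s c x) * eta c x" by (simp add: U_def r_def)
  have d1: "((\<lambda>x. - r * tanh (s c x) * eta c x) has_real_derivative
      - r * (sech2 (s c x) * (r / 2 / q (W c x))) * eta c x + U 1 c x * (- r * tanh (s c x))) (at x)"
    by (rule derivative_eq_intros refl s_DERIV_x[OF assms(1), folded r_def] eta_DERIV_x[OF assms(1)] | simp)+
  have "- r * (sech2 (s c x) * (r / 2 / q (W c x))) * eta c x + U 1 c x * (- r * tanh (s c x))
      = eta c x * (- ((r * r) * sech2 (s c x)) / (2 * q (W c x)) + (r * r) * (tanh (s c x))^2)"
    unfolding U1 using q by (simp add: field_simps power2_eq_square)
  also have "\<dots> = eta c x * (- W c x / (2 * q (W c x)) + m c - W c x)"
    unfolding sq W_def by (simp add: algebra_simps)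
  \<comment> \<open>\<open>N1_h\<close> absorbs the remaining term in \<open>1 / q\<close>, leaving
    a function of \<open>m\<close> and \<open>eta\<close> alone.\<close>
  also have "\<dots> = m c * eta c x - N1 (eta c x) / 2"
    unfolding eta_def N1_h[OF W_mem[OF assms(1)]] using q by (simp add: field_simps)
  finally have "((\<lambda>x. - (sqrt (m c)) * tanh (s c x) * eta c x) has_real_derivative
      m c * eta c x - N1 (eta c x) / 2) (at x)"
    using d1 unfolding r_def by metis
  moreover have "((\<lambda>x. m c * eta c x - N1 (eta c x) / 2) has_real_derivative
      (m c - N2 (eta c x) / 2) * (- (sqrt (m c)) * tanh (s c x) * eta c x)) (at x)"
  proof -
    have "((\<lambda>x. N1 (eta c x)) has_real_derivative N2 (eta c x) * U 1 c x) (at x)"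
      by (rule DERIV_chain2[where f = N1, OF N1_deriv[OF eta_mem[OF assms(1)]] eta_DERIV_x[OF assms(1)]])
    then show ?thesis using eta_DERIV_x[OF assms(1), of x]
      by (auto intro!: derivative_eq_intros simp: U_def algebra_simps)
  qed
  ultimately show ?thesis using k eta_DERIV_x[OF assms(1), of x]
    by (elim disjE) (simp_all add: U_def[abs_def] U_0)
qed

text \<open>The substitution is made for this: \<open>N(\<eta>) = W \<eta>\<^sup>2\<close> turns
  \<open>m \<eta>\<^sup>2 - N(\<eta>)\<close> into the perfect square
  \<open>m (tanh s)\<^sup>2 \<eta>\<^sup>2\<close>.\<close>

lemma eta_sq_identity:
  assumes "c \<in> I"
  shows "(U 1 c x)^2 = m c * (eta c x)^2 - N (eta c x)"
  using m_pos[OF assms] N_h[OF W_mem[OF assms, of x]]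
  by (simp add: U_def power_mult_distrib W_def eta_def algebra_simps)

lemma cls_U: "cls 2 eta (U k)"
proof -
  have N1: "cls 2 eta (\<lambda>c x. N1 (eta c x))"
    by (rule cls_compose[OF open_greaterThanLessThan greaterThanLessThan_subset_pos cls_eta eta_mem N1_rclass])
  have N2: "cls 2 (\<lambda>_ _. 1) (\<lambda>c x. N2 (eta c x))"
    by (rule cls_compose[OF open_greaterThanLessThan greaterThanLessThan_subset_pos cls_eta eta_mem N2_rclass])
  have U1: "cls 2 eta (\<lambda>c x. ((- 1) * sqrt (m c) * tanh (s c x)) * eta c x)"
    by (intro cls_mult1 cls_cmult cls_sqrt_m cls_tanh cls_s cls_eta)
  have U2: "cls 2 eta (\<lambda>c x. m c * eta c x - (1/2) * N1 (eta c x))"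
    by (intro cls_diff cls_mult1 cls_m1 cls_eta cls_cmult N1)
  have U3: "cls 2 eta (\<lambda>c x. (m c - (1/2) * N2 (eta c x)) * (((- 1) * sqrt (m c) * tanh (s c x)) * eta c x))"
    by (intro cls_mult1[OF _ U1] cls_diff cls_m1 cls_cmult N2)
  consider "k = 0" | "k = 1" | "k = 2" | "k \<noteq> 0" "k \<noteq> 1" "k \<noteq> 2" by blast
  then show ?thesis
  proof cases
    case 1 then show ?thesis by (intro cls_cong[OF cls_eta]) (simp add: U_def)
  next
    case 2 then show ?thesis by (intro cls_cong[OF U1]) (simp add: U_def)
  next
    case 3 then show ?thesis by (intro cls_cong[OF U2]) (simp add: U_def)
  next
    case 4 then show ?thesis by (intro cls_cong[OF U3]) (simp add: U_def)
  qed
qed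

definition V :: "nat \<Rightarrow> real \<Rightarrow> real \<Rightarrow> real" where
  "V k c x = c / 2 * (if k = 0 then eta c x / (1 - eta c x)
     else if k = 1 then U 1 c x / (1 - eta c x)^2
     else U 2 c x / (1 - eta c x)^2 + 2 * (U 1 c x)^2 / (1 - eta c x)^3)"

lemma V_DERIV_x:
  assumes "c \<in> I" "k < 2"
  shows "(V k c has_real_derivative V (Suc k) c x) (at x)"
proof -
  have k: "k = 0 \<or> k = 1" using assms by auto
  have e: "1 - eta c x \<noteq> 0" using eta_mem[OF assms(1), of x] \<delta> by auto
  have "((\<lambda>x. c / 2 * (eta c x / (1 - eta c x))) has_real_derivative
      c / 2 * (U 1 c x / (1 - eta c x)^2)) (at x)"
  proof -
    have "((\<lambda>x. eta c x / (1 - eta c x)) has_real_derivative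
        (U 1 c x * (1 - eta c x) - eta c x * (0 - U 1 c x)) / ((1 - eta c x) * (1 - eta c x))) (at x)"
      by (intro DERIV_divide DERIV_diff DERIV_const eta_DERIV_x[OF assms(1)] e)
    also have "(U 1 c x * (1 - eta c x) - eta c x * (0 - U 1 c x)) / ((1 - eta c x) * (1 - eta c x))
        = U 1 c x / (1 - eta c x)^2"
      by (simp add: algebra_simps power2_eq_square)
    finally show ?thesis by (rule DERIV_cmult)
  qed
  moreover have "((\<lambda>x. c / 2 * (U 1 c x / (1 - eta c x)^2)) has_real_derivative
      c / 2 * (U 2 c x / (1 - eta c x)^2 + 2 * (U 1 c x)^2 / (1 - eta c x)^3)) (at x)"
  proof -
    have "((\<lambda>x. (1 - eta c x)^2) has_real_derivative - 2 * (1 - eta c x) * U 1 c x) (at x)"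
      using eta_DERIV_x[OF assms(1), of x] by (auto intro!: derivative_eq_intros simp: algebra_simps)
    from DERIV_divide[OF U_DERIV_x[OF assms(1), of 1 x] this]
    have "((\<lambda>x. U 1 c x / (1 - eta c x)^2) has_real_derivative
        (U 2 c x * (1 - eta c x)^2 - U 1 c x * (- 2 * (1 - eta c x) * U 1 c x)) /
          ((1 - eta c x)^2 * (1 - eta c x)^2)) (at x)"
      using e by (simp add: numeral_2_eq_2)
    also have "(U 2 c x * (1 - eta c x)^2 - U 1 c x * (- 2 * (1 - eta c x) * U 1 c x)) /
          ((1 - eta c x)^2 * (1 - eta c x)^2)
        = U 2 c x / (1 - eta c x)^2 + 2 * (U 1 c x)^2 / (1 - eta c x)^3"
    proof -
      define z where "z = 1 - eta c x"
      have z: "z \<noteq> 0" using e by (simp add: z_def)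
      have "(U 2 c x * z^2 - U 1 c x * (- 2 * z * U 1 c x)) / (z^2 * z^2) = U 2 c x / z^2 + 2 * (U 1 c x)^2 / z^3"
        using z by (simp add: field_simps power2_eq_square power3_eq_cube)
      then show ?thesis by (simp only: z_def)
    qed
    finally show ?thesis by (rule DERIV_cmult)
  qed
  moreover have "V 0 c = (\<lambda>x. c / 2 * (eta c x / (1 - eta c x)))"
    "V 1 c = (\<lambda>x. c / 2 * (U 1 c x / (1 - eta c x)^2))"
    "V 2 c x = c / 2 * (U 2 c x / (1 - eta c x)^2 + 2 * (U 1 c x)^2 / (1 - eta c x)^3)"
    by (auto simp: V_def fun_eq_iff)
  ultimately have "(V 0 c has_real_derivative V 1 c x) (at x)" "(V 1 c has_real_derivative V 2 c x) (at x)"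
    by metis+
  then show ?thesis using k by (auto simp: numeral_2_eq_2)
qed

lemma cls_V: "cls 2 eta (V k)"
proof -
  have e: "1 - \<delta> \<le> 1 - eta c x" "1 - eta c x \<noteq> 0" "0 \<le> eta c x" "eta c x \<le> 1" if "c \<in> I" for c x
    using eta_mem[OF that, of x] \<delta> by auto
  have eta1: "cls 2 (\<lambda>_ _. 1) eta"
    by (rule cls_le[OF cls_eta, of 1]) (use e in auto)
  have u: "cls 2 (\<lambda>_ _. 1) (\<lambda>c x. 1 - eta c x)" by (intro cls_diff cls_const eta1)
  have i: "cls 2 (\<lambda>_ _. 1) (\<lambda>c x. 1 / (1 - eta c x))"
  proof (rule cls_inverse[OF u, where K = 1])
    show "wbound I L (\<lambda>_ _. 1) (\<lambda>c x. 1 / (1 - eta c x))"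
    proof (rule wboundI0[of "1 / (1 - \<delta>)"])
      show "\<bar>1 / (1 - eta c x)\<bar> \<le> 1 / (1 - \<delta>) * 1" if "c \<in> I" for c x
        using e[OF that, of x] \<delta> by (auto simp: abs_divide intro!: divide_left_mono)
      show "continuous_on I (\<lambda>c. 1 / (1 - eta c x))" for x
        using wbound_continuous(1)[OF wclass_wbound[OF eta1]] e by (intro continuous_intros) auto
      show "continuous_on UNIV (\<lambda>x. 1 / (1 - eta c x))" if "c \<in> I" for c
        using wbound_continuous(2)[OF wclass_wbound[OF eta1] that] e[OF that] by (intro continuous_intros) auto
    qed (use \<delta> in auto)
  qed (use e in auto)
  have U1': "cls 2 (\<lambda>_ _. 1) (U 1)"
    by (rule cls_le[OF cls_U, of 1]) (use e in auto)
  have V0: "cls 2 eta (\<lambda>c x. ((1/2) * c) * ((1 / (1 - eta c x)) * eta c x))"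
    by (intro cls_mult1 cls_cmult cls_c i cls_eta)
  have V1: "cls 2 eta (\<lambda>c x. ((1/2) * c) * (((1 / (1 - eta c x)) * (1 / (1 - eta c x))) * U 1 c x))"
    by (intro cls_mult1 cls_cmult cls_c i cls_U)
  have V2: "cls 2 eta (\<lambda>c x. ((1/2) * c) * (((1 / (1 - eta c x)) * (1 / (1 - eta c x))) * U 2 c x +
      (((2 * (1 / (1 - eta c x))) * (1 / (1 - eta c x))) * (1 / (1 - eta c x)) * U 1 c x) * U 1 c x))"
    by (intro cls_mult1 cls_cmult cls_add cls_c i cls_U U1')
  consider "k = 0" | "k = 1" | "k \<noteq> 0" "k \<noteq> 1" by blast
  then show ?thesis
  proof cases
    case 1 then show ?thesis by (intro cls_cong[OF V0]) (simp add: V_def)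
  next
    case 2 then show ?thesis by (intro cls_cong[OF V1]) (simp add: V_def power2_eq_square)
  next
    case 3 then show ?thesis
      by (intro cls_cong[OF V2]) (simp add: V_def power2_eq_square power3_eq_cube mult.assoc)
  qed
qed

end

section \<open>Exponential decay and the derivatives in the speed\<close>

lemma sech2_le_exp: "sech2 y \<le> 4 * exp (- 2 * \<bar>y\<bar>)"
proof -
  have "exp \<bar>y\<bar> \<le> 2 * cosh y" by (auto simp: cosh_def abs_if)
  then have "(exp \<bar>y\<bar>)^2 \<le> (2 * cosh y)^2" by (intro power_mono) auto
  then have e: "exp (2 * \<bar>y\<bar>) \<le> 4 * (cosh y)^2"
    by (simp add: exp_double power_mult_distrib)
  have "sech2 y = 1 / (cosh y)^2"
  proof -
    have "cosh y \<noteq> 0" by simp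
    then have "sech2 y = ((cosh y)^2 - (sinh y)^2) / (cosh y)^2"
      by (simp add: tanh_def power_divide diff_divide_distrib)
    then show ?thesis by (simp add: cosh_square_eq)
  qed
  also have "\<dots> \<le> 4 * exp (- 2 * \<bar>y\<bar>)"
    using e by (simp add: exp_minus field_simps)
  finally show ?thesis .
qed

text \<open>With \<open>r = 4 (n + 1)\<close> one has \<open>1 + z \<le> r exp (z / r)\<close>, and
  the \<open>n\<close>-th power costs at most \<open>exp (z / 4)\<close>: half of the decay pays for
  the polynomial weight.\<close>

lemma power_exp_bound:
  fixes z :: real
  assumes "0 \<le> z"
  shows "(1 + z) ^ n * exp (- z / 2) \<le> (4 * (real n + 1)) ^ n * exp (- z / 4)"
proof -
  define r where "r = 4 * (real n + 1)"
  have r: "1 \<le> r" by (simp add: r_def)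
  have "1 + z \<le> r * (1 + z / r)" using r assms by (simp add: algebra_simps)
  also have "\<dots> \<le> r * exp (z / r)" using r exp_ge_add_one_self[of "z / r"] by (intro mult_left_mono) auto
  finally have "(1 + z) ^ n \<le> (r * exp (z / r)) ^ n" using assms by (intro power_mono) auto
  also have "\<dots> = r ^ n * exp (n * (z / r))" by (simp only: power_mult_distrib exp_of_nat_mult)
  also have "\<dots> \<le> r ^ n * exp (z / 4)"
  proof -
    have "real n * (z / r) \<le> z / 4" using assms r by (simp add: r_def field_simps)
    then show ?thesis using r by simp
  qed
  finally have "(1 + z) ^ n * exp (- z / 2) \<le> r ^ n * exp (z / 4) * exp (- z / 2)"
    by (intro mult_right_mono) auto
  then show ?thesis by (simp add: r_def mult.assoc exp_add[symmetric])
qed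

context profile
begin

text \<open>The rate is half of the one obtained for \<open>eta\<close>; the other half absorbs the
  powers of \<open>L\<close>.\<close>

definition E :: "real \<Rightarrow> real \<Rightarrow> real" where "E c x = exp (- (sqrt (m c) * \<bar>x\<bar>) / 4)"

text \<open>The rate \<open>1/2\<close> is the exponent \<open>2\<close> in the decay of
  \<open>sech2\<close> times the \<open>1/4\<close> in the comparison of \<open>|s|\<close> with
  \<open>\<surd>m |x|\<close>.\<close>

lemma eta_decay:
  assumes "c \<in> I"
  shows "eta c x \<le> 4 * C * m c * exp (- (sqrt (m c) * \<bar>x\<bar>) / 2)"
proof -
  have "sech2 (s c x) \<le> 4 * exp (- (sqrt (m c) * \<bar>x\<bar>) / 2)"
    using sech2_le_exp[of "s c x"] s_bounds(2)[OF assms, of x]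
    by (smt (verit, best) exp_le_cancel_iff field_sum_of_halves)
  then have "C * m c * sech2 (s c x) \<le> C * m c * (4 * exp (- (sqrt (m c) * \<bar>x\<bar>) / 2))"
    using C m_pos[OF assms] by (intro mult_left_mono) auto
  then show ?thesis using h_le[OF W_mem[OF assms, of x]] by (simp add: eta_def W_def mult_ac)
qed

lemma wbound_eta_bound:
  assumes "wbound I L eta u"
  obtains K where "0 \<le> K" "\<And>c x. c \<in> I \<Longrightarrow> \<bar>u c x\<bar> \<le> K * m c * E c x"
proof -
  obtain n K where K: "0 \<le> K" "\<And>c x. c \<in> I \<Longrightarrow> \<bar>u c x\<bar> \<le> K * L c x ^ n * eta c x"
    using assms unfolding wbound_def by blast
  show ?thesis
  proof (rule that)
    show "0 \<le> K * 4 * C * (4 * (real n + 1)) ^ n" using K C by simp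
    fix c x assume c: "c \<in> I"
    let ?z = "sqrt (m c) * \<bar>x\<bar>"
    have m0: "0 \<le> m c" using m_pos[OF c] by simp
    have "\<bar>u c x\<bar> \<le> K * L c x ^ n * (4 * C * m c * exp (- ?z / 2))"
      using K(1) L_ge_1[OF c, of x] by (intro order_trans[OF K(2)[OF c]] mult_left_mono eta_decay c) auto
    also have "\<dots> = K * 4 * C * m c * ((1 + ?z) ^ n * exp (- ?z / 2))" by (simp add: L_def)
    also have "\<dots> \<le> K * 4 * C * m c * ((4 * (real n + 1)) ^ n * exp (- ?z / 4))"
      using K(1) C m0 by (intro mult_left_mono power_exp_bound) auto
    finally show "\<bar>u c x\<bar> \<le> K * 4 * C * (4 * (real n + 1)) ^ n * m c * E c x"
      by (simp add: E_def mult_ac)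
  qed
qed

text \<open>The class of order two, unwound: \<open>D j\<close> is the \<open>j\<close>-th
  derivative in \<open>c\<close>, and each derivative may cost a factor \<open>1 / m\<close>.
  Dividing the bound by \<open>m\<close> gives the weight with exponent \<open>j - 1\<close> of the
  stated estimate.\<close>

definition tame :: "(nat \<Rightarrow> real \<Rightarrow> real \<Rightarrow> real) \<Rightarrow> real \<Rightarrow> bool" where
  "tame D K \<longleftrightarrow> 0 \<le> K \<and>
     (\<forall>c\<in>I. \<forall>x. \<forall>j<2. ((\<lambda>c. D j c x) has_real_derivative D (Suc j) c x) (at c)) \<and>
     (\<forall>c\<in>I. \<forall>x. \<forall>j\<le>2. m c ^ j * \<bar>D j c x\<bar> \<le> K * m c * E c x) \<and>
     (\<forall>j\<le>2. (\<forall>x. continuous_on I (\<lambda>c. D j c x)) \<and> (\<forall>c\<in>I. continuous_on UNIV (D j c)))"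

lemma cls_tame:
  assumes "cls 2 eta u"
  shows "\<exists>D K. D 0 = u \<and> tame D K"
proof -
  have a2: "cls (Suc 1) eta u" using assms by (simp add: numeral_2_eq_2)
  obtain u1 where u1: "\<And>c x. c \<in> I \<Longrightarrow> ((\<lambda>c. u c x) has_real_derivative u1 c x) (at c)"
    "cls 1 eta (\<lambda>c x. m c * u1 c x)"
    using a2 by (rule clsSE) blast
  have a1: "cls (Suc 0) eta (\<lambda>c x. m c * u1 c x)" using u1(2) by simp
  obtain v where v: "\<And>c x. c \<in> I \<Longrightarrow> ((\<lambda>c. m c * u1 c x) has_real_derivative v c x) (at c)"
    "cls 0 eta (\<lambda>c x. m c * v c x)"
    using a1 by (rule clsSE) blast
  \<comment> \<open>The class controls \<open>m (m u1)'\<close>, not \<open>m\<^sup>2 u1'\<close>.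
    From \<open>(m u1)' = v\<close> and \<open>m' = - 2 c\<close> follows
    \<open>m u1' = v + 2 c u1\<close>.\<close>
  define u2 where "u2 c x = (v c x + 2 * c * u1 c x) / m c" for c x
  have mn: "m c \<noteq> 0" if "c \<in> I" for c using m_pos[OF that] by simp
  have d2: "((\<lambda>c. u1 c x) has_real_derivative u2 c x) (at c)" if c: "c \<in> I" for c x
  proof -
    have "((\<lambda>c. (m c * u1 c x) / m c) has_real_derivative
        (v c x * m c - (m c * u1 c x) * (- (2 * c))) / (m c * m c)) (at c)"
      by (rule DERIV_divide[OF v(1)[OF c] m_DERIV mn[OF c]])
    then have "((\<lambda>c. u1 c x) has_real_derivative
        (v c x * m c - (m c * u1 c x) * (- (2 * c))) / (m c * m c)) (at c)"
      by (rule has_field_derivative_transform_within_open[OF _ open_I c]) (use mn in auto)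
    then show ?thesis
      by (rule DERIV_cong) (use mn[OF c] in \<open>simp add: u2_def field_simps\<close>)
  qed
  have w0: "wbound I L eta u" and w1: "wbound I L eta (\<lambda>c x. m c * u1 c x)"
    and wv: "wbound I L eta (\<lambda>c x. m c * v c x)"
    using assms u1(2) v(2) wclass_wbound by blast+
  have "cls 0 eta (\<lambda>c x. m c * v c x + (2 * c) * (m c * u1 c x))"
    by (intro cls_add v(2) cls_mult1[of _ "\<lambda>c x. 2 * c" eta "\<lambda>c x. m c * u1 c x"] cls_cmult cls_c) (use w1 in simp)
  then have w2: "wbound I L eta (\<lambda>c x. m c ^ 2 * u2 c x)"
    unfolding wclass.simps
  proof (rule wbound_cong)
    fix c x assume "c \<in> I"
    then show "m c * v c x + 2 * c * (m c * u1 c x) = m c ^ 2 * u2 c x"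
      using mn[of c] by (simp add: u2_def power2_eq_square field_simps)
  qed
  obtain K0 where K0: "0 \<le> K0" "\<And>c x. c \<in> I \<Longrightarrow> \<bar>u c x\<bar> \<le> K0 * m c * E c x"
    using wbound_eta_bound[OF w0] by blast
  obtain K1 where K1: "0 \<le> K1" "\<And>c x. c \<in> I \<Longrightarrow> \<bar>m c * u1 c x\<bar> \<le> K1 * m c * E c x"
    using wbound_eta_bound[OF w1] by blast
  obtain K2 where K2: "0 \<le> K2" "\<And>c x. c \<in> I \<Longrightarrow> \<bar>m c ^ 2 * u2 c x\<bar> \<le> K2 * m c * E c x"
    using wbound_eta_bound[OF w2] by blast
  define D where "D = (\<lambda>j::nat. if j = 0 then u else if j = 1 then u1 else u2)"
  have j2: "j \<le> 2 \<longleftrightarrow> j = 0 \<or> j = 1 \<or> j = 2" for j :: nat by auto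
  have "tame D (K0 + K1 + K2)"
    unfolding tame_def
  proof (intro conjI ballI allI impI)
    show "0 \<le> K0 + K1 + K2" using K0 K1 K2 by simp
    show "((\<lambda>c. D j c x) has_real_derivative D (Suc j) c x) (at c)" if "c \<in> I" "j < 2" for c x j
      using that u1(1) d2 by (auto simp: D_def less_2_cases_iff)
    show "m c ^ j * \<bar>D j c x\<bar> \<le> (K0 + K1 + K2) * m c * E c x" if c: "c \<in> I" and j: "j \<le> 2" for c x j
    proof -
      have mE: "0 \<le> m c * E c x" using m_pos[OF c] by (simp add: E_def)
      have "m c ^ j * \<bar>D j c x\<bar> \<le> K0 * (m c * E c x) \<or> m c ^ j * \<bar>D j c x\<bar> \<le> K1 * (m c * E c x) \<or>
          m c ^ j * \<bar>D j c x\<bar> \<le> K2 * (m c * E c x)"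
        using j m_pos[OF c] K0(2)[OF c, of x] K1(2)[OF c, of x] K2(2)[OF c, of x]
        by (auto simp: D_def j2 abs_mult mult.assoc)
      moreover have "0 \<le> K0 * (m c * E c x)" "0 \<le> K1 * (m c * E c x)" "0 \<le> K2 * (m c * E c x)"
        using mE K0 K1 K2 by auto
      ultimately have "m c ^ j * \<bar>D j c x\<bar> \<le> K0 * (m c * E c x) + K1 * (m c * E c x) + K2 * (m c * E c x)"
        by linarith
      then show ?thesis by (simp add: algebra_simps)
    qed
    have cu1: "continuous_on I (\<lambda>c. u1 c x)" "c \<in> I \<Longrightarrow> continuous_on UNIV (u1 c)" for c x
    proof -
      have "continuous_on I (\<lambda>c. (m c * u1 c x) / m c)"
        by (intro continuous_on_divide wbound_continuous(1)[OF w1] m_cont) (use mn in auto)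
      then show "continuous_on I (\<lambda>c. u1 c x)"
        by (rule continuous_on_cong[THEN iffD1, rotated 2]) (use mn in auto)
      assume c: "c \<in> I"
      have "continuous_on UNIV (\<lambda>x. (m c * u1 c x) / m c)"
        by (intro continuous_on_divide wbound_continuous(2)[OF w1] c continuous_on_const) (use mn[OF c] in auto)
      then show "continuous_on UNIV (u1 c)" using mn[OF c] by simp
    qed
    have cu2: "continuous_on I (\<lambda>c. u2 c x)" "c \<in> I \<Longrightarrow> continuous_on UNIV (u2 c)" for c x
    proof -
      have "continuous_on I (\<lambda>c. (m c ^ 2 * u2 c x) / m c ^ 2)"
        by (intro continuous_on_divide wbound_continuous(1)[OF w2] m_cont continuous_on_power) (use mn in auto)
      then show "continuous_on I (\<lambda>c. u2 c x)"
        by (rule continuous_on_cong[THEN iffD1, rotated 2]) (use mn in auto)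
      assume c: "c \<in> I"
      have "continuous_on UNIV (\<lambda>x. (m c ^ 2 * u2 c x) / m c ^ 2)"
        by (intro continuous_on_divide wbound_continuous(2)[OF w2] c continuous_on_const) (use mn[OF c] in auto)
      then show "continuous_on UNIV (u2 c)" using mn[OF c] by simp
    qed
    show "continuous_on I (\<lambda>c. D j c x)" if "j \<le> 2" for j x
      using that cu1(1) cu2(1) wbound_continuous(1)[OF w0] by (auto simp: D_def j2)
    show "continuous_on UNIV (D j c)" if "j \<le> 2" "c \<in> I" for j c
      using that cu1(2)[OF that(2)] cu2(2)[OF that(2)] wbound_continuous(2)[OF w0 that(2)] by (auto simp: D_def j2)
  qed
  moreover have "D 0 = u" by (simp add: D_def)
  ultimately show ?thesis by blast
qed

lemma tame_decaying:
  assumes "tame D K" "j \<le> 2"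
  shows "decaying I (D j)"
  unfolding decaying_def
proof (intro conjI ballI)
  fix c assume c: "c \<in> I"
  show "continuous_on UNIV (D j c)" using assms c by (auto simp: tame_def)
  \<comment> \<open>\<open>m\<close> decreases, so for parameters below \<open>c1 < cs\<close> it
    stays at least \<open>m c1 > 0\<close>; this fixes the decay rate and bounds the negative powers
    of \<open>m\<close>.\<close>
  define c1 where "c1 = (c + cs) / 2"
  have c1: "c < c1" "c1 < cs" "c1 \<in> I" using c by (auto simp: c1_def I_def)
  define r where "r = min (c - c0) (c1 - c)"
  define a where "a = sqrt (m c1) / 4"
  have m1: "0 < m c1" using m_pos c1 by blast
  have K: "0 \<le> K" using assms by (simp add: tame_def)
  have r0: "0 < r" using c c1 by (auto simp: r_def I_def)
  have a0: "0 < a" using m1 by (simp add: a_def)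
  have K0: "0 \<le> K * w / m c1 ^ j" using K w_pos m1 by simp
  have "c' \<in> I \<and> (\<forall>x. \<bar>D j c' x\<bar> \<le> K * w / m c1 ^ j * exp (- a * \<bar>x\<bar>))" if c': "\<bar>c' - c\<bar> < r" for c'
  proof (intro conjI allI)
    from c' have c'1: "c0 < c'" "c' < c1" by (auto simp: r_def)
    then show c'I: "c' \<in> I" using c1 by (auto simp: I_def)
    have "c'^2 \<le> c1^2" using c'1 c0 by (intro power_mono) auto
    then have mm: "m c1 \<le> m c'" by (simp add: m_def)
    fix x
    have "m c1 ^ j * \<bar>D j c' x\<bar> \<le> m c' ^ j * \<bar>D j c' x\<bar>"
      using mm m1 by (intro mult_right_mono power_mono) auto
    also have "\<dots> \<le> K * m c' * E c' x" using assms c'I by (auto simp: tame_def)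
    also have "\<dots> \<le> K * w * exp (- a * \<bar>x\<bar>)"
    proof (intro mult_mono)
      show "m c' \<le> w" using m_mem[OF c'I] by auto
      have "sqrt (m c1) * \<bar>x\<bar> \<le> sqrt (m c') * \<bar>x\<bar>" using mm by (intro mult_right_mono) auto
      then show "E c' x \<le> exp (- a * \<bar>x\<bar>)" by (simp add: E_def a_def)
    qed (use K w_pos m_pos[OF c'I] in \<open>auto simp: E_def\<close>)
    finally show "\<bar>D j c' x\<bar> \<le> K * w / m c1 ^ j * exp (- a * \<bar>x\<bar>)"
      using m1 by (simp add: field_simps)
  qed
  with r0 a0 K0 show "\<exists>r>0. \<exists>K a. 0 < a \<and> 0 \<le> K \<and>
        (\<forall>c'. \<bar>c' - c\<bar> < r \<longrightarrow> c' \<in> I \<and> (\<forall>x. \<bar>D j c' x\<bar> \<le> K * exp (- a * \<bar>x\<bar>)))"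
    by blast
qed

lemma tame_C2_family:
  assumes "\<And>k. k \<le> n \<Longrightarrow> tame (D k) (K k)"
    and "\<And>k c x. k < n \<Longrightarrow> c \<in> I \<Longrightarrow> (D k 0 c has_real_derivative D (Suc k) 0 c x) (at x)"
  shows "C2_family I n (\<lambda>k. D k 0) (\<lambda>k. D k 1) (\<lambda>k. D k 2)"
proof
  fix k assume k: "k \<le> n"
  note t = assms(1)[OF k]
  have d: "((\<lambda>c. D k j c x) has_real_derivative D k (Suc j) c x) (at c)" if "c \<in> I" "j < 2" for c j x
    using t that by (auto simp: tame_def)
  show "deriv_family I (D k 0) (D k 1)"
    unfolding deriv_family_def using tame_decaying[OF t, of 0] tame_decaying[OF t, of 1] d[of _ 0] by auto
  show "deriv_family I (D k 1) (D k 2)"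
    unfolding deriv_family_def using tame_decaying[OF t, of 1] tame_decaying[OF t, of 2] d[of _ 1]
    by (auto simp: numeral_2_eq_2)
  show "isCont (\<lambda>c. D k 2 c x) c" if "c \<in> I" for c x
    using t that open_I by (auto simp: tame_def continuous_on_eq_continuous_at)
qed (use assms(2) in auto)

text \<open>\<open>deriv\<close> depends on the values in a neighbourhood, so the identification of
  \<open>pd\<close> with \<open>D\<close> is proved at all points of the open set \<open>I\<close>
  at once, order by order.\<close>

lemma tame_pds:
  assumes "\<And>k. k \<le> n \<Longrightarrow> tame (D k) (K k)"
    and "\<And>k c x. k < n \<Longrightarrow> c \<in> I \<Longrightarrow> (D k 0 c has_real_derivative D (Suc k) 0 c x) (at x)"
  shows "has_pds (D 0 0) I 2 n"
    and "\<And>j k c x. j \<le> 2 \<Longrightarrow> k \<le> n \<Longrightarrow> c \<in> I \<Longrightarrow> pd (D 0 0) j k c x = D k j c x"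
proof -
  have dx: "(deriv ^^ k) (D 0 0 c) = D k 0 c" if "k \<le> n" "c \<in> I" for k c
    using that
  proof (induction k)
    case (Suc k)
    then have "(deriv ^^ k) (D 0 0 c) = D k 0 c" by simp
    moreover have "deriv (D k 0 c) = D (Suc k) 0 c"
      using assms(2)[of k c] Suc.prems by (auto simp: fun_eq_iff DERIV_imp_deriv)
    ultimately show ?case by simp
  qed simp
  have pd_eq: "pd (D 0 0) j k c x = D k j c x \<and>
      (j < 2 \<longrightarrow> ((\<lambda>c'. pd (D 0 0) j k c' x) has_real_derivative D k (Suc j) c x) (at c))"
    if "k \<le> n" "j \<le> 2" "c \<in> I" for j k c x
    using that(2,3)
  proof (induction j arbitrary: c)
    have d: "((\<lambda>c'. pd (D 0 0) j k c' x) has_real_derivative D k (Suc j) c x) (at c)"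
      if "\<And>c'. c' \<in> I \<Longrightarrow> pd (D 0 0) j k c' x = D k j c' x" "j < 2" "c \<in> I" for j c
    proof -
      have "((\<lambda>c. D k j c x) has_real_derivative D k (Suc j) c x) (at c)"
        using assms(1)[OF \<open>k \<le> n\<close>] that by (auto simp: tame_def)
      then show ?thesis
        by (rule has_field_derivative_transform_within_open[OF _ open_I \<open>c \<in> I\<close>]) (use that in auto)
    qed
    {
      case 0
      have "pd (D 0 0) 0 k c' x = D k 0 c' x" if "c' \<in> I" for c'
        using dx[OF \<open>k \<le> n\<close> that] by (simp add: pd_def)
      then show ?case using d[of 0 c] 0 by auto
    next
      case (Suc j)
      have "pd (D 0 0) (Suc j) k c' x = D k (Suc j) c' x" if "c' \<in> I" for c'
      proof -
        have "((\<lambda>c'. pd (D 0 0) j k c' x) has_real_derivative D k (Suc j) c' x) (at c')"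
          using Suc.IH[of c'] Suc.prems that by auto
        then show ?thesis by (simp add: pd_def DERIV_imp_deriv)
      qed
      then show ?case using d[of "Suc j" c] Suc.prems by auto
    }
  qed
  then show "\<And>j k c x. j \<le> 2 \<Longrightarrow> k \<le> n \<Longrightarrow> c \<in> I \<Longrightarrow> pd (D 0 0) j k c x = D k j c x" by blast
  have "((deriv ^^ k) (D 0 0 c) has_real_derivative (deriv ^^ Suc k) (D 0 0 c) x) (at x)"
    if "k < n" "c \<in> I" for k c x
  proof -
    have "(deriv ^^ k) (D 0 0 c) = D k 0 c" "(deriv ^^ Suc k) (D 0 0 c) = D (Suc k) 0 c"
      using dx that Suc_leI less_imp_le_nat by blast+
    then show ?thesis using assms(2)[OF that] by metis
  qed
  moreover have "((\<lambda>c'. pd (D 0 0) j k c' x) has_real_derivative pd (D 0 0) (Suc j) k c x) (at c)"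
    if "k \<le> n" "j < 2" "c \<in> I" for j k c x
    using pd_eq[of k j c x] pd_eq[of k "Suc j" c x] that by auto
  ultimately show "has_pds (D 0 0) I 2 n"
    unfolding has_pds_def by blast
qed

section \<open>Symmetry and the stated decay estimate\<close>

lemma s_minus: "c \<in> I \<Longrightarrow> s c (- x) = - s c x"
  unfolding s_def using phi_minus[OF m_mem, of c "sqrt (m c) * x / 2"] by simp

lemma eta_minus: "c \<in> I \<Longrightarrow> eta c (- x) = eta c x"
  by (simp add: eta_def W_def s_minus)

lemma s_0: "c \<in> I \<Longrightarrow> s c 0 = 0"
  using s_minus[of c 0] by simp

lemma U1_neq_0:
  assumes "c \<in> I" "x \<noteq> 0"
  shows "U 1 c x \<noteq> 0"
proof -
  have "s c x \<noteq> 0" using s_bounds(2)[OF assms(1), of x] m_pos[OF assms(1)] assms(2)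
    by (auto simp: mult_le_0_iff)
  then show ?thesis using m_pos[OF assms(1)] eta_mem[OF assms(1), of x] by (auto simp: U_def)
qed

lemma families:
  obtains D D' :: "nat \<Rightarrow> nat \<Rightarrow> real \<Rightarrow> real \<Rightarrow> real" and K :: real where
    "C2_family I 3 (\<lambda>k. D k 0) (\<lambda>k. D k 1) (\<lambda>k. D k 2)"
    "C2_family I 2 (\<lambda>k. D' k 0) (\<lambda>k. D' k 1) (\<lambda>k. D' k 2)"
    "D 0 0 = eta" "D' 0 0 = V 0" "has_pds eta I 2 3" "has_pds (V 0) I 2 2" "0 \<le> K"
    "\<And>j k c x. j \<le> 2 \<Longrightarrow> k \<le> 3 \<Longrightarrow> c \<in> I \<Longrightarrow> m c ^ j * \<bar>pd eta j k c x\<bar> \<le> K * m c * E c x"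
    "\<And>j k c x. j \<le> 2 \<Longrightarrow> k \<le> 2 \<Longrightarrow> c \<in> I \<Longrightarrow> m c ^ j * \<bar>pd (V 0) j k c x\<bar> \<le> K * m c * E c x"
proof -
  have "\<forall>k. \<exists>D K. D 0 = U k \<and> tame D K" using cls_tame[OF cls_U] by blast
  then obtain D K where D: "\<And>k. D k 0 = U k" "\<And>k. tame (D k) (K k)" by metis
  have "\<forall>k. \<exists>D K. D 0 = V k \<and> tame D K" using cls_tame[OF cls_V] by blast
  then obtain D' K' where D': "\<And>k. D' k 0 = V k" "\<And>k. tame (D' k) (K' k)" by metis
  have x: "(D k 0 c has_real_derivative D (Suc k) 0 c x) (at x)" if "k < 3" "c \<in> I" for k c x
    unfolding D using U_DERIV_x that by blast
  have x': "(D' k 0 c has_real_derivative D' (Suc k) 0 c x) (at x)" if "k < 2" "c \<in> I" for k c x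
    unfolding D' using V_DERIV_x that by blast
  have D0: "D 0 0 = eta" by (simp add: D U_0)
  let ?K = "(\<Sum>k\<le>3. K k) + (\<Sum>k\<le>2. K' k)"
  have K0: "0 \<le> K k" "0 \<le> K' k" for k using D(2)[of k] D'(2)[of k] by (auto simp: tame_def)
  have le: "K k \<le> ?K" if "k \<le> 3" for k
    using member_le_sum[of k "{..3}" K] K0 that sum_nonneg[of "{..2}" K'] by auto
  have le': "K' k \<le> ?K" if "k \<le> 2" for k
    using member_le_sum[of k "{..2}" K'] K0 that sum_nonneg[of "{..3}" K] by auto
  have mE: "0 \<le> m c * E c x" if "c \<in> I" for c x using m_pos[OF that] by (simp add: E_def)
  show ?thesis
  proof (rule that[of D D' ?K])
    show "C2_family I 3 (\<lambda>k. D k 0) (\<lambda>k. D k 1) (\<lambda>k. D k 2)"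
      by (rule tame_C2_family[where K = K]) (use D x in auto)
    show "C2_family I 2 (\<lambda>k. D' k 0) (\<lambda>k. D' k 1) (\<lambda>k. D' k 2)"
      by (rule tame_C2_family[where K = K']) (use D' x' in auto)
    show "has_pds eta I 2 3"
      using tame_pds(1)[of 3 D K] D(2) x D0 by auto
    show "has_pds (V 0) I 2 2"
      using tame_pds(1)[of 2 D' K'] D'(2) x' D'(1) by auto
    show "0 \<le> ?K" using K0 by (simp add: sum_nonneg)
    fix j k c x assume j: "j \<le> (2::nat)" and c: "c \<in> I"
    show "m c ^ j * \<bar>pd eta j k c x\<bar> \<le> ?K * m c * E c x" if k: "k \<le> 3"
    proof -
      have "pd eta j k c x = D k j c x"
        using tame_pds(2)[of 3 D K j k c x] D(2) x D0 j k c by auto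
      then have "m c ^ j * \<bar>pd eta j k c x\<bar> \<le> K k * (m c * E c x)"
        using D(2)[of k] j c by (auto simp: tame_def mult.assoc)
      also have "\<dots> \<le> ?K * (m c * E c x)" by (rule mult_right_mono[OF le[OF k] mE[OF c]])
      finally show ?thesis by (simp add: mult.assoc)
    qed
    show "m c ^ j * \<bar>pd (V 0) j k c x\<bar> \<le> ?K * m c * E c x" if k: "k \<le> 2"
    proof -
      have "pd (V 0) j k c x = D' k j c x"
        using tame_pds(2)[of 2 D' K' j k c x] D'(2) x' D'(1) j k c by auto
      then have "m c ^ j * \<bar>pd (V 0) j k c x\<bar> \<le> K' k * (m c * E c x)"
        using D'(2)[of k] j c by (auto simp: tame_def mult.assoc)
      also have "\<dots> \<le> ?K * (m c * E c x)" by (rule mult_right_mono[OF le'[OF k] mE[OF c]])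
      finally show ?thesis by (simp add: mult.assoc)
    qed
  qed (use D0 D'(1) in auto)
qed

text \<open>There are \<open>4 * 3 * 3 = 36\<close> summands, all with the same bound. The largest
  exponent of \<open>c\<close> is \<open>1 + 4 + 4 = 9\<close>, and the base \<open>1 + cs\<close>
  is used because it exceeds both \<open>c\<close> and \<open>1\<close>.\<close>

lemma decay_estimate:
  assumes K: "0 \<le> K"
    and eta: "\<And>j k c x. j \<le> 2 \<Longrightarrow> k \<le> 3 \<Longrightarrow> c \<in> I \<Longrightarrow> m c ^ j * \<bar>pd eta j k c x\<bar> \<le> K * m c * E c x"
    and v: "\<And>j k c x. j \<le> 2 \<Longrightarrow> k \<le> 2 \<Longrightarrow> c \<in> I \<Longrightarrow> m c ^ j * \<bar>pd (V 0) j k c x\<bar> \<le> K * m c * E c x"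
    and c: "c \<in> I"
  shows "(\<Sum>k1\<le>3. \<Sum>k2\<le>2. \<Sum>j\<le>2::nat. m c powi (int j - 1) *
      (\<bar>pd eta j k1 c x\<bar> + c ^ (1 + 2*j + 2*k2) * \<bar>pd (V 0) j k2 c x\<bar>)) \<le> 36 * ((K + (1 + cs) ^ 9 * K) * E c x)"
proof -
  have m0: "0 < m c" by (rule m_pos[OF c])
  have red: "m c powi (int j - 1) * a \<le> K * E c x" if "m c ^ j * a \<le> K * m c * E c x" for j a
  proof -
    have "m c powi (int j - 1) = m c ^ j / m c"
      using m0 by (simp add: power_int_diff)
    then have "m c powi (int j - 1) * a = (m c ^ j * a) / m c" by simp
    also have "\<dots> \<le> (K * m c * E c x) / m c" using that m0 by (intro divide_right_mono) auto
    also have "\<dots> = K * E c x" using m0 by simp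
    finally show ?thesis .
  qed
  have "m c powi (int j - 1) * (\<bar>pd eta j k1 c x\<bar> + c ^ (1 + 2*j + 2*k2) * \<bar>pd (V 0) j k2 c x\<bar>)
      \<le> (K + (1 + cs) ^ 9 * K) * E c x" if jk: "k1 \<le> 3" "k2 \<le> 2" "j \<le> 2" for j k1 k2
  proof -
    let ?p = "1 + 2*j + 2*k2"
    have "c ^ ?p \<le> (1 + cs) ^ ?p" using c_pos[OF c] c_less[OF c] by (intro power_mono) auto
    also have "\<dots> \<le> (1 + cs) ^ 9" using jk c0 by (intro power_increasing) auto
    finally have cp: "c ^ ?p \<le> (1 + cs) ^ 9" .
    have "m c powi (int j - 1) * \<bar>pd eta j k1 c x\<bar> \<le> K * E c x"
      by (intro red eta jk c)
    moreover have "c ^ ?p * (m c powi (int j - 1) * \<bar>pd (V 0) j k2 c x\<bar>) \<le> (1 + cs) ^ 9 * (K * E c x)"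
    proof (rule mult_mono[OF cp])
      show "m c powi (int j - 1) * \<bar>pd (V 0) j k2 c x\<bar> \<le> K * E c x" by (intro red v jk c)
    qed (use m0 c0 in auto)
    ultimately show ?thesis by (simp add: algebra_simps)
  qed
  then have "(\<Sum>k1\<le>3. \<Sum>k2\<le>2. \<Sum>j\<le>2::nat. m c powi (int j - 1) *
      (\<bar>pd eta j k1 c x\<bar> + c ^ (1 + 2*j + 2*k2) * \<bar>pd (V 0) j k2 c x\<bar>))
    \<le> (\<Sum>k1\<le>(3::nat). \<Sum>k2\<le>(2::nat). \<Sum>j\<le>(2::nat). (K + (1 + cs) ^ 9 * K) * E c x)"
    by (intro sum_mono) auto
  then show ?thesis by simp
qed

end

section \<open>Monotonicity of the momentum\<close>

lemma decaying_integrable: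
  assumes "decaying I u" "c \<in> I"
  shows "integrable lborel (u c)"
proof -
  have [measurable]: "u c \<in> borel_measurable borel" by (rule decaying_measurable[OF assms])
  obtain K a where Ka: "0 < a" "0 \<le> K" "\<And>x. \<bar>u c x\<bar> \<le> K * exp (- a * \<bar>x\<bar>)"
    using decayingE[OF assms] by (metis abs_zero diff_self)
  show ?thesis
  proof (rule Bochner_Integration.integrable_bound)
    show "integrable lborel (\<lambda>x. K * exp (- a * \<bar>x\<bar>))"
      using integrable_exp_abs[OF Ka(1)] by simp
    show "AE x in lborel. norm (u c x) \<le> norm (K * exp (- a * \<bar>x\<bar>))"
      using Ka by (auto simp: abs_mult)
  qed auto
qed

lemma deriv_family_integral:
  assumes fam: "deriv_family I u u'" and c: "c \<in> I"
  shows "((\<lambda>c. LINT x|lborel. u c x) has_real_derivative (LINT x|lborel. u' c x)) (at c)"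
proof -
  have d: "decaying I u" using fam by (simp add: deriv_family_def)
  obtain r where r: "0 < r" "\<And>c'. \<bar>c' - c\<bar> < r \<Longrightarrow> c' \<in> I"
    using decaying_nbhd[OF d c] by blast
  have "((\<lambda>h. LINT x|lborel. (u (c + h) x - u c x) / h) \<longlongrightarrow> (LINT x|lborel. u' c x)) (at 0)"
    using difference_quotient_integral_tendsto[OF fam c, of "\<lambda>_. 1" 1] by simp
  moreover have "\<forall>\<^sub>F h in at 0. (LINT x|lborel. (u (c + h) x - u c x) / h)
      = ((LINT x|lborel. u (c + h) x) - (LINT x|lborel. u c x)) / h"
    using eventually_abs_less_at_0[OF r(1)]
  proof eventually_elim
    case (elim h)
    have "c + h \<in> I" using r(2)[of "c + h"] elim by auto
    then have "integrable lborel (u (c + h))" "integrable lborel (u c)"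
      using decaying_integrable[OF d] c by auto
    then show ?case by simp
  qed
  ultimately show ?thesis
    unfolding DERIV_def by (rule Lim_transform_eventually)
qed

context profile
begin

text \<open>The momentum density \<open>\<eta>\<^sup>2 / (1 - \<eta>)\<close> together with the
  Jacobian factor \<open>q\<close> of the change from \<open>x\<close> to the phase
  variable.\<close>

definition R :: "real \<Rightarrow> real" where "R y = (h y)^2 * q y / (1 - h y)"
definition \<theta>R :: "real \<Rightarrow> real" where
  "\<theta>R y = R y * (2 * q y + y * q' y / q y + h y * q y / (1 - h y))"

lemma R_DERIV:
  assumes "y \<in> {0<..<w}"
  shows "(R has_real_derivative \<theta>R y / y) (at y)"
proof -
  have ne: "1 - h y \<noteq> 0" "q y \<noteq> 0" "y \<noteq> 0"
    using h_mem[OF assms] \<delta> q_bounds[OF assms] assms by auto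
  have "((\<lambda>y. (h y)^2 * q y / (1 - h y)) has_real_derivative
      ((2 * h y * (h y * q y / y) * q y + q' y * (h y)^2) * (1 - h y) - (h y)^2 * q y * (0 - h y * q y / y)) /
        ((1 - h y) * (1 - h y))) (at y)"
    using h_deriv[OF assms] q_deriv[OF assms]
    by (intro DERIV_divide DERIV_mult DERIV_diff DERIV_const ne) (auto intro!: derivative_eq_intros)
  moreover have "((2 * h y * (h y * q y / y) * q y + q' y * (h y)^2) * (1 - h y) - (h y)^2 * q y * (0 - h y * q y / y)) /
        ((1 - h y) * (1 - h y)) = \<theta>R y / y"
  proof -
    define a where "a = 1 - h y"
    have a: "a \<noteq> 0" using ne by (simp add: a_def)
    have "((2 * h y * (h y * q y / y) * q y + q' y * (h y)^2) * a - (h y)^2 * q y * (0 - h y * q y / y)) / (a * a)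
        = ((h y)^2 * q y / a) * (2 * q y + y * q' y / q y + h y * q y / a) / y"
      using a ne by (simp add: field_simps power2_eq_square)
    then show ?thesis by (simp only: a_def \<theta>R_def R_def)
  qed
  ultimately show ?thesis unfolding R_def[abs_def] by simp
qed

text \<open>The logarithmic derivative of \<open>R\<close> is close to \<open>2\<close> near
  \<open>0\<close>, as for \<open>y\<^sup>2\<close>; the weaker lower bound \<open>3/2\<close> is
  enough for the momentum. The bounds linear in \<open>y\<close> serve as majorants, since
  \<open>sech2\<close> is integrable.\<close>

lemma R_bounds:
  assumes y: "y \<in> {0<..<w}" and q: "7/8 \<le> q y" "\<bar>y * q' y\<bar> \<le> 1/16"
  shows "0 < R y" "R y \<le> (2 * C / (1 - \<delta>)) * y" "3/2 * R y \<le> \<theta>R y"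
    "\<bar>\<theta>R y\<bar> \<le> (2 * C / (1 - \<delta>)) * (5 + 2 / (1 - \<delta>)) * y"
proof -
  have h: "0 < h y" "h y < \<delta>" "h y < 1" using h_mem[OF y] \<delta> by auto
  have q2: "q y \<le> 2" using q_bounds[OF y] by auto
  show Rp: "0 < R y" using h q by (simp add: R_def)
  have "(h y)^2 \<le> 1 * h y" unfolding power2_eq_square using h by (intro mult_right_mono) auto
  then have "(h y)^2 \<le> C * y" using h_le[OF y] by simp
  then have "(h y)^2 * q y \<le> (C * y) * 2" using q q2 h C y by (intro mult_mono) auto
  then have "(h y)^2 * q y / (1 - h y) \<le> ((C * y) * 2) / (1 - \<delta>)"
    using h \<delta> C y by (intro frac_le) auto
  then show Rle: "R y \<le> (2 * C / (1 - \<delta>)) * y" by (simp add: R_def mult_ac)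
  have "\<bar>y * q' y / q y\<bar> \<le> (1/16) / (1/2)"
    unfolding abs_divide using q by (intro frac_le) auto
  then have a: "\<bar>y * q' y / q y\<bar> \<le> 1/8" by simp
  have b: "0 \<le> h y * q y / (1 - h y)" using h q by simp
  have b2: "h y * q y / (1 - h y) \<le> 2 / (1 - \<delta>)"
  proof (intro frac_le)
    have "h y * q y \<le> 1 * 2" using h q q2 by (intro mult_mono) auto
    then show "h y * q y \<le> 2" by simp
  qed (use h \<delta> in auto)
  let ?f = "2 * q y + y * q' y / q y + h y * q y / (1 - h y)"
  \<comment> \<open>\<open>2 * 7/8 - 1/8 = 13/8\<close> exceeds \<open>3/2\<close>, and the last
    summand is nonnegative.\<close>
  have f: "3/2 \<le> ?f" "?f \<le> 5 + 2 / (1 - \<delta>)" using abs_le_D1[OF a] abs_le_D2[OF a] b b2 q(1) q2 by linarith+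
  show "3/2 * R y \<le> \<theta>R y" unfolding \<theta>R_def using mult_right_mono[OF f(1), of "R y"] Rp by (simp add: mult.commute)
  have f0: "0 \<le> ?f" using f(1) by linarith
  then have "\<bar>\<theta>R y\<bar> = R y * ?f" unfolding \<theta>R_def abs_mult using Rp by (simp only: abs_of_pos abs_of_nonneg)
  also have "\<dots> \<le> ((2 * C / (1 - \<delta>)) * y) * (5 + 2 / (1 - \<delta>))"
    using C y \<delta> by (intro mult_mono[OF Rle f(2) _ f0]) auto
  finally show "\<bar>\<theta>R y\<bar> \<le> (2 * C / (1 - \<delta>)) * (5 + 2 / (1 - \<delta>)) * y" by (simp add: mult_ac)
qed

lemma momentum_eq:
  assumes c: "c \<in> I"
  shows "momentum (eta c) (V 0 c) = c / (2 * sqrt (m c)) * (LINT t|lborel. R (m c * sech2 t))"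
proof -
  \<comment> \<open>The inverse of \<open>s c\<close>. Its derivative is explicit and positive, so
    the integral over \<open>x\<close> is pulled back to the phase variable along it.\<close>
  let ?g = "\<lambda>t. 2 / sqrt (m c) * Kint q t (m c)"
  let ?g' = "\<lambda>t. 2 / sqrt (m c) * q (m c * sech2 t)"
  let ?f = "\<lambda>x. (eta c x)^2 / (1 - eta c x)"
  have sm: "0 < sqrt (m c)" using m_pos[OF c] by simp
  have sg: "s c (?g t) = t" for t
    unfolding s_def using sm by (intro phi_eqI m_mem[OF c]) (simp add: field_simps)
  have gs: "?g (s c x) = x" for x
    unfolding s_def using Kint_phi[OF m_mem[OF c]] sm by simp
  have inj: "inj_on ?g UNIV" by (rule inj_on_inverseI[of _ "s c"]) (rule sg)
  have range: "range ?g = UNIV" by (rule surjI[of _ "s c"]) (rule gs)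
  have gd: "(?g has_real_derivative ?g' t) (at t within UNIV)" for t
    by (rule DERIV_cmult[OF Kint_has_derivative_t[OF q_cont m_mem[OF c], of t]])
  have qp: "0 < q (m c * sech2 t)" for t using q_bounds[OF mult_sech2_mem[OF m_mem[OF c]], of t] by auto
  have pos: "0 < ?g' t" for t using qp[of t] sm by simp
  have cont: "continuous_on UNIV ?f"
    using eta_mem[OF c] \<delta> wbound_continuous(2)[OF wclass_wbound[OF cls_eta] c]
    by (intro continuous_intros) (auto, metis less_trans less_irrefl)
  have int: "integrable lborel ?f"
  proof (rule Bochner_Integration.integrable_bound)
    show "integrable lborel (\<lambda>x. (4 * C * m c / (1 - \<delta>)) * exp (- (sqrt (m c) / 2) * \<bar>x\<bar>))"
      using integrable_exp_abs[of "sqrt (m c) / 2"] sm by simp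
    have "\<bar>?f x\<bar> \<le> (4 * C * m c / (1 - \<delta>)) * exp (- (sqrt (m c) / 2) * \<bar>x\<bar>)" for x
    proof -
      have e: "0 < eta c x" "eta c x < \<delta>" "eta c x < 1" using eta_mem[OF c, of x] \<delta> by auto
      have "(eta c x)^2 \<le> 1 * eta c x" unfolding power2_eq_square using e by (intro mult_right_mono) auto
      then have "(eta c x)^2 \<le> 4 * C * m c * exp (- (sqrt (m c) * \<bar>x\<bar>) / 2)" using eta_decay[OF c, of x] by simp
      then have "?f x \<le> (4 * C * m c * exp (- (sqrt (m c) * \<bar>x\<bar>) / 2)) / (1 - \<delta>)"
        using e \<delta> C m_pos[OF c] by (intro frac_le) auto
      then show ?thesis using e by simp
    qed
    then show "AE x in lborel. norm (?f x) \<le> norm ((4 * C * m c / (1 - \<delta>)) * exp (- (sqrt (m c) / 2) * \<bar>x\<bar>))"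
      using C m_pos[OF c] \<delta> by (auto simp: abs_mult)
  qed (use borel_measurable_continuous_onI[OF cont] in auto)
  have absf: "?f absolutely_integrable_on UNIV"
    using int by (simp add: set_integrable_def integrable_completion)
  have "(\<lambda>t. \<bar>?g' t\<bar> *\<^sub>R ?f (?g t)) absolutely_integrable_on UNIV \<and>
      integral UNIV (\<lambda>t. \<bar>?g' t\<bar> *\<^sub>R ?f (?g t)) = integral UNIV ?f"
    using has_absolute_integral_change_of_variables_1'[of UNIV ?g ?g' ?f "integral UNIV ?f"] gd inj range absf
    by auto
  moreover have "\<bar>?g' t\<bar> *\<^sub>R ?f (?g t) = 2 / sqrt (m c) * R (m c * sech2 t)" for t
  proof -
    have "\<bar>?g' t\<bar> = ?g' t" using pos[of t] by (rule abs_of_pos)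
    then show ?thesis unfolding eta_def W_def sg R_def by simp
  qed
  ultimately have 1: "(\<lambda>t. 2 / sqrt (m c) * R (m c * sech2 t)) absolutely_integrable_on UNIV"
    "integral UNIV (\<lambda>t. 2 / sqrt (m c) * R (m c * sech2 t)) = integral UNIV ?f" by auto
  have Rc: "continuous_on UNIV (\<lambda>t. R (m c * sech2 t))"
    using R_DERIV DERIV_isCont mult_sech2_mem[OF m_mem[OF c]]
    by (intro continuous_on_compose2[OF continuous_at_imp_continuous_on[of "{0<..<w}" R]] continuous_intros)
      (auto, blast)
  have Ri: "integrable lborel (\<lambda>t. 2 / sqrt (m c) * R (m c * sech2 t))"
    using 1(1) borel_measurable_continuous_onI[OF Rc] by (simp add: set_integrable_def integrable_completion)
  have fR: "(LINT t|lborel. 2 / sqrt (m c) * R (m c * sech2 t)) = (LINT x|lborel. ?f x)"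
    using 1(2) unfolding integral_lborel[OF Ri] integral_lborel[OF int] .
  have "(\<lambda>x. eta c x * V 0 c x) = (\<lambda>x. c / 2 * ?f x)"
    by (simp add: V_def fun_eq_iff power2_eq_square)
  then have fV: "(LINT x|lborel. eta c x * V 0 c x) = c / 2 * (LINT x|lborel. ?f x)"
    by (simp only: integral_mult_right_zero)
  show ?thesis
    unfolding momentum_def fV fR[symmetric] integral_mult_right_zero by simp
qed

text \<open>Two factors compete. The prefactor \<open>c / (2 \<surd>m)\<close> has logarithmic
  derivative \<open>1/c + c/m\<close>; that of the integral is \<open>- (2 c / m) Q / P\<close>, at
  most \<open>- 3 c / m\<close> because \<open>Q \<ge> (3/2) P\<close>. The sum is at most
  \<open>1/c - 2 c / m\<close>, negative as soon as \<open>m < 2 c\<^sup>2\<close>, that is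
  \<open>cs\<^sup>2 < 3 c\<^sup>2\<close>.\<close>

lemma momentum_decreasing:
  assumes q: "\<And>y. y \<in> {0<..<w} \<Longrightarrow> 7/8 \<le> q y \<and> \<bar>y * q' y\<bar> \<le> 1/16"
    and cs: "cs^2 \<le> 3 * c0^2" and c: "c \<in> I"
  shows "\<exists>D. ((\<lambda>c. momentum (eta c) (V 0 c)) has_real_derivative D) (at c) \<and> D < 0"
proof -
  define M where "M = 2 * C / (1 - \<delta>) * (5 + 2 / (1 - \<delta>))"
  have M: "0 \<le> M" "2 * C / (1 - \<delta>) \<le> M"
  proof -
    have "0 \<le> 2 * C / (1 - \<delta>)" using C \<delta> by simp
    moreover have "1 \<le> 5 + 2 / (1 - \<delta>)" using \<delta> by (simp add: add_increasing2)
    ultimately show "0 \<le> M" "2 * C / (1 - \<delta>) \<le> M"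
      unfolding M_def using mult_left_mono[of 1 "5 + 2 / (1 - \<delta>)" "2 * C / (1 - \<delta>)"] by auto
  qed
  define u where "u c t = R (m c * sech2 t)" for c t
  define u' where "u' c t = \<theta>R (m c * sech2 t) / m c * (- (2 * c))" for c t
  have y: "m c * sech2 t \<in> {0<..<w}" if "c \<in> I" for c t by (rule mult_sech2_mem[OF m_mem[OF that]])
  have ub: "0 < u c t" "\<bar>u c t\<bar> \<le> M * (m c * sech2 t)" if "c \<in> I" for c t
  proof -
    note b = R_bounds[OF y[OF that], of t] 
    show "0 < u c t" unfolding u_def using b(1) q[OF y[OF that]] by blast
    moreover have "u c t \<le> (2 * C / (1 - \<delta>)) * (m c * sech2 t)"
      unfolding u_def using b(2) q[OF y[OF that]] by blast
    moreover have "(2 * C / (1 - \<delta>)) * (m c * sech2 t) \<le> M * (m c * sech2 t)"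
      using M(2) y[OF that, of t] by (intro mult_right_mono) auto
    ultimately show "\<bar>u c t\<bar> \<le> M * (m c * sech2 t)" by auto
  qed
  have tb: "\<bar>\<theta>R (m c * sech2 t)\<bar> \<le> M * (m c * sech2 t)" "3/2 * u c t \<le> \<theta>R (m c * sech2 t)" if "c \<in> I" for c t
    unfolding M_def u_def using R_bounds(3,4)[OF y[OF that], of t] q[OF y[OF that]] by blast+
  have \<theta>c: "continuous_on {0<..<w} \<theta>R"
  proof -
    have "continuous_on {0<..<w} R" "continuous_on {0<..<w} h"
      using R_DERIV h_deriv DERIV_isCont by (blast intro: continuous_at_imp_continuous_on)+
    moreover have "q y \<noteq> 0" "1 - h y \<noteq> 0" if "y \<in> {0<..<w}" for y
      using h_mem[OF that] \<delta> q_bounds[OF that] by auto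
    ultimately show ?thesis unfolding \<theta>R_def
      by (intro continuous_on_mult continuous_on_add continuous_on_divide \<theta>q_cont q_cont
          continuous_on_diff continuous_on_const) auto
  qed
  have \<theta>t: "continuous_on UNIV (\<lambda>t. \<theta>R (m c * sech2 t))" if "c \<in> I" for c
    using y[OF that] by (intro continuous_on_compose2[OF \<theta>c] continuous_intros) auto
  have Rt: "continuous_on UNIV (u c)" if "c \<in> I" for c
  proof -
    have "continuous_on {0<..<w} R"
      using R_DERIV DERIV_isCont by (blast intro: continuous_at_imp_continuous_on)
    then show ?thesis unfolding u_def
      by (rule continuous_on_compose2) (use y[OF that] in \<open>auto intro!: continuous_intros\<close>)
  qed
  \<comment> \<open>After the substitution the majorant is a multiple of \<open>sech2\<close>, whose
    rate \<open>2\<close> does not depend on \<open>c\<close>.\<close>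
  have dec: "decaying I g" if cont: "\<And>c. c \<in> I \<Longrightarrow> continuous_on UNIV (g c)"
    and K: "0 \<le> K" and b: "\<And>c t. c \<in> I \<Longrightarrow> \<bar>g c t\<bar> \<le> K * sech2 t" for g K
    unfolding decaying_def
  proof (intro conjI ballI cont)
    fix c assume c: "c \<in> I"
    obtain r where r: "0 < r" "ball c r \<subseteq> I" using open_I c by (meson open_contains_ball)
    have "c' \<in> I \<and> (\<forall>x. \<bar>g c' x\<bar> \<le> 4 * K * exp (- 2 * \<bar>x\<bar>))" if "\<bar>c' - c\<bar> < r" for c'
    proof -
      have c': "c' \<in> I" using r(2) that by (auto simp: dist_real_def abs_minus_commute subset_iff)
      moreover have "K * sech2 x \<le> 4 * K * exp (- 2 * \<bar>x\<bar>)" for x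
        using mult_left_mono[OF sech2_le_exp[of x] K] by simp
      ultimately show ?thesis using b[OF c'] order_trans by blast
    qed
    then show "\<exists>r>0. \<exists>K a. 0 < a \<and> 0 \<le> K \<and>
        (\<forall>c'. \<bar>c' - c\<bar> < r \<longrightarrow> c' \<in> I \<and> (\<forall>x. \<bar>g c' x\<bar> \<le> K * exp (- a * \<bar>x\<bar>)))"
      using r(1) K by (intro exI[of _ r] conjI exI[of _ "4 * K"] exI[of _ 2]) auto
  qed
  have decu: "decaying I u"
  proof (rule dec[where K = "M * w", OF Rt])
    show "\<bar>u c t\<bar> \<le> M * w * sech2 t" if "c \<in> I" for c t
    proof -
      have "M * (m c * sech2 t) \<le> M * (w * sech2 t)"
        using M(1) m_mem[OF that] sech2_bounds[of t] by (intro mult_left_mono mult_right_mono) auto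
      then show ?thesis using ub(2)[OF that, of t] by (simp add: mult.assoc)
    qed
  qed (use M(1) w_pos in auto)
  have dect: "decaying I (\<lambda>c t. \<theta>R (m c * sech2 t))"
  proof (rule dec[where K = "M * w", OF \<theta>t])
    show "\<bar>\<theta>R (m c * sech2 t)\<bar> \<le> M * w * sech2 t" if "c \<in> I" for c t
    proof -
      have "M * (m c * sech2 t) \<le> M * (w * sech2 t)"
        using M(1) m_mem[OF that] sech2_bounds[of t] by (intro mult_left_mono mult_right_mono) auto
      then show ?thesis using tb(1)[OF that, of t] by (simp add: mult.assoc)
    qed
  qed (use M(1) w_pos in auto)
  have decu': "decaying I u'"
  proof (rule dec[where K = "M * (2 * cs)"])
    show "continuous_on UNIV (u' c)" if "c \<in> I" for c
      unfolding u'_def using m_pos[OF that] by (intro continuous_intros \<theta>t[OF that]) auto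
    show "\<bar>u' c t\<bar> \<le> M * (2 * cs) * sech2 t" if c: "c \<in> I" for c t
    proof -
      have "\<bar>\<theta>R (m c * sech2 t) / m c\<bar> \<le> M * sech2 t"
        using tb(1)[OF c, of t] m_pos[OF c] by (simp add: abs_divide divide_le_eq mult_ac)
      moreover have "\<bar>- (2 * c)\<bar> \<le> 2 * cs" using c_pos[OF c] c_less[OF c] by auto
      ultimately have "\<bar>\<theta>R (m c * sech2 t) / m c\<bar> * \<bar>- (2 * c)\<bar> \<le> (M * sech2 t) * (2 * cs)"
        using M(1) sech2_bounds[of t] by (intro mult_mono) auto
      then show ?thesis unfolding u'_def abs_mult by (simp add: mult_ac)
    qed
  qed (use M(1) c0 in auto)
  have fam: "deriv_family I u u'"
    unfolding deriv_family_def
  proof (intro conjI decu decu' ballI allI)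
    fix c t assume c: "c \<in> I"
    have ne: "sech2 t \<noteq> 0" using sech2_bounds[of t] by simp
    have "((\<lambda>c. m c * sech2 t) has_real_derivative - (2 * c) * sech2 t) (at c)"
      by (intro DERIV_cmult_right m_DERIV)
    from DERIV_chain2[where f = R, OF R_DERIV[OF y[OF c, of t]] this]
    show "((\<lambda>c. u c t) has_real_derivative u' c t) (at c)"
      unfolding u_def u'_def by (rule DERIV_cong) (use ne in simp)
  qed
  define P where "P = (LINT t|lborel. u c t)"
  define Q where "Q = (LINT t|lborel. \<theta>R (m c * sech2 t))"
  have dP: "((\<lambda>c. LINT t|lborel. u c t) has_real_derivative Q / m c * (- (2 * c))) (at c)"
    using deriv_family_integral[OF fam c] unfolding u'_def Q_def by simp
  have iu: "integrable lborel (u c)" and it: "integrable lborel (\<lambda>t. \<theta>R (m c * sech2 t))"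
    using decaying_integrable[OF decu c] decaying_integrable[OF dect c] by auto
  have PQ: "3/2 * P \<le> Q"
  proof -
    have "(LINT t|lborel. 3/2 * u c t) \<le> Q" unfolding Q_def
      by (rule integral_mono[OF _ it]) (use iu tb(2)[OF c] in auto)
    then show ?thesis by (simp add: P_def)
  qed
  have P0: "0 < P"
  proof -
    have "0 \<le> P" unfolding P_def using ub(1)[OF c] by (intro integral_nonneg_AE) (auto simp: less_imp_le)
    moreover have "P \<noteq> 0"
    proof
      assume "P = 0"
      then have "AE t in lborel. u c t = 0"
        using integral_nonneg_eq_0_iff_AE[OF iu] ub(1)[OF c] by (auto simp: P_def less_imp_le)
      moreover have "u c t \<noteq> 0" for t using ub(1)[OF c, of t] by simp
      \<comment> \<open>\<open>u c\<close> is positive everywhere, so if it vanished almost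
        everywhere the whole line would be a null set.\<close>
      ultimately have "ae_filter lborel = (bot :: real filter)" by (simp add: trivial_limit_def)
      then show False by (simp add: ae_filter_eq_bot_iff)
    qed
    ultimately show ?thesis by simp
  qed
  define r where "r = sqrt (m c)"
  have r: "0 < r" "r * r = m c" using m_pos[OF c] by (auto simp: r_def)
  have d1: "((\<lambda>c. c / (2 * sqrt (m c))) has_real_derivative
      (1 * (2 * sqrt (m c)) - c * (2 * (- c / sqrt (m c)))) / ((2 * sqrt (m c)) * (2 * sqrt (m c)))) (at c)"
    using m_pos[OF c] by (intro DERIV_divide DERIV_ident DERIV_cmult sqrt_m_DERIV[OF c]) auto
  let ?D = "(1 * (2 * r) - c * (2 * (- c / r))) / ((2 * r) * (2 * r)) * P + Q / m c * (- (2 * c)) * (c / (2 * r))"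
  have "((\<lambda>c. c / (2 * sqrt (m c)) * (LINT t|lborel. u c t)) has_real_derivative ?D) (at c)"
    using DERIV_mult[OF d1 dP] by (simp add: r_def P_def)
  then have "((\<lambda>c. momentum (eta c) (V 0 c)) has_real_derivative ?D) (at c)"
    by (rule has_field_derivative_transform_within_open[OF _ open_I c])
      (simp add: momentum_eq u_def)
  moreover have "?D < 0"
  proof -
    have "?D = ((r * r + c^2) * P - 2 * c^2 * Q) / (2 * r * (r * r))"
      unfolding r(2)[symmetric] using r(1) by (simp add: field_simps power2_eq_square)
    moreover have "(r * r + c^2) * P - 2 * c^2 * Q < 0"
    proof -
      have "2 * c^2 * (3/2 * P) \<le> 2 * c^2 * Q" using PQ by (intro mult_left_mono) auto
      moreover have "c0^2 < c^2" using c c0 by (auto simp: I_def intro!: power_strict_mono)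
      then have "r * r + c^2 < 3 * c^2" using cs r(2) by (simp add: m_def)
      then have "(r * r + c^2) * P < (3 * c^2) * P" using P0 by (intro mult_strict_right_mono)
      moreover have "2 * c^2 * (3/2 * P) = (3 * c^2) * P" by simp
      ultimately show ?thesis by linarith
    qed
    ultimately show ?thesis using r(1) by (simp add: divide_neg_pos)
  qed
  ultimately show ?thesis by blast
qed

end

section \<open>The nonlinearity\<close>

locale pressure =
  fixes f f1 f2 f3 :: "real \<Rightarrow> real" and cs :: real
  assumes f_d1: "\<forall>x\<ge>0. (f has_real_derivative f1 x) (at x within {0..})"
      and f_d2: "\<forall>x\<ge>0. (f1 has_real_derivative f2 x) (at x within {0..})"
      and f_d3: "\<forall>x\<ge>0. (f2 has_real_derivative f3 x) (at x within {0..})"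
      and f_C3: "continuous_on {0..} f3"
      and f1_zero: "f 1 = 0"
      and f1_neg: "f1 1 < 0"
      and cs_def: "cs = sqrt (- 2 * f1 1)"
      and H1: "\<forall>\<rho>\<ge>0. cs^2 / 4 * (1 - \<rho>)^2 \<le> Fpot f \<rho>"
begin

lemma cs_pos: "0 < cs" and cs_sq: "cs^2 = - 2 * f1 1"
  using f1_neg by (auto simp: cs_def)

lemma f_derivs:
  assumes "0 < x"
  shows "(f has_real_derivative f1 x) (at x)" "(f1 has_real_derivative f2 x) (at x)"
    "(f2 has_real_derivative f3 x) (at x)"
proof -
  have "x \<in> interior {0..}" using assms by simp
  then have "at x within {0..} = at x" by (rule at_within_interior)
  then show "(f has_real_derivative f1 x) (at x)" "(f1 has_real_derivative f2 x) (at x)"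
    "(f2 has_real_derivative f3 x) (at x)"
    using f_d1 f_d2 f_d3 assms by (metis less_imp_le)+
qed

lemma Fpot_1: "Fpot f 1 = 0"
  by (simp add: Fpot_def one_ereal_def)

lemma Fpot_DERIV:
  assumes "0 < x"
  shows "(Fpot f has_real_derivative - f x) (at x)"
proof -
  have fc: "continuous_on {0..x+1} f"
  proof (rule continuous_on_subset)
    show "continuous_on {0..} f"
      unfolding continuous_on_eq_continuous_within using f_d1 DERIV_continuous by fastforce
  qed auto
  have "((\<lambda>u. LBINT y=(1::real)..u. f y) has_vector_derivative f x) (at x within {0..x+1})"
    by (rule interval_integral_FTC2[OF _ _ fc]) (use assms in auto)
  moreover have "x \<in> interior {0..x+1}" using assms by simp
  then have "at x within {0..x+1} = at x" by (rule at_within_interior)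
  ultimately have "((\<lambda>u. LBINT y=(1::real)..u. f y) has_real_derivative f x) (at x)"
    by (simp add: has_real_derivative_iff_has_vector_derivative)
  from DERIV_minus[OF this] show ?thesis
    unfolding Fpot_def[abs_def] by (subst interval_integral_endpoints_reverse) (simp add: one_ereal_def)
qed

definition N :: "real \<Rightarrow> real" where "N e = cs^2 * e^2 - 4 * (1 - e) * Fpot f (1 - e)"
definition N1 :: "real \<Rightarrow> real" where "N1 e = 2 * cs^2 * e + 4 * Fpot f (1 - e) - 4 * (1 - e) * f (1 - e)"
definition N2 :: "real \<Rightarrow> real" where "N2 e = 2 * cs^2 + 8 * f (1 - e) + 4 * (1 - e) * f1 (1 - e)"
definition N3 :: "real \<Rightarrow> real" where "N3 e = - 12 * f1 (1 - e) - 4 * (1 - e) * f2 (1 - e)"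
definition N4 :: "real \<Rightarrow> real" where "N4 e = 16 * f2 (1 - e) + 4 * (1 - e) * f3 (1 - e)"

lemma N_derivs:
  assumes "e < 1"
  shows "(N has_real_derivative N1 e) (at e)" "(N1 has_real_derivative N2 e) (at e)"
    "(N2 has_real_derivative N3 e) (at e)" "(N3 has_real_derivative N4 e) (at e)"
proof -
  have i: "((\<lambda>e. 1 - e) has_real_derivative - 1) (at e)" by (auto intro!: derivative_eq_intros)
  have p: "0 < 1 - e" using assms by simp
  note F = DERIV_chain2[where g = "\<lambda>e. 1 - e", OF Fpot_DERIV[OF p] i]
    and d0 = DERIV_chain2[where g = "\<lambda>e. 1 - e", OF f_derivs(1)[OF p] i]
    and d1 = DERIV_chain2[where g = "\<lambda>e. 1 - e", OF f_derivs(2)[OF p] i]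
    and d2 = DERIV_chain2[where g = "\<lambda>e. 1 - e", OF f_derivs(3)[OF p] i]
  show "(N has_real_derivative N1 e) (at e)"
    unfolding N_def[abs_def] by (rule derivative_eq_intros F refl | simp add: N1_def algebra_simps)+
  show "(N1 has_real_derivative N2 e) (at e)"
    unfolding N1_def[abs_def] by (rule derivative_eq_intros F d0 refl | simp add: N2_def algebra_simps)+
  show "(N2 has_real_derivative N3 e) (at e)"
    unfolding N2_def[abs_def] by (rule derivative_eq_intros d0 d1 refl | simp add: N3_def algebra_simps)+
  show "(N3 has_real_derivative N4 e) (at e)"
    unfolding N3_def[abs_def] by (rule derivative_eq_intros d1 d2 refl | simp add: N4_def algebra_simps)+
qed

text \<open>The speed \<open>cs\<close> is exactly the value for which the quadratic terms of
  \<open>N\<close> cancel.\<close>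

lemma N_0: "N 0 = 0" "N1 0 = 0" "N2 0 = 0"
  by (auto simp: N_def N1_def N2_def Fpot_1 f1_zero cs_sq)

text \<open>This is (H1) at the density \<open>1 - e\<close>, multiplied by
  \<open>4 (1 - e) > 0\<close>.\<close>

lemma N_le:
  assumes "e < 1"
  shows "N e \<le> cs^2 * e^3"
proof -
  have "4 * (1 - e) * (cs^2 / 4 * (1 - (1 - e))^2) \<le> 4 * (1 - e) * Fpot f (1 - e)"
    using H1[rule_format, of "1 - e"] assms by (intro mult_left_mono) auto
  moreover have "4 * (1 - e) * (cs^2 / 4 * (1 - (1 - e))^2) = cs^2 * e^2 - cs^2 * e^3"
    by (simp add: left_diff_distrib power2_eq_square power3_eq_cube)
  ultimately show ?thesis by (simp add: N_def)
qed

section \<open>Asymptotics of the nonlinearity at the density \<open>1\<close>\<close>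

lemma N_limits_aux:
  "((\<lambda>e. N2 e / e) \<longlongrightarrow> N3 0) (at 0)" "((\<lambda>e. N1 e / e^2) \<longlongrightarrow> N3 0 / 2) (at 0)"
  "((\<lambda>e. N e / e^3) \<longlongrightarrow> N3 0 / 6) (at 0)"
proof -
  have ev: "\<forall>\<^sub>F e in at 0. e \<noteq> 0 \<and> e < (1::real)"
    using eventually_abs_less_at_0[OF zero_less_one] by eventually_elim auto
  have c0: "(g \<longlongrightarrow> 0) (at 0)" if "(g has_real_derivative d) (at 0)" "g 0 = 0" for g :: "real \<Rightarrow> real" and d
    using DERIV_isCont[OF that(1)] that(2) by (simp add: isCont_def)
  show 1: "((\<lambda>e. N2 e / e) \<longlongrightarrow> N3 0) (at 0)"
    using N_derivs(3)[of 0] N_0 by (simp add: has_field_derivative_iff)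
  show 2: "((\<lambda>e. N1 e / e^2) \<longlongrightarrow> N3 0 / 2) (at 0)"
  proof (rule lhopital[where f' = N2 and g' = "\<lambda>e. 2 * e"])
    show "(N1 \<longlongrightarrow> 0) (at 0)" using c0[OF N_derivs(2)] N_0 by simp
    have "((\<lambda>e. N2 e / e / 2) \<longlongrightarrow> N3 0 / 2) (at 0)" by (intro tendsto_intros 1) auto
    then show "((\<lambda>e. N2 e / (2 * e)) \<longlongrightarrow> N3 0 / 2) (at 0)" by (simp add: mult.commute)
    show "\<forall>\<^sub>F x in at 0. (N1 has_real_derivative N2 x) (at x)"
      using ev by eventually_elim (use N_derivs in auto)
  qed (use ev in \<open>auto intro!: tendsto_eq_intros derivative_eq_intros elim: eventually_mono\<close>)
  show "((\<lambda>e. N e / e^3) \<longlongrightarrow> N3 0 / 6) (at 0)"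
  proof (rule lhopital[where f' = N1 and g' = "\<lambda>e. 3 * e^2"])
    show "(N \<longlongrightarrow> 0) (at 0)" using c0[OF N_derivs(1)] N_0 by simp
    have "((\<lambda>e. N1 e / e^2 / 3) \<longlongrightarrow> N3 0 / 2 / 3) (at 0)" by (intro tendsto_intros 2) auto
    then show "((\<lambda>e. N1 e / (3 * e^2)) \<longlongrightarrow> N3 0 / 6) (at 0)" by (simp add: mult.commute)
    show "\<forall>\<^sub>F x in at 0. (N has_real_derivative N1 x) (at x)"
      using ev by eventually_elim (use N_derivs in auto)
  qed (use ev in \<open>auto intro!: tendsto_eq_intros derivative_eq_intros elim: eventually_mono\<close>)
qed

text \<open>The bound (H1) is one-sided on either side of the density \<open>1\<close>, which forces \<open>f2 1 = 0\<close>.\<close>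

lemma N3_0: "N3 0 = 6 * cs^2"
proof (rule antisym)
  have lim: "((\<lambda>e. N e / e^3) \<longlongrightarrow> N3 0 / 6) (at_right 0)" "((\<lambda>e. N e / e^3) \<longlongrightarrow> N3 0 / 6) (at_left 0)"
    using N_limits_aux(3) by (auto intro: tendsto_within_subset)
  have "\<forall>\<^sub>F e in at_right (0::real). N e / e^3 \<le> cs^2"
  proof -
    have "\<forall>\<^sub>F e in at_right (0::real). e \<in> {0<..<1}" by (rule eventually_at_right_real) simp
    then show ?thesis
      by eventually_elim (use N_le in \<open>auto simp: divide_le_eq\<close>)
  qed
  then have "N3 0 / 6 \<le> cs^2" by (rule tendsto_upperbound[OF lim(1)]) simp
  then show "N3 0 \<le> 6 * cs^2" by simp
  have "\<forall>\<^sub>F e in at_left (0::real). e \<in> {-1<..<0}" by (rule eventually_at_left_real) simp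
  then have "\<forall>\<^sub>F e in at_left (0::real). cs^2 \<le> N e / e^3"
  proof eventually_elim
    case (elim e)
    have "e^3 < 0" using elim by (simp add: power_less_zero_eq)
    then show ?case using N_le[of e] elim by (simp add: le_divide_eq)
  qed
  then have "cs^2 \<le> N3 0 / 6" by (rule tendsto_lowerbound[OF lim(2)]) simp
  then show "6 * cs^2 \<le> N3 0" by simp
qed

text \<open>This is \<open>e\<^sup>3\<close> times the derivative of
  \<open>N(e) / e\<^sup>2\<close>, so its positivity is the monotonicity of the function to be
  inverted.\<close>

definition Dn :: "real \<Rightarrow> real" where "Dn e = e * N1 e - 2 * N e"
text \<open>With \<open>\<omega>(e) = N(e) / e\<^sup>2\<close> this is
  \<open>\<omega> / (e \<omega>')\<close>, that is, the logarithmic derivative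
  \<open>y h'(y) / h(y)\<close> written in the variable \<open>e = h(y)\<close>. In this form it can
  be studied before the inverse is available.\<close>

definition qt :: "real \<Rightarrow> real" where "qt e = N e / Dn e"
definition qt' :: "real \<Rightarrow> real" where "qt' e = (N1 e * Dn e - N e * (e * N2 e - N1 e)) / (Dn e * Dn e)"

text \<open>Apart from the one for \<open>N4\<close>, the limits are the values for the model
  \<open>cs\<^sup>2 e\<^sup>3\<close>, because only the leading term of \<open>N\<close>
  contributes.\<close>

lemma limits:
  shows "((\<lambda>e. N e / e^3) \<longlongrightarrow> cs^2) (at_right 0)" "((\<lambda>e. N1 e / e^2) \<longlongrightarrow> 3 * cs^2) (at_right 0)"
    "((\<lambda>e. N2 e / e) \<longlongrightarrow> 6 * cs^2) (at_right 0)" "(N3 \<longlongrightarrow> 6 * cs^2) (at_right 0)"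
    "(N4 \<longlongrightarrow> N4 0) (at_right 0)" "((\<lambda>e. Dn e / e^3) \<longlongrightarrow> cs^2) (at_right 0)"
    "(qt \<longlongrightarrow> 1) (at_right 0)" "((\<lambda>e. e * qt' e) \<longlongrightarrow> 0) (at_right 0)"
proof -
  have ev: "\<forall>\<^sub>F e in at_right (0::real). e \<in> {0<..<1}" by (rule eventually_at_right_real) simp
  show 1: "((\<lambda>e. N e / e^3) \<longlongrightarrow> cs^2) (at_right 0)"
    and 2: "((\<lambda>e. N1 e / e^2) \<longlongrightarrow> 3 * cs^2) (at_right 0)"
    and 3: "((\<lambda>e. N2 e / e) \<longlongrightarrow> 6 * cs^2) (at_right 0)"
    using N_limits_aux[unfolded N3_0] by (auto intro: tendsto_within_subset)
  have "(N3 \<longlongrightarrow> N3 0) (at 0)" using DERIV_isCont[OF N_derivs(4)[of 0]] by (simp add: isCont_def)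
  then show "(N3 \<longlongrightarrow> 6 * cs^2) (at_right 0)" unfolding N3_0 by (rule tendsto_within_subset) auto
  have "isCont f2 1" "isCont f3 1"
    using DERIV_isCont[OF f_derivs(3)[of 1]] f_C3
    by (auto intro!: continuous_on_interior[of "{0..}"])
  moreover have "isCont (\<lambda>e::real. 1 - e) 0" by (intro continuous_intros)
  ultimately have "isCont (\<lambda>e. f2 (1 - e)) 0" "isCont (\<lambda>e. f3 (1 - e)) 0"
    using isCont_o2[of 0 "\<lambda>e. 1 - e" f2] isCont_o2[of 0 "\<lambda>e. 1 - e" f3] by auto
  then have "isCont N4 0" unfolding N4_def by (intro continuous_intros)
  then have "(N4 \<longlongrightarrow> N4 0) (at 0)" by (simp add: isCont_def)
  then show "(N4 \<longlongrightarrow> N4 0) (at_right 0)" by (rule tendsto_within_subset) auto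
  have "((\<lambda>e. N1 e / e^2 - 2 * (N e / e^3)) \<longlongrightarrow> 3 * cs^2 - 2 * cs^2) (at_right 0)"
    by (intro tendsto_intros 1 2)
  moreover have "\<forall>\<^sub>F e in at_right 0. N1 e / e^2 - 2 * (N e / e^3) = Dn e / e^3"
    using ev by eventually_elim (simp add: Dn_def field_simps power2_eq_square power3_eq_cube)
  ultimately show 6: "((\<lambda>e. Dn e / e^3) \<longlongrightarrow> cs^2) (at_right 0)"
    using Lim_transform_eventually by fastforce
  have c2: "cs^2 \<noteq> 0" using cs_pos by simp
  have "((\<lambda>e. (N e / e^3) / (Dn e / e^3)) \<longlongrightarrow> cs^2 / cs^2) (at_right 0)"
    by (intro tendsto_divide 1 6 c2)
  moreover have "\<forall>\<^sub>F e in at_right 0. (N e / e^3) / (Dn e / e^3) = qt e"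
    using ev by eventually_elim (simp add: qt_def)
  ultimately show "(qt \<longlongrightarrow> 1) (at_right 0)"
    using Lim_transform_eventually c2 by fastforce
  have lim: "((\<lambda>e. ((N1 e / e^2) * (Dn e / e^3) - (N e / e^3) * (N2 e / e - N1 e / e^2)) / ((Dn e / e^3) * (Dn e / e^3)))
      \<longlongrightarrow> ((3 * cs^2) * cs^2 - cs^2 * (6 * cs^2 - 3 * cs^2)) / (cs^2 * cs^2)) (at_right 0)"
    by (intro tendsto_divide tendsto_mult tendsto_diff 1 2 3 6) (use c2 in auto)
  \<comment> \<open>The leading coefficients cancel because \<open>qt\<close> is constant for the
    model.\<close>
  have z: "((3 * cs^2) * cs^2 - cs^2 * (6 * cs^2 - 3 * cs^2)) / (cs^2 * cs^2) = 0" by simp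
  have "\<forall>\<^sub>F e in at_right 0.
      ((N1 e / e^2) * (Dn e / e^3) - (N e / e^3) * (N2 e / e - N1 e / e^2)) / ((Dn e / e^3) * (Dn e / e^3)) = e * qt' e"
    using ev
  proof eventually_elim
    case (elim e)
    then have e: "e \<noteq> 0" by auto
    have "((N1 e / e^2) * (Dn e / e^3) - (N e / e^3) * (N2 e / e - N1 e / e^2))
        = (N1 e * Dn e - N e * (e * N2 e - N1 e)) / e^5"
      using e by (simp add: field_simps eval_nat_numeral)
    moreover have "(Dn e / e^3) * (Dn e / e^3) = (Dn e * Dn e) / e^6"
      by (simp add: eval_nat_numeral)
    ultimately show ?case using e by (simp add: qt'_def eval_nat_numeral)
  qed
  then show "((\<lambda>e. e * qt' e) \<longlongrightarrow> 0) (at_right 0)"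
    by (rule Lim_transform_eventually[OF lim[unfolded z]])
qed

text \<open>All limits are turned into bounds on one interval. The constants \<open>7/8\<close> and
  \<open>1/32\<close> are prepared for the momentum: \<open>1/32\<close> becomes the bound
  \<open>1/16\<close> on \<open>y q'\<close> after multiplication by
  \<open>q \<le> 2\<close>.\<close>

lemma small_interval:
  obtains \<delta> K where "0 < \<delta>" "\<delta> < 1" "0 \<le> K"
    "\<And>e. e \<in> {0<..\<delta>} \<Longrightarrow> cs^2 / 2 * e^3 \<le> Dn e"
    "\<And>e. e \<in> {0<..\<delta>} \<Longrightarrow> cs^2 / 2 * e^3 \<le> N e \<and> N e \<le> K * e^3"
    "\<And>e. e \<in> {0<..\<delta>} \<Longrightarrow> \<bar>N1 e\<bar> \<le> K * e^2 \<and> \<bar>N2 e\<bar> \<le> K * e \<and> \<bar>N3 e\<bar> \<le> K \<and> \<bar>N4 e\<bar> \<le> K"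
    "\<And>e. e \<in> {0<..\<delta>} \<Longrightarrow> 7/8 \<le> qt e \<and> qt e \<le> 2 \<and> \<bar>e * qt' e\<bar> \<le> 1/32"
proof -
  define a where "a = cs^2"
  have a: "0 < a" using cs_pos by (simp add: a_def)
  \<comment> \<open>\<open>7 a\<close> dominates the bounds \<open>2 a\<close>, \<open>4 a\<close>
    and \<open>7 a\<close> below, and \<open>|N4 0| + 1\<close> the one for
    \<open>N4\<close>.\<close>
  define K where "K = 7 * a + \<bar>N4 0\<bar> + 1"
  have "\<forall>\<^sub>F e in at_right 0. a / 2 < N e / e^3" "\<forall>\<^sub>F e in at_right 0. N e / e^3 < 2 * a"
    "\<forall>\<^sub>F e in at_right 0. a / 2 < Dn e / e^3"
    "\<forall>\<^sub>F e in at_right 0. - a < N1 e / e^2" "\<forall>\<^sub>F e in at_right 0. N1 e / e^2 < 4 * a"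
    "\<forall>\<^sub>F e in at_right 0. - a < N2 e / e" "\<forall>\<^sub>F e in at_right 0. N2 e / e < 7 * a"
    "\<forall>\<^sub>F e in at_right 0. - a < N3 e" "\<forall>\<^sub>F e in at_right 0. N3 e < 7 * a"
    "\<forall>\<^sub>F e in at_right 0. N4 0 - 1 < N4 e" "\<forall>\<^sub>F e in at_right 0. N4 e < N4 0 + 1"
    "\<forall>\<^sub>F e in at_right 0. 7/8 < qt e" "\<forall>\<^sub>F e in at_right 0. qt e < 2"
    "\<forall>\<^sub>F e in at_right 0. - (1/32) < e * qt' e" "\<forall>\<^sub>F e in at_right 0. e * qt' e < 1/32"
    by ((rule order_tendstoD(1)[OF limits(1)[folded a_def]] order_tendstoD(2)[OF limits(1)[folded a_def]]
        order_tendstoD(1)[OF limits(2)[folded a_def]] order_tendstoD(2)[OF limits(2)[folded a_def]]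
        order_tendstoD(1)[OF limits(3)[folded a_def]] order_tendstoD(2)[OF limits(3)[folded a_def]]
        order_tendstoD(1)[OF limits(4)[folded a_def]] order_tendstoD(2)[OF limits(4)[folded a_def]]
        order_tendstoD(1)[OF limits(5)] order_tendstoD(2)[OF limits(5)]
        order_tendstoD(1)[OF limits(6)[folded a_def]]
        order_tendstoD(1)[OF limits(7)] order_tendstoD(2)[OF limits(7)]
        order_tendstoD(1)[OF limits(8)] order_tendstoD(2)[OF limits(8)]), (use a in simp))+
  then have "\<forall>\<^sub>F e in at_right 0. a / 2 < N e / e^3 \<and> N e / e^3 < 2 * a \<and> a / 2 < Dn e / e^3 \<and>
      \<bar>N1 e / e^2\<bar> \<le> K \<and> \<bar>N2 e / e\<bar> \<le> K \<and> \<bar>N3 e\<bar> \<le> K \<and> \<bar>N4 e\<bar> \<le> K \<and> 7/8 \<le> qt e \<and> qt e \<le> 2 \<and> \<bar>e * qt' e\<bar> \<le> 1/32"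
    by eventually_elim (use a in \<open>auto simp: K_def abs_le_iff\<close>)
  then obtain b where b: "0 < b" "\<And>e. 0 < e \<Longrightarrow> e < b \<Longrightarrow> a / 2 < N e / e^3 \<and> N e / e^3 < 2 * a \<and> a / 2 < Dn e / e^3 \<and>
      \<bar>N1 e / e^2\<bar> \<le> K \<and> \<bar>N2 e / e\<bar> \<le> K \<and> \<bar>N3 e\<bar> \<le> K \<and> \<bar>N4 e\<bar> \<le> K \<and> 7/8 \<le> qt e \<and> qt e \<le> 2 \<and> \<bar>e * qt' e\<bar> \<le> 1/32"
    unfolding eventually_at_right_field by blast
  \<comment> \<open>Half of \<open>b\<close>, so that the closed end point \<open>\<delta>\<close>
    still satisfies the estimates; at most \<open>1/2\<close>, so that the density
    \<open>1 - e\<close> stays away from \<open>0\<close>.\<close>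
  define \<delta> where "\<delta> = min (b / 2) (1/2)"
  have \<delta>: "0 < \<delta>" "\<delta> < 1" "\<delta> < b" using b by (auto simp: \<delta>_def)
  have K: "0 \<le> K" "2 * a \<le> K" using a by (auto simp: K_def)
  show ?thesis
  proof (rule that[OF \<delta>(1,2) K(1)])
    fix e assume "e \<in> {0<..\<delta>}"
    then have e: "0 < e" "e < b" using \<delta> by auto
    note B = b(2)[OF e]
    have e3: "0 < e^3" "0 < e^2" using e by auto
    show "cs^2 / 2 * e^3 \<le> Dn e" using B e3 by (simp add: a_def less_divide_eq less_imp_le)
    have "N e \<le> 2 * a * e^3" using B e3 by (simp add: divide_less_eq less_imp_le)
    also have "\<dots> \<le> K * e^3" using K e3 by (intro mult_right_mono) auto
    finally show "cs^2 / 2 * e^3 \<le> N e \<and> N e \<le> K * e^3" using B e3 by (simp add: a_def less_divide_eq less_imp_le)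
    show "\<bar>N1 e\<bar> \<le> K * e^2 \<and> \<bar>N2 e\<bar> \<le> K * e \<and> \<bar>N3 e\<bar> \<le> K \<and> \<bar>N4 e\<bar> \<le> K"
      using B e by (simp add: abs_divide divide_le_eq)
    show "7/8 \<le> qt e \<and> qt e \<le> 2 \<and> \<bar>e * qt' e\<bar> \<le> 1/32" using B by blast
  qed
qed

end

text \<open>The estimates include the end point \<open>\<delta>\<close>, since \<open>w\<close> is
  the value of \<open>om\<close> there, while the inverse is sought on the open interval below
  it.\<close>

locale small_pressure = pressure +
  fixes \<delta> K :: real
  assumes \<delta>: "0 < \<delta>" "\<delta> < 1" and K: "0 \<le> K"
    and Dn_ge: "e \<in> {0<..\<delta>} \<Longrightarrow> cs^2 / 2 * e^3 \<le> Dn e"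
    and N_bounds: "e \<in> {0<..\<delta>} \<Longrightarrow> cs^2 / 2 * e^3 \<le> N e \<and> N e \<le> K * e^3"
    and N123_bounds: "e \<in> {0<..\<delta>} \<Longrightarrow> \<bar>N1 e\<bar> \<le> K * e^2 \<and> \<bar>N2 e\<bar> \<le> K * e \<and> \<bar>N3 e\<bar> \<le> K \<and> \<bar>N4 e\<bar> \<le> K"
    and qt_bounds: "e \<in> {0<..\<delta>} \<Longrightarrow> 7/8 \<le> qt e \<and> qt e \<le> 2 \<and> \<bar>e * qt' e\<bar> \<le> 1/32"
begin

definition om :: "real \<Rightarrow> real" where "om e = N e / e^2"
definition w :: real where "w = om \<delta>"
definition h :: "real \<Rightarrow> real" where "h y = (THE e. e \<in> {0<..<\<delta>} \<and> om e = y)"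
definition q :: "real \<Rightarrow> real" where "q y = qt (h y)"
definition q' :: "real \<Rightarrow> real" where "q' y = qt' (h y) * (h y * q y / y)"

lemma Dn_pos: "e \<in> {0<..\<delta>} \<Longrightarrow> 0 < Dn e"
  using Dn_ge[of e] cs_pos by (auto intro!: less_le_trans[of 0 "cs^2 / 2 * e^3" "Dn e"])

lemma N_pos: "e \<in> {0<..\<delta>} \<Longrightarrow> 0 < N e"
  using N_bounds[of e] cs_pos by (auto intro!: less_le_trans[of 0 "cs^2 / 2 * e^3" "N e"])

lemma om_DERIV:
  assumes "e \<in> {0<..\<delta>}"
  shows "(om has_real_derivative Dn e / e^3) (at e)"
proof -
  have e: "e \<noteq> 0" "e < 1" using assms \<delta> by auto
  have "((\<lambda>e. N e / e^2) has_real_derivative (N1 e * e^2 - N e * (2 * e)) / (e^2 * e^2)) (at e)"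
    by (intro DERIV_divide N_derivs e) (use e in \<open>auto intro!: derivative_eq_intros\<close>)
  moreover have "(N1 e * e^2 - N e * (2 * e)) / (e^2 * e^2) = Dn e / e^3"
    using e by (simp add: Dn_def field_simps power2_eq_square power3_eq_cube)
  ultimately show ?thesis unfolding om_def[abs_def] by simp
qed

lemma om_less:
  assumes "0 < e" "e < e'" "e' \<le> \<delta>"
  shows "om e < om e'"
proof (rule DERIV_pos_imp_increasing[OF assms(2)])
  fix x assume "e \<le> x" "x \<le> e'"
  then have "x \<in> {0<..\<delta>}" using assms by auto
  then show "\<exists>y. (om has_real_derivative y) (at x) \<and> 0 < y"
    using om_DERIV Dn_pos[of x] by (intro exI[of _ "Dn x / x^3"]) auto
qed

lemma om_bounds:
  assumes "e \<in> {0<..\<delta>}"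
  shows "cs^2 / 2 * e \<le> om e" "om e \<le> K * e"
  using N_bounds[OF assms] assms by (auto simp: om_def field_simps power2_eq_square power3_eq_cube)

lemma w_pos: "0 < w"
  using N_pos[of \<delta>] \<delta> by (simp add: w_def om_def)

lemma om_ex1:
  assumes "y \<in> {0<..<w}"
  shows "\<exists>!e. e \<in> {0<..<\<delta>} \<and> om e = y"
proof -
  \<comment> \<open>Chosen so that \<open>om e0 \<le> K e0 \<le> y / 2\<close>: the intermediate
    value theorem can then be applied between \<open>e0\<close> and \<open>\<delta>\<close>, away
    from the singular point \<open>0\<close>.\<close>
  define e0 where "e0 = min (\<delta> / 2) (y / (2 * (K + 1)))"
  have e0: "0 < e0" "e0 < \<delta>" using \<delta> assms K by (auto simp: e0_def)
  have "K * e0 \<le> (K + 1) * e0" using e0 by (simp add: algebra_simps)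
  also have "\<dots> \<le> (K + 1) * (y / (2 * (K + 1)))" using K by (intro mult_left_mono) (auto simp: e0_def)
  also have "\<dots> = y / 2" using K by (simp add: field_simps)
  finally have "om e0 \<le> y" using om_bounds(2)[of e0] e0 assms by auto
  moreover have "y \<le> om \<delta>" using assms by (auto simp: w_def)
  moreover have "continuous_on {e0..\<delta>} om"
  proof (intro continuous_at_imp_continuous_on ballI)
    fix x assume "x \<in> {e0..\<delta>}"
    then show "isCont om x" using e0 by (intro DERIV_isCont[OF om_DERIV]) auto
  qed
  ultimately obtain e where e: "e0 \<le> e" "e \<le> \<delta>" "om e = y"
    using IVT'[of om e0 y \<delta>] e0 by auto
  have "e \<noteq> \<delta>" using e(3) assms by (auto simp: w_def)
  then have "e \<in> {0<..<\<delta>} \<and> om e = y" using e e0 by auto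
  moreover have "e' = e" if "e' \<in> {0<..<\<delta>} \<and> om e' = y" for e'
    using om_less[of e e'] om_less[of e' e] that e e0 by (cases e e' rule: linorder_cases) auto
  ultimately show ?thesis by blast
qed

lemma h_mem: "y \<in> {0<..<w} \<Longrightarrow> h y \<in> {0<..<\<delta>}" and om_h: "y \<in> {0<..<w} \<Longrightarrow> om (h y) = y"
  unfolding h_def using theI'[OF om_ex1] by blast+

lemma om_mem: "e \<in> {0<..<\<delta>} \<Longrightarrow> om e \<in> {0<..<w}"
  using om_less[of e \<delta>] N_pos[of e] by (auto simp: w_def om_def)

lemma h_om: "e \<in> {0<..<\<delta>} \<Longrightarrow> h (om e) = e"
  unfolding h_def using om_ex1[OF om_mem] by blast

lemma h_mem': "y \<in> {0<..<w} \<Longrightarrow> h y \<in> {0<..\<delta>}"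
  using h_mem by force

lemma N_h:
  assumes "y \<in> {0<..<w}"
  shows "N (h y) = y * (h y)^2"
proof -
  have "h y \<noteq> 0" using h_mem[OF assms] by auto
  then show ?thesis using om_h[OF assms] by (simp add: om_def field_simps)
qed

lemma h_deriv:
  assumes "y \<in> {0<..<w}"
  shows "(h has_real_derivative h y * q y / y) (at y)"
proof -
  have hy: "h y \<in> {0<..\<delta>}" "h y \<noteq> 0" using h_mem'[OF assms] by auto
  have d: "Dn (h y) \<noteq> 0" using Dn_pos[OF hy(1)] by simp
  have "(h has_real_derivative inverse (Dn (h y) / (h y)^3)) (at y)"
    unfolding has_field_derivative_def
  proof (rule has_derivative_inverse_strong_x[where S = "{0<..<\<delta>}"])
    show "(om has_derivative (*) (Dn (h y) / (h y)^3)) (at (h y))"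
      using om_DERIV[OF hy(1)] by (simp add: has_field_derivative_def)
    show "(*) (Dn (h y) / (h y)^3) \<circ> (*) (inverse (Dn (h y) / (h y)^3)) = id"
      using d hy by (auto simp: fun_eq_iff)
    show "continuous_on {0<..<\<delta>} om"
    proof (intro continuous_at_imp_continuous_on ballI)
      fix x assume "x \<in> {0<..<\<delta>}"
      then show "isCont om x" by (intro DERIV_isCont[OF om_DERIV]) auto
    qed
  qed (use d hy h_mem[OF assms] om_h[OF assms] h_om in auto)
  moreover have "inverse (Dn (h y) / (h y)^3) = h y * q y / y"
  proof -
    have "y \<noteq> 0" using assms by auto
    then show ?thesis
      unfolding q_def qt_def N_h[OF assms] using hy d by (simp add: field_simps power2_eq_square power3_eq_cube)
  qed
  ultimately show ?thesis by simp
qed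

text \<open>Solve \<open>q = N / (e N1 - 2 N)\<close> for \<open>e N1\<close> and divide by
  \<open>e = h y\<close>.\<close>

lemma N1_h:
  assumes "y \<in> {0<..<w}"
  shows "N1 (h y) = y * h y * (2 + 1 / q y)"
proof -
  have hy: "h y \<in> {0<..\<delta>}" "h y \<noteq> 0" using h_mem'[OF assms] by auto
  have "N (h y) \<noteq> 0" "Dn (h y) \<noteq> 0" using N_pos[OF hy(1)] Dn_pos[OF hy(1)] by auto
  then have "N (h y) * (2 + 1 / q y) = h y * N1 (h y)"
    by (simp add: q_def qt_def Dn_def field_simps)
  then show ?thesis unfolding N_h[OF assms] using hy(2) by (simp add: power2_eq_square)
qed

lemma qt_DERIV:
  assumes "e \<in> {0<..<\<delta>}"
  shows "(qt has_real_derivative qt' e) (at e)"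
proof -
  have e: "e < 1" using assms \<delta> by auto
  have "Dn e \<noteq> 0" using Dn_pos[of e] assms by auto
  moreover have "(Dn has_real_derivative e * N2 e - N1 e) (at e)"
    unfolding Dn_def[abs_def] using N_derivs(1,2)[OF e] by (auto intro!: derivative_eq_intros)
  ultimately show ?thesis unfolding qt_def[abs_def] qt'_def by (intro DERIV_divide N_derivs(1)[OF e])
qed

section \<open>Classes of the nonlinearity and of its inverse\<close>

sublocale E: weights "{0<..<\<delta>}" "\<lambda>e. e" "\<lambda>_ _. 1" by unfold_locales auto
sublocale Y: weights "{0<..<w}" "\<lambda>e. e" "\<lambda>_ _. 1" by unfold_locales auto

lemma N_cont: "continuous_on {0<..<\<delta>} N" "continuous_on {0<..<\<delta>} N1"
  "continuous_on {0<..<\<delta>} N2" "continuous_on {0<..<\<delta>} N3" "continuous_on {0<..<\<delta>} N4"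
proof -
  have "e < 1" if "e \<in> {0<..<\<delta>}" for e using that \<delta> by auto
  then show "continuous_on {0<..<\<delta>} N" "continuous_on {0<..<\<delta>} N1"
    "continuous_on {0<..<\<delta>} N2" "continuous_on {0<..<\<delta>} N3"
    using N_derivs DERIV_isCont by (blast intro!: continuous_at_imp_continuous_on)+
  have "continuous_on {0<..<\<delta>} (\<lambda>e. f3 (1 - e))"
    by (rule continuous_on_compose2[OF f_C3]) (use \<delta> in \<open>auto intro!: continuous_intros\<close>)
  moreover have "continuous_on {0<..<\<delta>} (\<lambda>e. f2 (1 - e))"
  proof (rule continuous_on_compose2[of "{0<..}" f2])
    show "continuous_on {0<..} f2"
      using f_derivs(3) DERIV_isCont by (auto intro!: continuous_at_imp_continuous_on)
  qed (use \<delta> in \<open>auto intro!: continuous_intros\<close>)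
  ultimately show "continuous_on {0<..<\<delta>} N4" unfolding N4_def[abs_def] by (intro continuous_intros)
qed

lemma rclassI0:
  assumes "0 \<le> M" "\<And>e. e \<in> {0<..<\<delta>} \<Longrightarrow> \<bar>u e\<bar> \<le> M * B e" "\<And>e. e \<in> {0<..<\<delta>} \<Longrightarrow> 0 \<le> B e"
    "continuous_on {0<..<\<delta>} u"
  shows "wbound {0<..<\<delta>} (\<lambda>_ _. 1) (\<lambda>e _. B e) (\<lambda>e _. u e)"
  by (rule E.wboundI0[OF assms(1)]) (use assms in auto)

text \<open>The iterates of \<open>e d/de\<close> on \<open>N\<close> are combinations of
  \<open>N\<close>, \<open>e N1\<close>, \<open>e\<^sup>2 N2\<close> and
  \<open>e\<^sup>3 N3\<close>, each of size \<open>e\<^sup>3\<close>. Order three is wanted because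
  \<open>Dn\<close> contains \<open>e N1\<close>, which has one derivation built in and must still
  have order two.\<close>

lemma N_rclass: "rclass {0<..<\<delta>} (Suc (Suc (Suc 0))) (\<lambda>e. e^3) N"
proof -
  have e: "e < 1" "e \<in> {0<..\<delta>}" "0 < e" if "e \<in> {0<..<\<delta>}" for e using that \<delta> by auto
  have bN: "\<bar>N e\<bar> \<le> K * e^3" if "e \<in> {0<..<\<delta>}" for e
    using N_bounds[OF e(2)[OF that]] N_pos[OF e(2)[OF that]] by auto
  have b1: "\<bar>e * N1 e\<bar> \<le> K * e^3" and b2: "\<bar>e * (e * N2 e)\<bar> \<le> K * e^3" and b3: "\<bar>e * (e * (e * N3 e))\<bar> \<le> K * e^3"
    if "e \<in> {0<..<\<delta>}" for e
  proof -
    note b = N123_bounds[OF e(2)[OF that]]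
    have p: "0 < e" by (rule e(3)[OF that])
    have "e * \<bar>N1 e\<bar> \<le> e * (K * e^2)" using b p by (intro mult_left_mono) auto
    then show "\<bar>e * N1 e\<bar> \<le> K * e^3" using p by (simp add: abs_mult power3_eq_cube power2_eq_square mult_ac)
    have "e * (e * \<bar>N2 e\<bar>) \<le> e * (e * (K * e))" using b p by (intro mult_left_mono) auto
    then show "\<bar>e * (e * N2 e)\<bar> \<le> K * e^3" using p by (simp add: abs_mult power3_eq_cube mult_ac)
    have "e * (e * (e * \<bar>N3 e\<bar>)) \<le> e * (e * (e * K))" using b p by (intro mult_left_mono) auto
    then show "\<bar>e * (e * (e * N3 e))\<bar> \<le> K * e^3" using p by (simp add: abs_mult power3_eq_cube mult_ac)
  qed
  \<comment> \<open>\<open>5 = 1 + 3 + 1\<close> is the sum of the coefficients in the third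
    iterate.\<close>
  have k5: "0 \<le> 5 * K" using K by simp
  show ?thesis
  proof (rule E.clsSI[where u' = "\<lambda>e _. N1 e"])
    show "wbound {0<..<\<delta>} (\<lambda>_ _. 1) (\<lambda>e _. e^3) (\<lambda>e _. N e)"
      by (rule rclassI0[OF K]) (use bN N_cont in auto)
    show "rclass {0<..<\<delta>} (Suc (Suc 0)) (\<lambda>e. e^3) (\<lambda>e. e * N1 e)"
    proof (rule E.clsSI[where u' = "\<lambda>e _. N1 e + e * N2 e"])
      show "wbound {0<..<\<delta>} (\<lambda>_ _. 1) (\<lambda>e _. e^3) (\<lambda>e _. e * N1 e)"
        by (rule rclassI0[OF K]) (use b1 N_cont in \<open>auto intro!: continuous_intros\<close>)
      show "((\<lambda>e. e * N1 e) has_real_derivative N1 e + e * N2 e) (at e)" if "e \<in> {0<..<\<delta>}" for e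
        using N_derivs(2)[OF e(1)[OF that]] by (auto intro!: derivative_eq_intros)
      show "rclass {0<..<\<delta>} (Suc 0) (\<lambda>e. e^3) (\<lambda>e. e * (N1 e + e * N2 e))"
      proof (rule E.clsSI[where u' = "\<lambda>e _. N1 e + 3 * (e * N2 e) + e * (e * N3 e)"])
        show "wbound {0<..<\<delta>} (\<lambda>_ _. 1) (\<lambda>e _. e^3) (\<lambda>e _. e * (N1 e + e * N2 e))"
        proof (rule rclassI0[OF k5])
          show "\<bar>e * (N1 e + e * N2 e)\<bar> \<le> 5 * K * e^3" if "e \<in> {0<..<\<delta>}" for e
            using b1[OF that] b2[OF that] K e(3)[OF that] mult_nonneg_nonneg[of K "e^3"]
            by (simp add: distrib_left)
        qed (use N_cont in \<open>auto intro!: continuous_intros\<close>)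
        show "((\<lambda>e. e * (N1 e + e * N2 e)) has_real_derivative N1 e + 3 * (e * N2 e) + e * (e * N3 e)) (at e)"
          if "e \<in> {0<..<\<delta>}" for e
          using N_derivs(2,3)[OF e(1)[OF that]] by (auto intro!: derivative_eq_intros simp: algebra_simps)
        have "wbound {0<..<\<delta>} (\<lambda>_ _. 1) (\<lambda>e _. e^3) (\<lambda>e _. e * (N1 e + 3 * (e * N2 e) + e * (e * N3 e)))"
        proof (rule rclassI0[OF k5])
          show "\<bar>e * (N1 e + 3 * (e * N2 e) + e * (e * N3 e))\<bar> \<le> 5 * K * e^3" if "e \<in> {0<..<\<delta>}" for e
          proof -
            have "e * (N1 e + 3 * (e * N2 e) + e * (e * N3 e)) = e * N1 e + 3 * (e * (e * N2 e)) + e * (e * (e * N3 e))"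
              by (simp add: algebra_simps)
            then show ?thesis using b1[OF that] b2[OF that] b3[OF that] by linarith
          qed
        qed (use N_cont in \<open>auto intro!: continuous_intros\<close>)
        then show "rclass {0<..<\<delta>} 0 (\<lambda>e. e^3) (\<lambda>e. e * (N1 e + 3 * (e * N2 e) + e * (e * N3 e)))" by simp
      qed
    qed
  qed (use N_derivs(1) e(1) in auto)
qed

text \<open>Numerator and denominator have the same size \<open>e\<^sup>3\<close>, so the quotient
  is of size \<open>1\<close>; the lower bound on \<open>Dn\<close> supplies the weight of its
  inverse.\<close>

lemma qt_rclass: "rclass {0<..<\<delta>} 2 (\<lambda>_. 1) qt"
proof -
  have e: "e < 1" "e \<in> {0<..\<delta>}" "0 < e" if "e \<in> {0<..<\<delta>}" for e using that \<delta> by auto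
  obtain N' where N': "\<And>e. e \<in> {0<..<\<delta>} \<Longrightarrow> (N has_real_derivative N' e) (at e)"
    "rclass {0<..<\<delta>} (Suc (Suc 0)) (\<lambda>e. e^3) (\<lambda>e. e * N' e)"
    using N_rclass by (rule rclass_SucE) auto
  have "e * N' e = e * N1 e" if "e \<in> {0<..<\<delta>}" for e
    using DERIV_unique[OF N'(1)[OF that] N_derivs(1)[OF e(1)[OF that]]] by simp
  with N'(2) have r1: "rclass {0<..<\<delta>} 2 (\<lambda>e. e^3) (\<lambda>e. e * N1 e)"
    unfolding numeral_2_eq_2 by (rule E.cls_cong)
  have rN: "rclass {0<..<\<delta>} 2 (\<lambda>e. e^3) N"
    using wclass_Suc_D[OF N_rclass] by (simp add: numeral_2_eq_2)
  have rD: "rclass {0<..<\<delta>} 2 (\<lambda>e. e^3) Dn"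
    unfolding Dn_def[abs_def] by (intro E.cls_diff E.cls_cmult r1 rN)
  have "rclass {0<..<\<delta>} 2 (\<lambda>e. 1 / e^3) (\<lambda>e. 1 / Dn e)"
  proof (rule E.cls_inverse[OF rD, of _ 1])
    have Dn_cont: "continuous_on {0<..<\<delta>} Dn"
      unfolding Dn_def[abs_def] by (intro continuous_intros N_cont)
    show "wbound {0<..<\<delta>} (\<lambda>_ _. 1) (\<lambda>e _. 1 / e^3) (\<lambda>e _. 1 / Dn e)"
    proof (rule rclassI0[of "2 / cs^2"])
      show "\<bar>1 / Dn e\<bar> \<le> 2 / cs^2 * (1 / e^3)" if "e \<in> {0<..<\<delta>}" for e
      proof -
        have "1 / Dn e \<le> 1 / (cs^2 / 2 * e^3)"
          using Dn_ge[OF e(2)[OF that]] cs_pos e(3)[OF that] by (intro frac_le) auto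
        then show ?thesis using Dn_pos[OF e(2)[OF that]] by simp
      qed
      show "continuous_on {0<..<\<delta>} (\<lambda>e. 1 / Dn e)"
        using Dn_pos e(2) by (intro continuous_intros Dn_cont) force
    qed (use e(3) in auto)
    show "Dn e \<noteq> 0" if "e \<in> {0<..<\<delta>}" for e using Dn_pos[OF e(2)[OF that]] by simp
  qed auto
  from E.cls_mult_le[OF rN this, of 1 "\<lambda>_ _. 1"]
  show ?thesis by (simp add: qt_def[abs_def])
qed

text \<open>\<open>N1\<close> is of size \<open>e\<^sup>2\<close>, but the weight is taken to be
  \<open>e\<close>: composed with \<open>eta\<close> it gives the size \<open>\<eta>\<close> at
  which all \<open>x\<close>-derivatives are estimated.\<close>

lemma N1_rclass: "rclass {0<..<\<delta>} 2 (\<lambda>e. e) N1"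
proof -
  have e: "e < 1" "e \<in> {0<..\<delta>}" "0 < e" if "e \<in> {0<..<\<delta>}" for e using that \<delta> by auto
  have b: "\<bar>N1 e\<bar> \<le> K * e" "\<bar>e * N2 e\<bar> \<le> K * e" "\<bar>e * (e * N3 e)\<bar> \<le> K * e" if "e \<in> {0<..<\<delta>}" for e
  proof -
    note b = N123_bounds[OF e(2)[OF that]]
    have p: "0 < e" "e < 1" "e * e \<le> 1 * e" using e[OF that] by (auto intro!: mult_right_mono)
    have le: "K * (e * e) \<le> K * e" using K p by (intro mult_left_mono) auto
    show "\<bar>N1 e\<bar> \<le> K * e" using b le by (simp add: power2_eq_square)
    have "e * \<bar>N2 e\<bar> \<le> e * (K * e)" using b p by (intro mult_left_mono) auto
    then have "\<bar>e * N2 e\<bar> \<le> K * (e * e)" unfolding abs_mult using p by (simp only: abs_of_pos mult_ac)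
    then show "\<bar>e * N2 e\<bar> \<le> K * e" using le by linarith
    have "e * (e * \<bar>N3 e\<bar>) \<le> e * (e * K)" using b p by (intro mult_left_mono) auto
    then have "\<bar>e * (e * N3 e)\<bar> \<le> K * (e * e)" unfolding abs_mult using p by (simp only: abs_of_pos mult_ac)
    then show "\<bar>e * (e * N3 e)\<bar> \<le> K * e" using le by linarith
  qed
  have "rclass {0<..<\<delta>} (Suc (Suc 0)) (\<lambda>e. e) N1"
  proof (rule E.clsSI[where u' = "\<lambda>e _. N2 e"])
    show "wbound {0<..<\<delta>} (\<lambda>_ _. 1) (\<lambda>e _. e) (\<lambda>e _. N1 e)"
      by (rule rclassI0[OF K]) (use b N_cont in auto)
    show "rclass {0<..<\<delta>} (Suc 0) (\<lambda>e. e) (\<lambda>e. e * N2 e)"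
    proof (rule E.clsSI[where u' = "\<lambda>e _. N2 e + e * N3 e"])
      show "wbound {0<..<\<delta>} (\<lambda>_ _. 1) (\<lambda>e _. e) (\<lambda>e _. e * N2 e)"
        by (rule rclassI0[OF K]) (use b N_cont in \<open>auto intro!: continuous_intros\<close>)
      show "((\<lambda>e. e * N2 e) has_real_derivative N2 e + e * N3 e) (at e)" if "e \<in> {0<..<\<delta>}" for e
        using N_derivs(3)[OF e(1)[OF that]] by (auto intro!: derivative_eq_intros)
      have "wbound {0<..<\<delta>} (\<lambda>_ _. 1) (\<lambda>e _. e) (\<lambda>e _. e * (N2 e + e * N3 e))"
      proof (rule rclassI0[of "2 * K"])
        show "\<bar>e * (N2 e + e * N3 e)\<bar> \<le> 2 * K * e" if "e \<in> {0<..<\<delta>}" for e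
          using b(2,3)[OF that] by (simp add: distrib_left)
      qed (use K N_cont in \<open>auto intro!: continuous_intros\<close>)
      then show "rclass {0<..<\<delta>} 0 (\<lambda>e. e) (\<lambda>e. e * (N2 e + e * N3 e))" by simp
    qed
  qed (use N_derivs(2) e(1) in auto)
  then show ?thesis by (simp add: numeral_2_eq_2)
qed

text \<open>Two derivations on \<open>N2\<close> reach \<open>N4\<close>, hence the third derivative
  of \<open>f\<close>: three derivatives of the profile in \<open>x\<close> followed by two in
  \<open>c\<close> use all the available smoothness.\<close>

lemma N2_rclass: "rclass {0<..<\<delta>} 2 (\<lambda>_. 1) N2"
proof -
  have e: "e < 1" "e \<in> {0<..\<delta>}" "0 < e" if "e \<in> {0<..<\<delta>}" for e using that \<delta> by auto
  have b: "\<bar>N2 e\<bar> \<le> K" "\<bar>e * N3 e\<bar> \<le> K" "\<bar>e * (e * N4 e)\<bar> \<le> K" if "e \<in> {0<..<\<delta>}" for e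
  proof -
    note b = N123_bounds[OF e(2)[OF that]]
    have p: "0 < e" "e \<le> 1" using e[OF that] by auto
    have le: "K * e \<le> K" using K p by (simp add: mult_left_le)
    show "\<bar>N2 e\<bar> \<le> K" using b le by simp
    have "e * \<bar>N3 e\<bar> \<le> 1 * K" using b p by (intro mult_mono) auto
    then show "\<bar>e * N3 e\<bar> \<le> K" using p by (simp add: abs_mult)
    have "e * (e * \<bar>N4 e\<bar>) \<le> 1 * (1 * K)" using b p by (intro mult_mono) auto
    then show "\<bar>e * (e * N4 e)\<bar> \<le> K" using p by (simp add: abs_mult)
  qed
  have "rclass {0<..<\<delta>} (Suc (Suc 0)) (\<lambda>_. 1) N2"
  proof (rule E.clsSI[where u' = "\<lambda>e _. N3 e"])
    show "wbound {0<..<\<delta>} (\<lambda>_ _. 1) (\<lambda>e _. 1) (\<lambda>e _. N2 e)"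
      by (rule rclassI0[OF K]) (use b N_cont in auto)
    show "rclass {0<..<\<delta>} (Suc 0) (\<lambda>_. 1) (\<lambda>e. e * N3 e)"
    proof (rule E.clsSI[where u' = "\<lambda>e _. N3 e + e * N4 e"])
      show "wbound {0<..<\<delta>} (\<lambda>_ _. 1) (\<lambda>e _. 1) (\<lambda>e _. e * N3 e)"
        by (rule rclassI0[OF K]) (use b N_cont in \<open>auto intro!: continuous_intros\<close>)
      show "((\<lambda>e. e * N3 e) has_real_derivative N3 e + e * N4 e) (at e)" if "e \<in> {0<..<\<delta>}" for e
        using N_derivs(4)[OF e(1)[OF that]] by (auto intro!: derivative_eq_intros)
      have "wbound {0<..<\<delta>} (\<lambda>_ _. 1) (\<lambda>e _. 1) (\<lambda>e _. e * (N3 e + e * N4 e))"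
      proof (rule rclassI0[of "2 * K"])
        show "\<bar>e * (N3 e + e * N4 e)\<bar> \<le> 2 * K * 1" if "e \<in> {0<..<\<delta>}" for e
          using b(2,3)[OF that] by (simp add: distrib_left)
      qed (use K N_cont in \<open>auto intro!: continuous_intros\<close>)
      then show "rclass {0<..<\<delta>} 0 (\<lambda>_. 1) (\<lambda>e. e * (N3 e + e * N4 e))" by simp
    qed
  qed (use N_derivs(3) e(1) in auto)
  then show ?thesis by (simp add: numeral_2_eq_2)
qed

lemma qt_h_rclass:
  assumes "rclass {0<..<w} n h h" "n \<le> 2"
  shows "rclass {0<..<w} n (\<lambda>_. 1) q"
  unfolding q_def
  by (rule Y.cls_compose[OF open_greaterThanLessThan greaterThanLessThan_subset_pos assms(1) h_mem
        wclass_antimono[OF qt_rclass assms(2)]])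

text \<open>Bootstrap: \<open>y h' = q h\<close> with \<open>q = qt(h)\<close>, so the class of
  \<open>h\<close> at order \<open>n\<close> passes to \<open>q\<close> and then to
  \<open>y h'\<close>, which gives order \<open>n + 1\<close> for \<open>h\<close>.\<close>

lemma h_rclass: "n \<le> 2 \<Longrightarrow> rclass {0<..<w} n h h"
proof (induction n)
  have b: "wbound {0<..<w} (\<lambda>_ _. 1) (\<lambda>y _. h y) (\<lambda>y _. h y)"
  proof (rule Y.wboundI0[of 1])
    show "continuous_on {0<..<w} h"
      using h_deriv DERIV_isCont by (blast intro: continuous_at_imp_continuous_on)
  qed (use h_mem in \<open>auto simp: less_imp_le\<close>)
  {
    case 0
    show ?case using b by simp
  next
    case (Suc n)
    then have n: "rclass {0<..<w} n h h" by simp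
    have "rclass {0<..<w} n h (\<lambda>y. q y * h y)"
      by (rule Y.cls_mult1[OF qt_h_rclass[OF n] n]) (use Suc in simp)
    then have "rclass {0<..<w} n h (\<lambda>y. y * (h y * q y / y))"
      by (rule Y.cls_cong) auto
    then show ?case by (intro Y.clsSI[OF b, where u' = "\<lambda>y _. h y * q y / y"] h_deriv)
  }
qed

lemma q_deriv:
  assumes "y \<in> {0<..<w}"
  shows "(q has_real_derivative q' y) (at y)"
proof -
  have "((\<lambda>y. qt (h y)) has_real_derivative qt' (h y) * (h y * q y / y)) (at y)"
    by (rule DERIV_chain2[where f = qt, OF qt_DERIV[OF h_mem[OF assms]] h_deriv[OF assms]])
  then show ?thesis by (simp only: q_def[abs_def] q'_def)
qed

lemma \<theta>q_rclass: "rclass {0<..<w} 1 (\<lambda>_. 1) (\<lambda>y. y * q' y)"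
proof -
  have "rclass {0<..<w} (Suc 1) (\<lambda>_. 1) q" using qt_h_rclass[OF h_rclass, of 2] unfolding numeral_2_eq_2 by simp
  then obtain d where d: "\<And>y. y \<in> {0<..<w} \<Longrightarrow> (q has_real_derivative d y) (at y)"
    "rclass {0<..<w} 1 (\<lambda>_. 1) (\<lambda>y. y * d y)"
    by (rule rclass_SucE) auto
  have "y * d y = y * q' y" if "y \<in> {0<..<w}" for y
    using DERIV_unique[OF d(1)[OF that] q_deriv[OF that]] by simp
  with d(2) show ?thesis by (rule Y.cls_cong)
qed

lemma q_estimates:
  assumes "y \<in> {0<..<w}"
  shows "7/8 \<le> q y" "q y \<le> 2" "\<bar>y * q' y\<bar> \<le> 1/16"
proof -
  note b = qt_bounds[OF h_mem'[OF assms]]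
  show q: "7/8 \<le> q y" "q y \<le> 2" using b by (auto simp: q_def)
  have "y * q' y = h y * qt' (h y) * q y" using assms by (simp add: q'_def)
  then have "\<bar>y * q' y\<bar> = \<bar>h y * qt' (h y)\<bar> * q y" using q by (simp add: abs_mult)
  also have "\<dots> \<le> 1/32 * 2" using b q by (intro mult_mono) auto
  finally show "\<bar>y * q' y\<bar> \<le> 1/16" by simp
qed

lemma profile_pressure:
  assumes "0 < c0" "c0 < cs" "cs^2 - c0^2 \<le> w"
  shows "profile w q q' h N N1 N2 \<delta> (2 / cs^2) cs c0"
proof
  show "continuous_on {0<..<w} (\<lambda>y. y * q' y)"
    using wbound_continuous(1)[OF wclass_wbound[OF \<theta>q_rclass]] .
  \<comment> \<open>The lower bound \<open>om e \<ge> (cs\<^sup>2 / 2) e\<close>, read at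
    \<open>e = h y\<close>.\<close>
  show "h y \<le> 2 / cs^2 * y" if "y \<in> {0<..<w}" for y
    using om_bounds(1)[OF h_mem'[OF that]] om_h[OF that] cs_pos by (simp add: field_simps)
  show "(N1 has_real_derivative N2 e) (at e)" if "e \<in> {0<..<\<delta>}" for e
    using N_derivs(2)[of e] that \<delta> by auto
  show "1/2 \<le> q y \<and> q y \<le> 2" if "y \<in> {0<..<w}" for y using q_estimates[OF that] by auto
qed (use w_pos q_deriv \<delta> \<theta>q_rclass h_mem h_deriv h_rclass[of 2] N_h N1_h N1_rclass N2_rclass assms in auto)

end

section \<open>Uniqueness\<close>

text \<open>Integrability alone gives no limit at infinity, but small values occur beyond every
  point. This suffices to evaluate the constant of the first integral and to enclose any given point
  between small values.\<close>

lemma integrable_small_values: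
  fixes g :: "real \<Rightarrow> real"
  assumes g: "integrable lborel g" and pos: "\<And>x. 0 \<le> g x" and \<epsilon>: "0 < \<epsilon>"
  shows "\<exists>b>a. g b < \<epsilon>"
proof (rule ccontr)
  assume "\<not> (\<exists>b>a. g b < \<epsilon>)"
  then have ge: "\<epsilon> \<le> g b" if "b > a" for b using that by force
  have "real n * \<epsilon> \<le> (LINT x|lborel. g x)" for n :: nat
  proof -
    have "(LINT x|lborel. \<epsilon> * indicator {a<..a + real n} x) \<le> (LINT x|lborel. g x)"
    proof (rule integral_mono[OF _ g])
      show "integrable lborel (\<lambda>x. \<epsilon> * indicator {a<..a + real n} x)" by simp
      show "\<epsilon> * indicator {a<..a + real n} x \<le> g x" for x
        using ge[of x] pos[of x] \<epsilon> by (auto simp: indicator_def)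
    qed
    then show ?thesis by (simp add: mult.commute)
  qed
  moreover obtain n :: nat where "(LINT x|lborel. g x) / \<epsilon> < real n" using reals_Archimedean2 by blast
  ultimately show False using \<epsilon> by (metis divide_less_eq not_less)
qed

lemma integrable_small_values_left:
  fixes g :: "real \<Rightarrow> real"
  assumes g: "integrable lborel g" and pos: "\<And>x. 0 \<le> g x" and \<epsilon>: "0 < \<epsilon>"
  shows "\<exists>b<a. g b < \<epsilon>"
proof -
  have "integrable lborel (\<lambda>x. g (0 + (-1) * x))"
    by (rule lborel_integrable_real_affine[OF g]) simp
  from integrable_small_values[OF this _ \<epsilon>, of "- a"] pos
  obtain b where "b > - a" "g (- b) < \<epsilon>" by auto
  then show ?thesis by (intro exI[of _ "- b"]) auto
qed

lemma continuous_locally_integrable: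
  fixes u :: "real \<Rightarrow> real"
  assumes "continuous_on UNIV u"
  shows "integrable lborel (\<lambda>x. indicator {a<..<b} x * u x)"
proof (rule Bochner_Integration.integrable_bound)
  have [measurable]: "u \<in> borel_measurable borel" by (rule borel_measurable_continuous_onI[OF assms])
  show "integrable lborel (\<lambda>x. indicator {a..b} x *\<^sub>R u x)"
    using continuous_on_subset[OF assms] by (intro borel_integrable_compact) auto
  show "AE x in lborel. norm (indicator {a<..<b} x * u x) \<le> norm (indicator {a..b} x *\<^sub>R u x)"
    by (auto simp: indicator_def)
  show "(\<lambda>x. indicator {a<..<b} x * u x) \<in> borel_measurable lborel" by measurable
qed

lemma continuous_weak_deriv_L2:
  assumes "is_weak_deriv i w u" "continuous_on UNIV u" "is_weak_deriv i w g" "L2fun g"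
  shows "integrable lborel (\<lambda>x. (u x)^2)"
proof -
  have [measurable]: "u \<in> borel_measurable borel" by (rule borel_measurable_continuous_onI[OF assms(2)])
  have [measurable]: "g \<in> borel_measurable borel" using assms(4) by (simp add: L2fun_def)
  have "AE x in lborel. g x = u x"
    by (rule weak_deriv_unique[OF assms(3,1)])
      (use assms L2fun_locally_integrable continuous_locally_integrable in auto)
  then have "integrable lborel (\<lambda>x. (g x)^2) \<longleftrightarrow> integrable lborel (\<lambda>x. (u x)^2)"
    by (intro integrable_cong_AE) auto
  then show ?thesis using assms(4) by (simp add: L2fun_def)
qed

text \<open>The derivative \<open>2 u u'\<close> of \<open>u\<^sup>2\<close> is integrable, so
  \<open>u\<^sup>2\<close> stays within a fixed distance of its value at \<open>0\<close>. A bound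
  must come first, because \<open>Sup\<close> of an unbounded set gives no pointwise
  information.\<close>

lemma H1_bounded:
  fixes u u' :: "real \<Rightarrow> real"
  assumes "\<And>x. (u has_real_derivative u' x) (at x)" "continuous_on UNIV u'"
    "integrable lborel (\<lambda>x. (u x)^2)" "integrable lborel (\<lambda>x. (u' x)^2)"
  obtains B where "\<And>x. u x \<le> B"
proof -
  have u: "isCont u x" for x using DERIV_isCont[OF assms(1)] .
  have u': "isCont u' x" for x using assms(2) by (simp add: continuous_on_eq_continuous_at)
  let ?g = "\<lambda>x. (u x)^2 + (u' x)^2"
  have ig: "integrable lborel ?g" using assms(3,4) by auto
  define T where "T = (LINT x|lborel. ?g x)"
  have main: "\<bar>(u b)^2 - (u a)^2\<bar> \<le> T" if "a \<le> b" for a b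
  proof -
    let ?k = "\<lambda>x. 2 * u x * u' x"
    have hb: "has_bochner_integral lborel (\<lambda>x. ?k x * indicator {a..b} x) ((u b)^2 - (u a)^2)"
    proof (rule has_bochner_integral_FTC_Icc_real[OF that])
      show "((\<lambda>x. (u x)^2) has_real_derivative ?k x) (at x)" for x
        using assms(1)[of x] by (auto intro!: derivative_eq_intros)
      show "isCont ?k x" for x using u u' by (intro continuous_intros)
    qed
    have ik: "integrable lborel (\<lambda>x. ?k x * indicator {a..b} x)" using hb by (simp add: has_bochner_integral_iff)
    have "\<bar>LINT x|lborel. ?k x * indicator {a..b} x\<bar> \<le> (LINT x|lborel. \<bar>?k x * indicator {a..b} x\<bar>)"
      using integral_norm_bound[of lborel "\<lambda>x. ?k x * indicator {a..b} x"] by simp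
    also have "\<dots> \<le> T" unfolding T_def
    proof (rule integral_mono[OF _ ig])
      show "integrable lborel (\<lambda>x. \<bar>?k x * indicator {a..b} x\<bar>)" using ik by simp
      fix x
      have "0 \<le> (\<bar>u x\<bar> - \<bar>u' x\<bar>)^2" by simp
      then have "2 * (\<bar>u x\<bar> * \<bar>u' x\<bar>) \<le> ?g x" unfolding power2_diff by simp
      then show "\<bar>?k x * indicator {a..b} x\<bar> \<le> ?g x" by (auto simp: indicator_def abs_mult)
    qed
    finally show ?thesis using has_bochner_integral_integral_eq[OF hb] by simp
  qed
  have "u x \<le> 1 + ((u 0)^2 + T)" for x
  proof -
    have "(u x)^2 \<le> (u 0)^2 + T"
      using main[of 0 x] main[of x 0] by (cases "0 \<le> x") auto
    moreover have "u x \<le> 1 + (u x)^2"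
    proof -
      have "0 \<le> (u x - 1/2)^2" by simp
      then show ?thesis by (simp add: power2_eq_square algebra_simps)
    qed
    ultimately show ?thesis by simp
  qed
  then show ?thesis by (rule that)
qed

text \<open>The integrating factors \<open>exp (- \<Lambda> x)\<close> on the right of
  \<open>0\<close> and \<open>exp (\<Lambda> x)\<close> on the left make the product monotone in the
  direction that traps it below its value \<open>0\<close> at the origin.\<close>

lemma gronwall_zero:
  fixes y y' :: "real \<Rightarrow> real"
  assumes d: "\<And>x. (y has_real_derivative y' x) (at x)" and le: "\<And>x. \<bar>y' x\<bar> \<le> \<Lambda> * y x"
    and y: "\<And>x. 0 \<le> y x" "y 0 = 0"
  shows "y x = 0"
proof (cases "0 \<le> x")
  case True
  have "y x * exp (- \<Lambda> * x) \<le> y 0 * exp (- \<Lambda> * 0)"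
  proof (rule DERIV_nonpos_imp_nonincreasing[where f = "\<lambda>x. y x * exp (- \<Lambda> * x)", OF True])
    fix t
    have "((\<lambda>x. y x * exp (- \<Lambda> * x)) has_real_derivative (y' t - \<Lambda> * y t) * exp (- \<Lambda> * t)) (at t)"
      using d[of t] by (auto intro!: derivative_eq_intros simp: algebra_simps)
    moreover have "(y' t - \<Lambda> * y t) * exp (- \<Lambda> * t) \<le> 0"
      using le[of t] by (intro mult_nonpos_nonneg) auto
    ultimately show "\<exists>z. ((\<lambda>x. y x * exp (- \<Lambda> * x)) has_real_derivative z) (at t) \<and> z \<le> 0" by blast
  qed
  then have "y x * exp (- \<Lambda> * x) \<le> 0" using y by simp
  then show ?thesis using y(1)[of x] by (auto simp: mult_le_0_iff not_le[symmetric])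
next
  case False
  have "y x * exp (\<Lambda> * x) \<le> y 0 * exp (\<Lambda> * 0)"
  proof (rule DERIV_nonneg_imp_nondecreasing[where f = "\<lambda>x. y x * exp (\<Lambda> * x)"])
    show "x \<le> 0" using False by simp
    fix t
    have "((\<lambda>x. y x * exp (\<Lambda> * x)) has_real_derivative (y' t + \<Lambda> * y t) * exp (\<Lambda> * t)) (at t)"
      using d[of t] by (auto intro!: derivative_eq_intros simp: algebra_simps)
    moreover have "0 \<le> (y' t + \<Lambda> * y t) * exp (\<Lambda> * t)"
      using le[of t] by (intro mult_nonneg_nonneg) auto
    ultimately show "\<exists>z. ((\<lambda>x. y x * exp (\<Lambda> * x)) has_real_derivative z) (at t) \<and> z \<ge> 0" by blast
  qed
  then have "y x * exp (\<Lambda> * x) \<le> 0" using y by simp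
  then show ?thesis using y(1)[of x] by (auto simp: mult_le_0_iff not_le[symmetric])
qed

text \<open>The residual \<open>e1\<^sup>2 - ((cs\<^sup>2 - c\<^sup>2) e\<^sup>2 - N e)\<close>, divided by \<open>1 - e\<close>, is the first integral of the equation.\<close>

lemma (in pressure) TW_second_equation:
  assumes e: "e < 1" and v: "c / 2 * e = v * (1 - e)"
  shows "c * v = f (1 - e) - v^2 - e2 / (2 * (1 - e)) - e1^2 / (4 * (1 - e)^2) \<longleftrightarrow>
    e2 = (cs^2 - c^2) * e - N1 e / 2 - (e1^2 - ((cs^2 - c^2) * e^2 - N e)) / (2 * (1 - e))"
proof -
  define a where "a = 1 - e"
  have a: "a \<noteq> 0" "0 < a" and ea: "e = 1 - a" using e by (auto simp: a_def)
  define F where "F = Fpot f a"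
  have va: "v = c / 2 * e / a" using v a by (simp add: a_def field_simps)
  have n1: "N1 e = 2 * cs^2 * e + 4 * F - 4 * a * f a" by (simp add: N1_def a_def F_def)
  have n: "N e = cs^2 * e^2 - 4 * a * F" by (simp add: N_def a_def F_def)
  have "c * v + v^2 = c^2 * (1 - a^2) / (4 * a^2)"
    unfolding va ea using a by (simp add: field_simps power2_eq_square)
  then have l: "c * v = f a - v^2 - e2 / (2 * a) - e1^2 / (4 * a^2) \<longleftrightarrow>
      c^2 * (1 - a^2) / (4 * a^2) = f a - e2 / (2 * a) - e1^2 / (4 * a^2)" by auto
  also have "f a - e2 / (2 * a) - e1^2 / (4 * a^2) = (4 * a^2 * f a - 2 * a * e2 - e1^2) / (4 * a^2)"
    using a by (simp add: diff_divide_distrib power2_eq_square)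
  also have "c^2 * (1 - a^2) / (4 * a^2) = (4 * a^2 * f a - 2 * a * e2 - e1^2) / (4 * a^2) \<longleftrightarrow>
      c^2 * (1 - a^2) = 4 * a^2 * f a - 2 * a * e2 - e1^2"
    using a by simp
  also have "\<dots> \<longleftrightarrow> 2 * a * e2 = 2 * a * ((cs^2 - c^2) * e) - a * N1 e - (e1^2 - ((cs^2 - c^2) * e^2 - N e))"
    unfolding n1 n unfolding ea by (auto simp: algebra_simps power2_eq_square)
  also have "\<dots> \<longleftrightarrow> e2 = (cs^2 - c^2) * e - N1 e / 2 - (e1^2 - ((cs^2 - c^2) * e^2 - N e)) / (2 * a)"
    using a by (auto simp: field_simps)
  finally show ?thesis by (simp only: a_def)
qed

section \<open>Existence and uniqueness of the waves\<close>

locale wave = small_pressure +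
  fixes c0 :: real
  assumes c0: "0 < c0" "c0 < cs" "cs^2 - c0^2 \<le> w" "cs^2 \<le> 3 * c0^2"
begin

sublocale P: profile w q q' h N N1 N2 \<delta> "2 / cs^2" cs c0
  by (rule profile_pressure[OF c0(1-3)])

lemma TW_profile:
  assumes c: "c \<in> P.I"
  shows "TW_hy f c (P.eta c) (P.V 0 c)"
  unfolding TW_hy_def
proof
  fix x
  have d1: "deriv (P.eta c) = P.U 1 c"
    using P.eta_DERIV_x[OF c] by (auto simp: fun_eq_iff DERIV_imp_deriv)
  have D2: "(P.U 1 c has_real_derivative P.U 2 c x) (at x)" for x
    using P.U_DERIV_x[OF c, of 1 x] by (simp add: numeral_2_eq_2)
  have d2: "deriv (P.U 1 c) x = P.U 2 c x" using D2 by (rule DERIV_imp_deriv)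
  have e: "P.eta c x < 1" using P.eta_mem[OF c, of x] \<delta> by auto
  have v: "c / 2 * P.eta c x = P.V 0 c x * (1 - P.eta c x)"
  proof -
    have "c / 2 * z = c / 2 * (z / a) * a" if "a \<noteq> 0" for a z :: real using that by simp
    from this[of "1 - P.eta c x" "P.eta c x"] show ?thesis using e by (simp only: P.V_def) simp
  qed
  \<comment> \<open>The first integral holds with residual \<open>0\<close>, so the correction term
    in the equation for \<open>\<eta>''\<close> drops out.\<close>
  have "P.U 2 c x = (cs^2 - c^2) * P.eta c x - N1 (P.eta c x) / 2
      - ((P.U 1 c x)^2 - ((cs^2 - c^2) * (P.eta c x)^2 - N (P.eta c x))) / (2 * (1 - P.eta c x))"
    using P.eta_sq_identity[OF c, of x] by (simp add: P.U_def P.m_def)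
  then have "c * P.V 0 c x = f (1 - P.eta c x) - (P.V 0 c x)^2 - P.U 2 c x / (2 * (1 - P.eta c x))
      - (P.U 1 c x)^2 / (4 * (1 - P.eta c x)^2)"
    using TW_second_equation[OF e v] by blast
  then show "(P.eta c has_real_derivative deriv (P.eta c) x) (at x) \<and>
      (deriv (P.eta c) has_real_derivative deriv (deriv (P.eta c)) x) (at x) \<and>
      c / 2 * P.eta c x = P.V 0 c x * (1 - P.eta c x) \<and>
      c * P.V 0 c x = f (1 - P.eta c x) - (P.V 0 c x)^2 - deriv (deriv (P.eta c)) x / (2 * (1 - P.eta c x))
        - (deriv (P.eta c) x)^2 / (4 * (1 - P.eta c x)^2)"
    unfolding d1 d2 using v D2 P.eta_DERIV_x[OF c, of x] by simp
qed

lemma TW_unique: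
  assumes c: "c \<in> P.I" and NX: "in_NX 2 E v" and TW: "TW_hy f c E v"
    and nc: "\<not> (\<exists>a b. \<forall>x. E x = a \<and> v x = b)"
  shows "\<exists>a. \<forall>x. E x = P.eta c (x + a) \<and> v x = P.V 0 c (x + a)"
proof -
  define E1 where "E1 = deriv E"
  define E2 where "E2 = deriv E1"
  define m where "m = cs^2 - c^2"
  have m: "m = P.m c" "0 < m" using P.m_pos[OF c] by (auto simp: m_def P.m_def)
  have D1: "(E has_real_derivative E1 x) (at x)" and D2: "(E1 has_real_derivative E2 x) (at x)"
    and vE: "c / 2 * E x = v x * (1 - E x)"
    and eq: "c * v x = f (1 - E x) - (v x)^2 - E2 x / (2 * (1 - E x)) - (E1 x)^2 / (4 * (1 - E x)^2)" for x
    using TW unfolding TW_hy_def E1_def E2_def by auto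
  have contE: "continuous_on UNIV E" and contE1: "continuous_on UNIV E1"
    using D1 D2 DERIV_isCont by (blast intro: continuous_at_imp_continuous_on)+
  have inH: "in_H 3 E" and sup: "Sup (range E) < 1"
    using NX by (auto simp: in_NX_def in_X_def numeral_3_eq_3 numeral_2_eq_2)
  have wd0: "is_weak_deriv 0 E E" by (rule is_weak_deriv_0[OF contE])
  have wd1: "is_weak_deriv 1 E E1" using is_weak_deriv_Suc[OF wd0 D1 contE1] by simp
  obtain g0 g1 where "L2fun g0" "is_weak_deriv 0 E g0" "L2fun g1" "is_weak_deriv 1 E g1"
    using inH unfolding in_H_def by (meson le0 one_le_numeral)
  then have iE: "integrable lborel (\<lambda>x. (E x)^2)" and iE1: "integrable lborel (\<lambda>x. (E1 x)^2)"
    using continuous_weak_deriv_L2[OF wd0 contE] continuous_weak_deriv_L2[OF wd1 contE1] by auto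
  obtain B where "\<And>x. E x \<le> B" using H1_bounded[OF D1 contE1 iE iE1] by blast
  then have "bdd_above (range E)" by (auto simp: bdd_above_def)
  then have E_lt: "E x < 1" for x using cSUP_upper[of x UNIV E] sup by (meson UNIV_I le_less_trans)

  define G where "G x = (E1 x)^2 - (m * (E x)^2 - N (E x))" for x
  have E2_eq: "E2 x = m * E x - N1 (E x) / 2 - G x / (2 * (1 - E x))" for x
    using TW_second_equation[OF E_lt vE, of x] eq[of x] unfolding G_def m_def by blast
  \<comment> \<open>The second equation gives the linear equation
    \<open>G' = - E1 G / (1 - E)\<close>. As \<open>1 - E\<close> solves the same equation, the
    quotient is constant.\<close>
  have G_const: "G x / (1 - E x) = G 0 / (1 - E 0)" for x
  proof (rule DERIV_isconst_all[where f = "\<lambda>x. G x / (1 - E x)"])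
    show "\<forall>x. ((\<lambda>x. G x / (1 - E x)) has_real_derivative 0) (at x)"
    proof
      fix x
      define a where "a = 1 - E x"
      have a: "a \<noteq> 0" using E_lt[of x] by (simp add: a_def)
      have "((\<lambda>x. N (E x)) has_real_derivative N1 (E x) * E1 x) (at x)"
        by (rule DERIV_chain2[where f = N, OF N_derivs(1)[OF E_lt] D1])
      then have "(G has_real_derivative 2 * E1 x * E2 x - (m * (2 * E x * E1 x) - N1 (E x) * E1 x)) (at x)"
        unfolding G_def[abs_def] using D1[of x] D2[of x] by (auto intro!: derivative_eq_intros)
      also have "2 * E1 x * E2 x - (m * (2 * E x * E1 x) - N1 (E x) * E1 x) = - E1 x * G x / a"
        unfolding E2_eq a_def[symmetric] using a by (simp add: field_simps)
      finally have "((\<lambda>x. G x / (1 - E x)) has_real_derivative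
          ((- E1 x * G x / a) * (1 - E x) - G x * (0 - E1 x)) / ((1 - E x) * (1 - E x))) (at x)"
        using a unfolding a_def by (intro DERIV_divide DERIV_diff DERIV_const D1)
      then show "((\<lambda>x. G x / (1 - E x)) has_real_derivative 0) (at x)"
        unfolding a_def[symmetric] using a by simp
    qed
  qed
  have G0: "G x = 0" for x
  proof -
    \<comment> \<open>Along points where \<open>E\<close> and \<open>E1\<close> are small together,
      \<open>G / (1 - E)\<close> tends to \<open>0\<close>; being constant, it is
      \<open>0\<close>.\<close>
    have "\<forall>n. \<exists>x. (E x)^2 + (E1 x)^2 < 1 / (real n + 1)"
    proof
      fix n :: nat
      show "\<exists>x. (E x)^2 + (E1 x)^2 < 1 / (real n + 1)"
        using integrable_small_values[OF Bochner_Integration.integrable_add[OF iE iE1], of "1 / (real n + 1)" 0] by auto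
    qed
    then obtain X where X: "\<And>n. (E (X n))^2 + (E1 (X n))^2 < 1 / (real n + 1)" by metis
    have lim0: "(\<lambda>n. 1 / (real n + 1)) \<longlonglongrightarrow> 0" by real_asymp
    have sq: "u \<longlonglongrightarrow> 0" if "\<And>n. (u n)^2 < 1 / (real n + 1)" for u :: "nat \<Rightarrow> real"
    proof -
      have "(\<lambda>n. (u n)^2) \<longlonglongrightarrow> 0"
        by (rule Lim_null_comparison[OF _ lim0]) (use that in \<open>auto intro!: always_eventually less_imp_le\<close>)
      then have "(\<lambda>n. sqrt ((u n)^2)) \<longlonglongrightarrow> sqrt 0" by (intro tendsto_intros)
      then show ?thesis by (simp add: tendsto_rabs_zero_iff)
    qed
    have lE: "(\<lambda>n. E (X n)) \<longlonglongrightarrow> 0" and lE1: "(\<lambda>n. E1 (X n)) \<longlonglongrightarrow> 0"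
    proof -
      have "(E (X n))^2 < 1 / (real n + 1)" "(E1 (X n))^2 < 1 / (real n + 1)" for n
        using X[of n] zero_le_power2[of "E (X n)"] zero_le_power2[of "E1 (X n)"] by linarith+
      then show "(\<lambda>n. E (X n)) \<longlonglongrightarrow> 0" "(\<lambda>n. E1 (X n)) \<longlonglongrightarrow> 0" by (auto intro: sq)
    qed
    have "(\<lambda>n. N (E (X n))) \<longlonglongrightarrow> N 0"
      by (rule isCont_tendsto_compose[OF DERIV_isCont[OF N_derivs(1)] lE]) simp
    then have "(\<lambda>n. G (X n) / (1 - E (X n))) \<longlonglongrightarrow> (0^2 - (m * 0^2 - N 0)) / (1 - 0)"
      unfolding G_def using lE lE1 by (intro tendsto_intros) auto
    moreover have "(\<lambda>n. G (X n) / (1 - E (X n))) = (\<lambda>n. G 0 / (1 - E 0))" using G_const by blast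
    ultimately have "G 0 / (1 - E 0) = 0" using N_0 by (simp add: LIMSEQ_const_iff)
    then have "G x / (1 - E x) = 0" using G_const[of x] by simp
    then show ?thesis using E_lt[of x] by simp
  qed
  then have first: "(E1 x)^2 = m * (E x)^2 - N (E x)" and second: "E2 x = m * E x - N1 (E x) / 2" for x
    using G0[of x] E2_eq[of x] by (auto simp: G_def)

  have small: "\<exists>a b. a < x \<and> x < b \<and> \<bar>E a\<bar> < \<epsilon> \<and> \<bar>E b\<bar> < \<epsilon>" if \<epsilon>: "0 < \<epsilon>" for x \<epsilon>
  proof -
    have e2: "0 < \<epsilon>^2" using \<epsilon> by simp
    obtain b where b: "b > x" "(E b)^2 < \<epsilon>^2" using integrable_small_values[OF iE _ e2, of x] by auto
    obtain a where a: "a < x" "(E a)^2 < \<epsilon>^2" using integrable_small_values_left[OF iE _ e2, of x] by auto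
    have "\<bar>E y\<bar> < \<epsilon>" if "(E y)^2 < \<epsilon>^2" for y
      using that \<epsilon> by (metis abs_ge_zero abs_of_pos power2_abs power2_less_imp_less less_imp_le)
    with a b show ?thesis by blast
  qed
  \<comment> \<open>Small values on both sides force an interior minimum, where
    \<open>m E\<^sup>2 = N(E) \<le> cs\<^sup>2 E\<^sup>3\<close>; for negative \<open>E\<close> the
    right side is negative, which is absurd.\<close>
  have nonneg: "0 \<le> E x" for x
  proof (rule ccontr)
    assume "\<not> 0 \<le> E x"
    then have neg: "E x < 0" by simp
    obtain a b where ab: "a < x" "x < b" "\<bar>E a\<bar> < - E x" "\<bar>E b\<bar> < - E x"
      using small[of "- E x" x] neg by auto
    have "\<exists>z\<in>{a..b}. \<forall>y\<in>{a..b}. E z \<le> E y"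
      using ab continuous_on_subset[OF contE] by (intro continuous_attains_inf) auto
    then obtain z where z: "z \<in> {a..b}" "\<And>y. y \<in> {a..b} \<Longrightarrow> E z \<le> E y" by blast
    have zx: "E z \<le> E x" using z(2)[of x] ab by auto
    have "z \<noteq> a" "z \<noteq> b" using zx ab by auto
    then have zab: "a < z" "z < b" using z(1) by auto
    have "E1 z = 0"
      by (rule DERIV_local_min[OF D1, of "min (z - a) (b - z)"]) (use zab z(2) in \<open>auto simp: abs_if split: if_splits\<close>)
    then have "m * (E z)^2 = N (E z)" using first[of z] by simp
    also have "\<dots> \<le> cs^2 * (E z)^3" by (rule N_le[OF E_lt])
    also have "\<dots> < 0" using zx neg cs_pos by (simp add: mult_less_0_iff power_less_zero_eq)
    finally show False using m(2) by (simp add: mult_less_0_iff not_le[symmetric])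
  qed
  define \<xi> where "\<xi> = h m"
  have mJ: "m \<in> {0<..<w}" using P.m_mem[OF c] m by simp
  have \<xi>: "0 < \<xi>" "\<xi> < \<delta>" "om \<xi> = m" using h_mem[OF mJ] om_h[OF mJ] by (auto simp: \<xi>_def)
  have crest: "\<exists>z. E z = \<xi> \<and> E1 z = 0 \<and> E x \<le> \<xi>" if pos: "0 < E x" for x
  proof -
    obtain a b where ab: "a < x" "x < b" "\<bar>E a\<bar> < min (E x) \<xi>" "\<bar>E b\<bar> < min (E x) \<xi>"
      using small[of "min (E x) \<xi>" x] pos \<xi> by auto
    have "\<exists>z\<in>{a..b}. \<forall>y\<in>{a..b}. E y \<le> E z"
      using ab continuous_on_subset[OF contE] by (intro continuous_attains_sup) auto
    then obtain z where z: "z \<in> {a..b}" "\<And>y. y \<in> {a..b} \<Longrightarrow> E y \<le> E z" by blast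
    have zx: "E x \<le> E z" using z(2)[of x] ab by auto
    have "z \<noteq> a" "z \<noteq> b" using zx ab by auto
    then have zab: "a < z" "z < b" using z(1) by auto
    have d0: "E1 z = 0"
      by (rule DERIV_local_max[OF D1, of "min (z - a) (b - z)"]) (use zab z(2) in \<open>auto simp: abs_if split: if_splits\<close>)
    have Ez: "0 < E z" using zx pos by simp
    have omz: "om (E z) = m" using first[of z] d0 Ez by (simp add: om_def divide_eq_eq)
    \<comment> \<open>\<open>h\<close> inverts \<open>om\<close> only below \<open>\<delta>\<close>.
      A higher maximum would make \<open>E\<close> take the value \<open>e\<close> between
      \<open>\<xi>\<close> and \<open>\<delta>\<close>, where \<open>om e > m\<close> renders
      \<open>m e\<^sup>2 - N(e)\<close> negative, against the first integral.\<close>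
    have "E z < \<delta>"
    proof (rule ccontr)
      assume "\<not> E z < \<delta>"
      define e where "e = (\<xi> + \<delta>) / 2"
      have e: "\<xi> < e" "e < \<delta>" "e \<le> E z" using \<xi> \<open>\<not> E z < \<delta>\<close> by (auto simp: e_def)
      have "\<exists>t\<ge>a. t \<le> z \<and> E t = e"
        using ab e zab continuous_on_subset[OF contE] by (intro IVT') auto
      then obtain t where t: "E t = e" by blast
      have "m < om e" using om_less[of \<xi> e] \<xi> e by simp
      moreover have "0 < e^2" using e \<xi> by simp
      ultimately have "m * e^2 < N e" by (simp add: om_def less_divide_eq)
      moreover have "0 \<le> (E1 t)^2" by simp
      ultimately show False using first[of t] t by simp
    qed
    then have "E z = \<xi>" using h_om[of "E z"] omz Ez by (simp add: \<xi>_def)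
    then show ?thesis using d0 zx by auto
  qed
  have "\<exists>x. 0 < E x"
  proof (rule ccontr)
    assume "\<not> (\<exists>x. 0 < E x)"
    then have "E x = 0" for x using nonneg[of x] by (meson antisym not_le)
    moreover from this have "v x = 0" for x using vE[of x] by simp
    ultimately show False using nc by blast
  qed
  then obtain z where z: "E z = \<xi>" "E1 z = 0" using crest by blast
  have le: "E x \<le> \<xi>" for x
    using crest[of x] \<xi> by (cases "0 < E x") auto

  \<comment> \<open>At the crest the first-order equation has no uniqueness, since the constant
    \<open>\<xi>\<close> solves it as well. The comparison therefore uses the second-order equation,
    whose right side is Lipschitz on \<open>[0, \<delta>]\<close>.\<close>
  define Dx where "Dx x = E (x + z) - P.eta c x" for x
  define D1x where "D1x x = E1 (x + z) - P.U 1 c x" for x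
  define D2x where "D2x x = E2 (x + z) - P.U 2 c x" for x
  have dD: "(Dx has_real_derivative D1x x) (at x)" and dD1: "(D1x has_real_derivative D2x x) (at x)" for x
  proof -
    have s: "((\<lambda>x. x + z) has_real_derivative 1) (at x)" by (auto intro!: derivative_eq_intros)
    have "((\<lambda>x. E (x + z)) has_real_derivative E1 (x + z) * 1) (at x)"
      by (rule DERIV_chain2[OF D1 s])
    moreover have "((\<lambda>x. E1 (x + z)) has_real_derivative E2 (x + z) * 1) (at x)"
      by (rule DERIV_chain2[OF D2 s])
    moreover have "(P.U 1 c has_real_derivative P.U 2 c x) (at x)"
      using P.U_DERIV_x[OF c, of 1 x] by (simp add: numeral_2_eq_2)
    ultimately show "(Dx has_real_derivative D1x x) (at x)" "(D1x has_real_derivative D2x x) (at x)"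
      unfolding Dx_def[abs_def] D1x_def[abs_def] D2x_def using P.eta_DERIV_x[OF c, of x]
      by (auto intro!: derivative_intros)
  qed
  have lip: "\<bar>N1 a - N1 b\<bar> \<le> K * \<bar>a - b\<bar>" if "a \<in> {0..\<delta>}" "b \<in> {0..\<delta>}" for a b
  proof -
    have "norm (N1 a - N1 b) \<le> K * norm (a - b)"
    proof (rule field_differentiable_bound[where S = "{0..\<delta>}"])
      fix t assume t: "t \<in> {0..\<delta>}"
      show "(N1 has_real_derivative N2 t) (at t within {0..\<delta>})"
        using N_derivs(2)[of t] t \<delta> by (auto intro: has_field_derivative_at_within)
      show "norm (N2 t) \<le> K"
      proof (cases "t = 0")
        case False
        then have "\<bar>N2 t\<bar> \<le> K * t" using N123_bounds[of t] t by auto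
        also have "\<dots> \<le> K * 1" using K t \<delta> by (intro mult_left_mono) auto
        finally show ?thesis by simp
      qed (use N_0 K in simp)
    qed (use that in auto)
    then show ?thesis by simp
  qed
  \<comment> \<open>\<open>1\<close> accounts for the product of \<open>D1x\<close> with
    \<open>Dx\<close>, and \<open>m + K / 2\<close> for the product of \<open>D1x\<close> with
    \<open>D2x\<close>.\<close>
  define \<Lambda> where "\<Lambda> = 1 + m + K / 2"
  have D2_le: "\<bar>D2x x\<bar> \<le> (m + K / 2) * \<bar>Dx x\<bar>" for x
  proof -
    have "D2x x = m * Dx x - (N1 (E (x + z)) - N1 (P.eta c x)) / 2"
      unfolding D2x_def Dx_def second by (simp add: P.U_def m(1) field_simps)
    then have "\<bar>D2x x\<bar> \<le> \<bar>m * Dx x\<bar> + \<bar>N1 (E (x + z)) - N1 (P.eta c x)\<bar> / 2"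
      using abs_triangle_ineq4[of "m * Dx x" "(N1 (E (x + z)) - N1 (P.eta c x)) / 2"] by simp
    also have "\<dots> \<le> m * \<bar>Dx x\<bar> + K * \<bar>Dx x\<bar> / 2"
    proof (intro add_mono divide_right_mono)
      show "\<bar>N1 (E (x + z)) - N1 (P.eta c x)\<bar> \<le> K * \<bar>Dx x\<bar>"
        unfolding Dx_def using nonneg[of "x + z"] le[of "x + z"] \<xi> P.eta_mem[OF c, of x]
        by (intro lip) auto
    qed (use m(2) in \<open>auto simp: abs_mult\<close>)
    finally show ?thesis by (simp add: distrib_right)
  qed
  have "(Dx x)^2 + (D1x x)^2 = 0" for x
  proof (rule gronwall_zero[where y = "\<lambda>x. (Dx x)^2 + (D1x x)^2"
        and y' = "\<lambda>x. 2 * Dx x * D1x x + 2 * D1x x * D2x x" and \<Lambda> = \<Lambda>])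
    show "((\<lambda>x. (Dx x)^2 + (D1x x)^2) has_real_derivative 2 * Dx x * D1x x + 2 * D1x x * D2x x) (at x)" for x
      using dD[of x] dD1[of x] by (auto intro!: derivative_eq_intros)
    show "\<bar>2 * Dx x * D1x x + 2 * D1x x * D2x x\<bar> \<le> \<Lambda> * ((Dx x)^2 + (D1x x)^2)" for x
    proof -
      have "\<bar>2 * Dx x * D1x x + 2 * D1x x * D2x x\<bar> \<le> 2 * \<bar>D1x x\<bar> * \<bar>Dx x\<bar> + 2 * \<bar>D1x x\<bar> * \<bar>D2x x\<bar>"
        using abs_triangle_ineq[of "2 * Dx x * D1x x" "2 * D1x x * D2x x"] by (simp add: abs_mult mult_ac)
      also have "\<dots> \<le> 2 * \<bar>D1x x\<bar> * \<bar>Dx x\<bar> + 2 * \<bar>D1x x\<bar> * ((m + K / 2) * \<bar>Dx x\<bar>)"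
        using D2_le[of x] by (intro add_left_mono mult_left_mono) auto
      also have "\<dots> = \<Lambda> * (2 * \<bar>D1x x\<bar> * \<bar>Dx x\<bar>)" by (simp add: \<Lambda>_def algebra_simps)
      also have "\<dots> \<le> \<Lambda> * ((Dx x)^2 + (D1x x)^2)"
      proof (rule mult_left_mono)
        have "0 \<le> (\<bar>Dx x\<bar> - \<bar>D1x x\<bar>)^2" by simp
        then show "2 * \<bar>D1x x\<bar> * \<bar>Dx x\<bar> \<le> (Dx x)^2 + (D1x x)^2" unfolding power2_diff by (simp add: mult_ac)
      qed (use m K in \<open>simp add: \<Lambda>_def\<close>)
      finally show ?thesis .
    qed
    have "P.eta c 0 = \<xi>" by (simp add: P.eta_def P.W_def P.s_0[OF c] \<xi>_def m)
    then show "(Dx 0)^2 + (D1x 0)^2 = 0" using z by (simp add: Dx_def D1x_def P.U_def P.s_0[OF c])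
  qed auto
  then have eqE: "E (x + z) = P.eta c x" for x by (simp add: Dx_def sum_power2_eq_zero_iff)
  show ?thesis
  proof (intro exI[of _ "- z"] allI conjI)
    fix x
    show E: "E x = P.eta c (x + - z)" using eqE[of "x - z"] by simp
    have "v x = c / 2 * E x / (1 - E x)" using vE[of x] E_lt[of x] by (simp add: field_simps)
    then show "v x = P.V 0 c (x + - z)" unfolding E by (simp add: P.V_def)
  qed
qed

lemma Sup_eta: 
  assumes "c \<in> P.I"
  shows "Sup (range (P.eta c)) < 1"
proof -
  have "Sup (range (P.eta c)) \<le> \<delta>"
    using P.eta_mem[OF assms] by (intro cSUP_least) (auto simp: less_imp_le)
  then show ?thesis using \<delta> by simp
qed

lemma eta_nonconstant:
  assumes "c \<in> P.I"
  shows "\<not> (\<exists>a b. \<forall>x. P.eta c x = a \<and> P.V 0 c x = b)"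
proof
  assume "\<exists>a b. \<forall>x. P.eta c x = a \<and> P.V 0 c x = b"
  then obtain a where "P.eta c = (\<lambda>_. a)" by blast
  then have "((\<lambda>_. a) has_real_derivative P.U 1 c 1) (at 1)" using P.eta_DERIV_x[OF assms, of 1] by simp
  then have "P.U 1 c 1 = 0" using DERIV_unique[OF _ DERIV_const] by blast
  then show False using P.U1_neq_0[OF assms, of 1] by simp
qed

end

theorem mainTheorem1:
  fixes f f1 f2 f3 :: "real \<Rightarrow> real" and cs :: real
  assumes f_d1: "\<forall>x\<ge>0. (f has_real_derivative f1 x) (at x within {0..})"
      and f_d2: "\<forall>x\<ge>0. (f1 has_real_derivative f2 x) (at x within {0..})"
      and f_d3: "\<forall>x\<ge>0. (f2 has_real_derivative f3 x) (at x within {0..})"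
      and f_C3: "continuous_on {0..} f3"
      and f1_zero: "f 1 = 0"
      and f1_neg: "f1 1 < 0"
      and cs_def: "cs = sqrt (- 2 * f1 1)"
      and H1: "\<forall>\<rho>\<ge>0. cs^2 / 4 * (1 - \<rho>)^2 \<le> Fpot f \<rho>"
      and H2: "\<exists>M q. M \<ge> 0 \<and> q \<ge> 2 \<and> (\<forall>\<rho>\<ge>2. Fpot f \<rho> \<le> M * \<bar>1 - \<rho>\<bar> powr q)"
      and H3: "f2 1 + 3 * f1 1 \<noteq> 0"
  shows "\<exists>c0 \<in> {0<..<cs}. \<exists>\<eta> v :: real \<Rightarrow> real \<Rightarrow> real.
     (\<forall>c\<in>{c0<..<cs}.
        in_NX 2 (\<eta> c) (v c) \<and> TW_hy f c (\<eta> c) (v c) \<and>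
        \<not> (\<exists>a b. \<forall>x. \<eta> c x = a \<and> v c x = b) \<and>
        (\<forall>x. \<eta> c (- x) = \<eta> c x \<and> v c (- x) = v c x) \<and>
        (\<forall>\<eta>' v'. in_NX 2 \<eta>' v' \<and> TW_hy f c \<eta>' v' \<and> \<not> (\<exists>a b. \<forall>x. \<eta>' x = a \<and> v' x = b)
            \<longrightarrow> (\<exists>a. \<forall>x. \<eta>' x = \<eta> c (x + a) \<and> v' x = v c (x + a)))) \<and>
     C2_NX 2 {c0<..<cs} \<eta> v \<and>
     (\<forall>c\<in>{c0<..<cs}. \<exists>D. ((\<lambda>c'. momentum (\<eta> c') (v c')) has_real_derivative D) (at c) \<and> D < 0) \<and>
     has_pds \<eta> {c0<..<cs} 2 3 \<and> has_pds v {c0<..<cs} 2 2 \<and>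
     (\<exists>ad Kd. ad > 0 \<and> Kd > 0 \<and>
        (\<forall>c\<in>{c0<..<cs}. \<forall>x.
           (\<Sum>k1\<le>3. \<Sum>k2\<le>2. \<Sum>j\<le>2::nat.
              (cs^2 - c^2) powi (int j - 1) *
              (\<bar>pd \<eta> j k1 c x\<bar> + c ^ (1 + 2*j + 2*k2) * \<bar>pd v j k2 c x\<bar>))
           \<le> Kd * exp (- ad * sqrt (cs^2 - c^2) * \<bar>x\<bar>)))"
proof -
  interpret pressure f f1 f2 f3 cs
    by unfold_locales (rule f_d1 f_d2 f_d3 f_C3 f1_zero f1_neg cs_def H1)+
  obtain \<delta> K where "small_pressure f f1 f2 f3 cs \<delta> K"
  proof (rule small_interval)
    fix \<delta> K assume "0 < \<delta>" "\<delta> < 1" "0 \<le> K"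
      "\<And>e. e \<in> {0<..\<delta>} \<Longrightarrow> cs^2 / 2 * e^3 \<le> Dn e"
      "\<And>e. e \<in> {0<..\<delta>} \<Longrightarrow> cs^2 / 2 * e^3 \<le> N e \<and> N e \<le> K * e^3"
      "\<And>e. e \<in> {0<..\<delta>} \<Longrightarrow> \<bar>N1 e\<bar> \<le> K * e^2 \<and> \<bar>N2 e\<bar> \<le> K * e \<and> \<bar>N3 e\<bar> \<le> K \<and> \<bar>N4 e\<bar> \<le> K"
      "\<And>e. e \<in> {0<..\<delta>} \<Longrightarrow> 7/8 \<le> qt e \<and> qt e \<le> 2 \<and> \<bar>e * qt' e\<bar> \<le> 1/32"
    then have "small_pressure f f1 f2 f3 cs \<delta> K" by unfold_locales
    then show thesis by (rule that)
  qed
  then interpret small_pressure f f1 f2 f3 cs \<delta> K .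
  \<comment> \<open>This will be \<open>cs\<^sup>2 - c0\<^sup>2\<close>. The bound by
    \<open>w\<close> keeps all \<open>cs\<^sup>2 - c\<^sup>2\<close> in the domain of
    \<open>h\<close>; the bound by \<open>cs\<^sup>2 / 2\<close> gives \<open>c0 > 0\<close> and
    \<open>cs\<^sup>2 \<le> 2 c0\<^sup>2\<close>, which is within the \<open>3 c0\<^sup>2\<close>
    required for the momentum.\<close>
  define t where "t = min w (cs^2 / 2)"
  define c0 where "c0 = sqrt (cs^2 - t)"
  have t: "0 < t" "t \<le> w" "t \<le> cs^2 / 2" using w_pos cs_pos by (auto simp: t_def)
  have c0sq: "c0^2 = cs^2 - t" using t cs_pos by (simp add: c0_def)
  have c0_less: "0 < c0" "c0 < cs"
  proof -
    have "0 < cs^2 - t" using t cs_pos by simp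
    then show "0 < c0" by (simp add: c0_def)
    have "c0^2 < cs^2" using c0sq t by simp
    then show "c0 < cs" using cs_pos by (simp add: power2_less_imp_less)
  qed
  interpret wave f f1 f2 f3 cs \<delta> K c0
  proof unfold_locales
    show "cs^2 - c0^2 \<le> w" "cs^2 \<le> 3 * c0^2" unfolding c0sq using t by auto
  qed (use c0_less in auto)
  have I: "P.I = {c0<..<cs}" by (simp add: P.I_def)
  obtain D D' :: "nat \<Rightarrow> nat \<Rightarrow> real \<Rightarrow> real \<Rightarrow> real" and M :: real where fam:
    "C2_family P.I 3 (\<lambda>k. D k 0) (\<lambda>k. D k 1) (\<lambda>k. D k 2)"
    "C2_family P.I 2 (\<lambda>k. D' k 0) (\<lambda>k. D' k 1) (\<lambda>k. D' k 2)"
    "D 0 0 = P.eta" "D' 0 0 = P.V 0" "has_pds P.eta P.I 2 3" "has_pds (P.V 0) P.I 2 2" "0 \<le> M"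
    "\<And>j k c x. j \<le> 2 \<Longrightarrow> k \<le> 3 \<Longrightarrow> c \<in> P.I \<Longrightarrow> P.m c ^ j * \<bar>pd P.eta j k c x\<bar> \<le> M * P.m c * P.E c x"
    "\<And>j k c x. j \<le> 2 \<Longrightarrow> k \<le> 2 \<Longrightarrow> c \<in> P.I \<Longrightarrow> P.m c ^ j * \<bar>pd (P.V 0) j k c x\<bar> \<le> M * P.m c * P.E c x"
    using P.families by metis
  have C2: "C2_NX 2 P.I P.eta (P.V 0)"
    using C2_NX_families[of P.I 2 "\<lambda>k. D k 0" "\<lambda>k. D k 1" "\<lambda>k. D k 2" "\<lambda>k. D' k 0" "\<lambda>k. D' k 1" "\<lambda>k. D' k 2"]
      fam Sup_eta by simp
  then have NX: "in_NX 2 (P.eta c) (P.V 0 c)" if "c \<in> P.I" for c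
    using that unfolding C2_NX_def by blast
  have even: "P.eta c (- x) = P.eta c x \<and> P.V 0 c (- x) = P.V 0 c x" if "c \<in> P.I" for c x
    using P.eta_minus[OF that] by (simp add: P.V_def)
  have mom: "\<exists>D. ((\<lambda>c'. momentum (P.eta c') (P.V 0 c')) has_real_derivative D) (at c) \<and> D < 0" if "c \<in> P.I" for c
    by (rule P.momentum_decreasing[OF _ c0(4) that])
      (use q_estimates in auto)
  \<comment> \<open>The summand \<open>1\<close> keeps \<open>Kd\<close> positive even if
    \<open>M = 0\<close>.\<close>
  define Kd where "Kd = 36 * (M + (1 + cs) ^ 9 * M) + 1"
  have decay: "(\<Sum>k1\<le>3. \<Sum>k2\<le>2. \<Sum>j\<le>2::nat. (cs^2 - c^2) powi (int j - 1) *
      (\<bar>pd P.eta j k1 c x\<bar> + c ^ (1 + 2*j + 2*k2) * \<bar>pd (P.V 0) j k2 c x\<bar>))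
      \<le> Kd * exp (- (1/4) * sqrt (cs^2 - c^2) * \<bar>x\<bar>)" if "c \<in> P.I" for c x
  proof -
    have E: "P.E c x = exp (- (1/4) * sqrt (cs^2 - c^2) * \<bar>x\<bar>)" by (simp add: P.E_def P.m_def)
    have "36 * ((M + (1 + cs) ^ 9 * M) * P.E c x) \<le> Kd * P.E c x"
      unfolding Kd_def E by (simp add: algebra_simps)
    then show ?thesis
      using P.decay_estimate[OF fam(7-9) that, of x] unfolding E P.m_def by (rule order_trans[rotated])
  qed
  have "0 < Kd" using fam(7) cs_pos by (simp add: Kd_def add_nonneg_pos)
  then have "\<exists>ad Kd. ad > 0 \<and> Kd > 0 \<and> (\<forall>c\<in>P.I. \<forall>x. (\<Sum>k1\<le>3. \<Sum>k2\<le>2. \<Sum>j\<le>2::nat. (cs^2 - c^2) powi (int j - 1) *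
      (\<bar>pd P.eta j k1 c x\<bar> + c ^ (1 + 2*j + 2*k2) * \<bar>pd (P.V 0) j k2 c x\<bar>))
      \<le> Kd * exp (- ad * sqrt (cs^2 - c^2) * \<bar>x\<bar>))"
    using decay by (intro exI[of _ "1/4"] exI[of _ Kd]) auto
  then show ?thesis
    using c0_less NX TW_profile eta_nonconstant even TW_unique C2 mom fam(5,6)
    unfolding I by (intro bexI[of _ c0] exI[of _ P.eta] exI[of _ "P.V 0"]) auto
qed

end
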